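(* Let $G$ be a non-trivial compact Hausdorff topological group, and for positive integers $n$ let $E_nG := G^{*(n+1)}$ denote the join of $n+1$ copies of $G$, equipped with the diagonal action of $G$. Then, for every positive integer $n$, there are no continuous $G$-equivariant maps $E_{n+1}G\to E_nG$.
   Context: For compact Hausdorff spaces $X,Y$, the topological join $X*Y$ is the quotient of $X\times Y\times[0,1]$ by the relation which, for each fixed $y_0\in Y$, identifies all points $(x,y_0,0)$ ($x\in X$), and, for each fixed $x_0\in X$, identifies all points $(x_0,y,1)$ ($y\in Y$). The iterated join $G^{*(n+1)}=G*\cdots*G$ ($n+1$ factors) has points written as formal convex combinations $t_0g_0+\cdots+t_ng_n$ with $g_i\in G$, $t_i\in[0,1]$, $\sum_i t_i=1$ (where $g_i$ is disregarded when $t_i=0$). The diagonal action is $(t_0g_0+\cdots+t_ng_n)\cdot g = t_0g_0g+\cdots+t_ng_ng$. *)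

theory Defs
  imports "HOL-Analysis.Analysis" "HOL-Algebra.Group"
begin

locale topological_group = group G for G (structure) +
  fixes T :: "'a topology"
  assumes topspace_eq: "topspace T = carrier G"
    and continuous_mult: "continuous_map (prod_topology T T) T (\<lambda>(x, y). x \<otimes> y)"
    and continuous_inv: "continuous_map T T (\<lambda>x. inv x)"

text \<open>The quotient (final) topology that \<^term>\<open>f\<close> induces on the image of \<^term>\<open>topspace X\<close>.\<close>

definition quotient_topology :: "'a topology \<Rightarrow> ('a \<Rightarrow> 'b) \<Rightarrow> 'b topology" where
  "quotient_topology X f =
     topology (\<lambda>U. U \<subseteq> f ` topspace X \<and> openin X {x \<in> topspace X. f x \<in> U})"

lemma openin_quotient_topology:
  "openin (quotient_topology X f) U \<longleftrightarrow>
     U \<subseteq> f ` topspace X \<and> openin X {x \<in> topspace X. f x \<in> U}"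
proof -
  have "istopology (\<lambda>U. U \<subseteq> f ` topspace X \<and> openin X {x \<in> topspace X. f x \<in> U})"
    unfolding istopology_def
  proof (intro conjI allI impI; (elim conjE)?)
    fix S U assume "S \<subseteq> f ` topspace X" "openin X {x \<in> topspace X. f x \<in> S}"
      "openin X {x \<in> topspace X. f x \<in> U}"
    moreover have "{x \<in> topspace X. f x \<in> S \<inter> U} =
        {x \<in> topspace X. f x \<in> S} \<inter> {x \<in> topspace X. f x \<in> U}" by auto
    ultimately show "S \<inter> U \<subseteq> f ` topspace X" "openin X {x \<in> topspace X. f x \<in> S \<inter> U}"
      by auto
  next
    fix \<K> assume \<K>: "\<forall>K\<in>\<K>. K \<subseteq> f ` topspace X \<and> openin X {x \<in> topspace X. f x \<in> K}"
    then show "\<Union>\<K> \<subseteq> f ` topspace X" by blast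
    have "{x \<in> topspace X. f x \<in> \<Union>\<K>} = \<Union>((\<lambda>K. {x \<in> topspace X. f x \<in> K}) ` \<K>)" by auto
    with \<K> show "openin X {x \<in> topspace X. f x \<in> \<Union>\<K>}" by auto
  qed
  then show ?thesis
    by (simp add: quotient_topology_def topology_inverse')
qed

lemma topspace_quotient_topology [simp]: "topspace (quotient_topology X f) = f ` topspace X"
proof
  show "topspace (quotient_topology X f) \<subseteq> f ` topspace X"
    using openin_quotient_topology[of X f "topspace (quotient_topology X f)"] by simp
  have "{x \<in> topspace X. f x \<in> f ` topspace X} = topspace X" by auto
  then have "openin (quotient_topology X f) (f ` topspace X)"
    by (simp add: openin_quotient_topology)
  then show "f ` topspace X \<subseteq> topspace (quotient_topology X f)"
    by (rule openin_subset)
qed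

lemma quotient_map_quotient_topology: "quotient_map X (quotient_topology X f) f"
  by (auto simp: quotient_map_def openin_quotient_topology)

text \<open>The join of two spaces: the points are the equivalence classes of \<^term>\<open>join_rel X Y\<close>.\<close>

definition join_rel :: "'a topology \<Rightarrow> 'b topology \<Rightarrow> (('a \<times> 'b \<times> real) \<times> ('a \<times> 'b \<times> real)) set" where
  "join_rel X Y =
     {((x, y, t), (x', y', t')). {x, x'} \<subseteq> topspace X \<and> {y, y'} \<subseteq> topspace Y \<and> t \<in> {0..1} \<and> t' = t \<and>
        (x = x' \<and> y = y' \<or> t = 0 \<and> y = y' \<or> t = 1 \<and> x = x')}"

definition join_space :: "'a topology \<Rightarrow> 'b topology \<Rightarrow> ('a \<times> 'b \<times> real) set topology" where
  "join_space X Y =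
     quotient_topology (prod_topology X (prod_topology Y (top_of_set {0..1})))
       (\<lambda>p. join_rel X Y `` {p})"

lemma equiv_join_rel: "equiv (topspace X \<times> topspace Y \<times> {0..1}) (join_rel X Y)"
  by (auto simp: equiv_def refl_on_def sym_def trans_def join_rel_def)

lemma topspace_join_space:
  "topspace (join_space X Y) = (topspace X \<times> topspace Y \<times> {0..1}) // join_rel X Y"
  by (auto simp: join_space_def quotient_def)

text \<open>Formal convex combinations \<open>t\<^sub>0 g\<^sub>0 + t\<^sub>1 g\<^sub>1 + \<dots>\<close>. The value at \<open>i\<close> is
  \<open>Some (g\<^sub>i, t\<^sub>i)\<close> if \<open>t\<^sub>i > 0\<close>, and \<open>None\<close> if \<open>t\<^sub>i = 0\<close>, so that \<open>g\<^sub>i\<close> is disregarded in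
  that case.\<close>

type_synonym 'a formal_comb = "nat \<Rightarrow> ('a \<times> real) option"

definition coeff_at :: "'a formal_comb \<Rightarrow> nat \<Rightarrow> real" where
  "coeff_at c i = (case c i of None \<Rightarrow> 0 | Some (g, t) \<Rightarrow> t)"

definition convex_combs :: "'a set \<Rightarrow> nat \<Rightarrow> 'a formal_comb set" where
  "convex_combs A n =
     {c. (\<forall>i>n. c i = None) \<and> (\<forall>i g t. c i = Some (g, t) \<longrightarrow> g \<in> A \<and> 0 < t) \<and>
         (\<Sum>i\<le>n. coeff_at c i) = 1}"

text \<open>\<open>append_comb n (c, h, t)\<close> is the combination \<open>t c + (1 - t) h\<close> with \<open>h\<close> in position
  \<^term>\<open>Suc n\<close>. The weights match \<^const>\<open>join_rel\<close>, which forgets \<open>c\<close> at \<open>t = 0\<close> and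
  \<open>h\<close> at \<open>t = 1\<close>.\<close>

definition append_comb :: "nat \<Rightarrow> 'a formal_comb \<times> 'a \<times> real \<Rightarrow> 'a formal_comb" where
  "append_comb n = (\<lambda>(c, h, t) i.
     if i = Suc n then (if t = 1 then None else Some (h, 1 - t))
     else if t = 0 then None
     else map_option (\<lambda>(g, s). (g, t * s)) (c i))"

text \<open>The \<open>(n+1)\<close>-fold join of \<^term>\<open>T\<close>. Each binary join is a topology on a new type of
  equivalence classes, so a recursion over \<open>n\<close> has to rename its points: the class of \<open>(c, h, t)\<close>
  becomes \<open>t c + (1 - t) h\<close>. By \<open>homeomorphic_map_join_power\<close> below the renaming is a
  homeomorphism.\<close>

primrec join_power :: "'a topology \<Rightarrow> nat \<Rightarrow> 'a formal_comb topology" where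
  "join_power T 0 = quotient_topology T (\<lambda>g. [0 \<mapsto> (g, 1)])"
| "join_power T (Suc n) =
     quotient_topology (join_space (join_power T n) T) (\<lambda>C. the_elem (append_comb n ` C))"

definition diag_action :: "('a, 'b) monoid_scheme \<Rightarrow> 'a formal_comb \<Rightarrow> 'a \<Rightarrow> 'a formal_comb" where
  "diag_action G c g = (\<lambda>i. map_option (\<lambda>(h, t). (h \<otimes>\<^bsub>G\<^esub> g, t)) (c i))"

definition equivariant_map ::
  "('a, 'b) monoid_scheme \<Rightarrow> 'a formal_comb set \<Rightarrow> ('a formal_comb \<Rightarrow> 'a formal_comb) \<Rightarrow> bool" where
  "equivariant_map G S f \<longleftrightarrow>
     (\<forall>c\<in>S. \<forall>g\<in>carrier G. f (diag_action G c g) = diag_action G (f c) g)"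

lemma append_comb_eq_iff:
  assumes "c \<in> convex_combs A n" "c' \<in> convex_combs A n" "t \<in> {0..1}" "t' \<in> {0..1}"
  shows "append_comb n (c, h, t) = append_comb n (c', h', t') \<longleftrightarrow>
         t' = t \<and> (c = c' \<and> h = h' \<or> t = 0 \<and> h = h' \<or> t = 1 \<and> c = c')" (is "?l \<longleftrightarrow> ?r")
proof
  assume eq: ?l
  have at: "append_comb n (c, h, t) i = append_comb n (c', h', t') i" for i
    using eq by simp
  have tt: "t' = t" and hh: "t \<noteq> 1 \<Longrightarrow> h = h'"
    using at[of "Suc n"] by (auto simp: append_comb_def split: if_splits)
  have cc: "c = c'" if "t \<noteq> 0"
  proof
    fix i
    show "c i = c' i"
    proof (cases "i = Suc n")
      case True
      then show ?thesis using assms by (simp add: convex_combs_def)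
    next
      case False
      with at[of i] tt that have
        "map_option (\<lambda>(g, s). (g, t * s)) (c i) = map_option (\<lambda>(g, s). (g, t * s)) (c' i)"
        by (simp add: append_comb_def)
      with that show ?thesis by (cases "c i"; cases "c' i") auto
    qed
  qed
  show ?r using tt hh cc by (cases "t = 0") auto
next
  assume ?r
  then show ?l by (auto simp: append_comb_def fun_eq_iff)
qed

lemma append_comb_in:
  assumes "c \<in> convex_combs A n" "h \<in> A" "t \<in> {0..1}"
  shows "append_comb n (c, h, t) \<in> convex_combs A (Suc n)"
proof -
  have 1: "coeff_at (append_comb n (c, h, t)) i = t * coeff_at c i" if "i \<le> n" for i
    using that by (auto simp: coeff_at_def append_comb_def split: option.splits)
  have 2: "coeff_at (append_comb n (c, h, t)) (Suc n) = 1 - t"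
    by (auto simp: coeff_at_def append_comb_def)
  have "(\<Sum>i\<le>Suc n. coeff_at (append_comb n (c, h, t)) i) = 1"
    using assms(1) by (simp add: 1 2 sum_distrib_left[symmetric] convex_combs_def)
  moreover have "g \<in> A \<and> 0 < s" if "append_comb n (c, h, t) i = Some (g, s)" for i g s
    using that assms by (auto simp: append_comb_def convex_combs_def split: if_splits)
  ultimately show ?thesis
    using assms(1) by (auto simp: convex_combs_def append_comb_def)
qed

lemma append_comb_surj:
  assumes "d \<in> convex_combs A (Suc n)"
  shows "d \<in> append_comb n ` (convex_combs A n \<times> A \<times> {0..1})"
proof -
  have pos: "g \<in> A" "0 < s" if "d i = Some (g, s)" for i g s
    using assms that by (auto simp: convex_combs_def)
  have nonneg: "0 \<le> coeff_at d i" for i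
    using pos by (fastforce simp: coeff_at_def split: option.splits)
  have none: "d i = None" if "coeff_at d i = 0" for i
    using pos that by (fastforce simp: coeff_at_def split: option.splits)
  define t where "t = (\<Sum>i\<le>n. coeff_at d i)"
  have t: "t = 1 - coeff_at d (Suc n)" "0 \<le> t" "t \<le> 1"
    using assms nonneg[of "Suc n"] by (auto simp: t_def convex_combs_def intro: sum_nonneg nonneg)
  have above: "d i = None" if "i > Suc n" for i
    using assms that by (simp add: convex_combs_def)
  show ?thesis
  proof (cases "t = 0")
    case True
    then have "coeff_at d (Suc n) = 1" using t by simp
    then obtain h where h: "d (Suc n) = Some (h, 1)"
      by (auto simp: coeff_at_def split: option.splits)
    have "d i = None" if "i \<le> n" for i
      using True nonneg that unfolding t_def
      by (intro none) (simp add: sum_nonneg_eq_0_iff)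
    then have "d = append_comb n ([0 \<mapsto> (h, 1)], h, 0)"
      using h above by (auto simp: fun_eq_iff append_comb_def) (metis not_less_eq_eq linorder_not_less le_antisym)
    moreover have "[0 \<mapsto> (h, 1)] \<in> convex_combs A n"
    proof -
      have "coeff_at [0 \<mapsto> (h, 1)] i = (if i = 0 then 1 else 0)" for i
        by (simp add: coeff_at_def)
      then show ?thesis using pos(1)[OF h] by (simp add: convex_combs_def split: if_splits)
    qed
    ultimately show ?thesis using pos(1)[OF h] by force
  next
    case False
    define c where "c = (\<lambda>i. if i = Suc n then None else map_option (\<lambda>(g, s). (g, s / t)) (d i))"
    have "coeff_at c i = coeff_at d i / t" if "i \<le> n" for i
      using that by (auto simp: c_def coeff_at_def split: option.splits)
    then have "(\<Sum>i\<le>n. coeff_at c i) = 1"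
      using False by (simp add: sum_divide_distrib[symmetric] t_def[symmetric])
    then have c: "c \<in> convex_combs A n"
      using pos above t False by (auto simp: convex_combs_def c_def split: if_splits)
    have "\<exists>h\<in>A. d (Suc n) = (if t = 1 then None else Some (h, 1 - t))"
    proof (cases "d (Suc n)")
      case None
      have "\<exists>i\<le>n. coeff_at d i \<noteq> 0" using False unfolding t_def by (meson atMost_iff sum.neutral)
      then obtain i g s where "d i = Some (g, s)"
        by (auto simp: coeff_at_def split: option.splits)
      then show ?thesis using pos None t by (auto simp: coeff_at_def)
    next
      case (Some p)
      then show ?thesis using pos t by (cases p) (fastforce simp: coeff_at_def)
    qed
    then obtain h where h: "h \<in> A" "d (Suc n) = (if t = 1 then None else Some (h, 1 - t))"
      by blast
    have "d = append_comb n (c, h, t)"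
    proof
      fix i show "d i = append_comb n (c, h, t) i"
        using h False by (cases "d i") (auto simp: append_comb_def c_def)
    qed
    moreover have "(c, h, t) \<in> convex_combs A n \<times> A \<times> {0..1}" using c h(1) t by simp
    ultimately show ?thesis by (rule image_eqI)
  qed
qed

lemma append_comb_class:
  assumes "topspace E = convex_combs (topspace T) n"
    and "p \<in> topspace E \<times> topspace T \<times> {0..1}"
  shows "append_comb n ` (join_rel E T `` {p}) = {append_comb n p}"
proof -
  obtain c h t where p: "p = (c, h, t)" by (cases p)
  have "append_comb n q = append_comb n p" if "(p, q) \<in> join_rel E T" for q
  proof -
    obtain c' h' t' where q: "q = (c', h', t')" by (cases q)
    show ?thesis
      using that assms append_comb_eq_iff[of c "topspace T" n c' t t' h h']
      unfolding p q by (auto simp: join_rel_def)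
  qed
  moreover have "(p, p) \<in> join_rel E T"
    using assms by (auto simp: join_rel_def)
  ultimately show ?thesis by blast
qed

theorem topspace_join_power: "topspace (join_power T n) = convex_combs (topspace T) n"
proof (induction n)
  case 0
  have "c \<in> (\<lambda>g. [0 \<mapsto> (g, 1)]) ` topspace T" if "c \<in> convex_combs (topspace T) 0" for c
  proof -
    have "coeff_at c 0 = 1" using that by (simp add: convex_combs_def)
    then obtain g where g: "c 0 = Some (g, 1)"
      by (auto simp: coeff_at_def split: option.splits)
    then have "c = [0 \<mapsto> (g, 1)]" using that by (auto simp: convex_combs_def fun_eq_iff)
    moreover have "g \<in> topspace T" using g that by (simp add: convex_combs_def)
    ultimately show ?thesis by (rule image_eqI)
  qed
  then show ?case
    by (auto simp: convex_combs_def coeff_at_def split: if_splits)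
next
  case (Suc n)
  have "topspace (join_power T (Suc n)) =
      append_comb n ` (topspace (join_power T n) \<times> topspace T \<times> {0..1})"
    by (simp add: join_space_def image_image append_comb_class[OF Suc] cong: image_cong)
  also have "\<dots> = convex_combs (topspace T) (Suc n)"
    unfolding Suc using append_comb_surj append_comb_in by fastforce
  finally show ?case .
qed

theorem homeomorphic_map_join_power:
  "homeomorphic_map (join_space (join_power T n) T) (join_power T (Suc n))
     (\<lambda>C. the_elem (append_comb n ` C))"
proof -
  let ?E = "join_power T n"
  let ?S = "topspace ?E \<times> topspace T \<times> {0..1::real}"
  note E = topspace_join_power[of T n]
  have "inj_on (\<lambda>C. the_elem (append_comb n ` C)) (?S // join_rel ?E T)"
  proof (rule inj_onI)
    fix C D
    assume CD: "C \<in> ?S // join_rel ?E T" "D \<in> ?S // join_rel ?E T"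
      and eq: "the_elem (append_comb n ` C) = the_elem (append_comb n ` D)"
    obtain p where p: "p \<in> ?S" "C = join_rel ?E T `` {p}" using CD(1) by (rule quotientE)
    obtain q where q: "q \<in> ?S" "D = join_rel ?E T `` {q}" using CD(2) by (rule quotientE)
    have "append_comb n p = append_comb n q"
      using eq p q append_comb_class[OF E] by simp
    moreover obtain c h t c' h' t' where "p = (c, h, t)" "q = (c', h', t')"
      by (cases p, cases q)
    ultimately have "(p, q) \<in> join_rel ?E T"
      using p(1) q(1) E append_comb_eq_iff[of c "topspace T" n c' t t' h h']
      by (auto simp: join_rel_def)
    then show "C = D"
      using p q equiv_class_eq[OF equiv_join_rel] by metis
  qed
  then show ?thesis
    by (simp add: homeomorphic_map_def topspace_join_space quotient_map_quotient_topology)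
qed

theorem homeomorphic_map_join_power_0:
  "homeomorphic_map T (join_power T 0) (\<lambda>g. [0 \<mapsto> (g, 1)])"
proof -
  have "inj_on (\<lambda>g. [0 \<mapsto> (g, 1::real)]) (topspace T)"
    by (rule inj_onI) (metis fun_upd_same option.inject prod.inject)
  then show ?thesis
    by (simp add: homeomorphic_map_def quotient_map_quotient_topology)
qed

lemma (in group) diag_action_in_convex_combs:
  assumes "c \<in> convex_combs (carrier G) n" "g \<in> carrier G"
  shows "diag_action G c g \<in> convex_combs (carrier G) n"
proof -
  have "coeff_at (diag_action G c g) i = coeff_at c i" for i
    by (auto simp: coeff_at_def diag_action_def split: option.splits)
  then show ?thesis
    using assms by (auto simp: convex_combs_def diag_action_def)
qed

end

(* Joining an equivariant map E_{n+1} -> E_n with the identity of G gives equivariant maps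
   E_m -> E_n for all m >= n, and three cases arise.

   If h in G nearly has prime order p and a function phi on G satisfies
   phi(x h^k) = zeta^(a k) phi(x) approximately, where zeta = exp(2 pi i/p), then finitely many
   left translates of phi without common zero extend to E_n. Pulled back to a high join power of
   Z/p and averaged, they become nowhere simultaneously vanishing equivariant complex functions,
   whose number does not depend on the dimension of the join: this contradicts Borsuk-Ulam for
   Z/p. Such h and phi exist if G has torsion, and also if some phi is an eigenfunction of a
   translation whose eigenvalue is not a root of unity.

   If the identity component is nontrivial, Peter-Weyl theory provides such an eigenfunction: were
   all eigenvalues roots of unity, the trace of the translations on an eigenspace of a convolution
   operator would be countably valued, hence constant on the identity component, which would then
   fix the eigenspace pointwise; a suitable choice of the operator excludes this.

   If G is torsion-free and totally disconnected, it contains free abelian groups of every rank,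
   so Euclidean space of dimension n + 1 maps equivariantly under a lattice to E_n. The slots of
   E_n then give n + 1 locally constant integer functions on open sets covering the space which
   are at bounded distance from the coordinates, contrary to Sperner's lemma. *)

theory Submission
  imports Defs "HOL-Homology.Simplices" "HOL-Complex_Analysis.Great_Picard"
    "Jordan_Normal_Form.Schur_Decomposition"
begin

section \<open>Joins\<close>

text \<open>The approximate formulation is forced by the order of choices. An element of exact order
  \<open>p\<close> need not exist, so \<open>k \<mapsto> h^k\<close> is no homomorphism from Z/p; on
  joins it fails by a multiplication with \<open>h^p\<close> in some slots, which is harmless if
  \<open>h^p\<close> lies in a small neighbourhood \<open>W\<close> of the identity. For an
  eigenvalue that is not a root of unity, \<open>p\<close> and \<open>h\<close> can only be found
  when \<open>W\<close> is known. This is possible because \<open>W\<close> and the tolerance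
  \<open>e\<close> do not depend on \<open>p\<close>: the dimension in which Borsuk-Ulam is applied
  is the same for all \<open>p\<close>. The operator in the second case comes from
  \<open>f x = \<psi> x - \<psi> (h \<otimes> x)\<close> with \<open>h\<close> in the identity
  component. It annihilates all functions invariant under left translation by \<open>h\<close>, so
  these cannot belong to a positive eigenvalue. In the last case the coordinates of a group element
  come from a choice of coset representatives and are not continuous. They are constant along paths,
  since paths in a totally disconnected group do not move. One coordinate is taken for each of the
  \<open>n + 1\<close> slots, so that a slot of large weight contradicts the cell found by Sperner's
  lemma.\<close>

lemma continuous_map_compose_app:
  "continuous_map X Y f \<Longrightarrow> continuous_map Y Z g \<Longrightarrow> continuous_map X Z (\<lambda>x. g (f x))"
  using continuous_map_compose[of X Y f Z g] by (simp add: o_def)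

lemma continuous_map_compose2_euclidean:
  assumes "continuous_map X euclidean f" "continuous_map X euclidean g"
    and "continuous_on UNIV (\<lambda>p. h (fst p) (snd p))"
  shows "continuous_map X euclidean (\<lambda>x. h (f x) (g x))"
proof -
  have "continuous_map X euclidean (\<lambda>x. (f x, g x))"
    using assms(1,2) by (simp add: continuous_map_paired flip: prod_topology_euclidean)
  from continuous_map_compose_app[OF this, of euclidean "\<lambda>p. h (fst p) (snd p)"]
  show ?thesis using assms(3) by simp
qed

lemma continuous_map_scaleR_euclidean:
  fixes g :: "'a \<Rightarrow> 'b::real_normed_vector"
  assumes "continuous_map X euclideanreal f" "continuous_map X euclidean g"
  shows "continuous_map X euclidean (\<lambda>x. f x *\<^sub>R g x)"
  by (rule continuous_map_compose2_euclidean[OF assms]) (intro continuous_intros)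

lemma continuous_map_mult_euclidean:
  fixes g :: "'a \<Rightarrow> 'b::real_normed_algebra"
  assumes "continuous_map X euclidean f" "continuous_map X euclidean g"
  shows "continuous_map X euclidean (\<lambda>x. f x * g x)"
  by (rule continuous_map_compose2_euclidean[OF assms]) (intro continuous_intros)

lemma continuous_map_join_param:
  "continuous_map (prod_topology X (prod_topology Y (top_of_set {0..1::real}))) X fst"
  "continuous_map (prod_topology X (prod_topology Y (top_of_set {0..1::real}))) Y (\<lambda>p. fst (snd p))"
  "continuous_map (prod_topology X (prod_topology Y (top_of_set {0..1::real}))) euclideanreal (\<lambda>p. snd (snd p))"
proof -
  let ?P = "prod_topology X (prod_topology Y (top_of_set {0..1::real}))"
  show "continuous_map ?P X fst" by (rule continuous_map_fst)
  show "continuous_map ?P Y (\<lambda>p. fst (snd p))"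
    by (rule continuous_map_compose_app[OF continuous_map_snd continuous_map_fst])
  have "continuous_map ?P (top_of_set {0..1::real}) (\<lambda>p. snd (snd p))"
    by (rule continuous_map_compose_app[OF continuous_map_snd continuous_map_snd])
  then show "continuous_map ?P euclideanreal (\<lambda>p. snd (snd p))"
    by (rule continuous_map_into_fulltopology)
qed

text \<open>Carries a function on the group to slot \<open>i\<close> of the join. For a continuous
  \<open>\<phi>\<close> the factor \<open>t\<close> makes the default 0 a continuous continuation to
  the points where the slot is absent.\<close>

definition comb_val :: "('a \<Rightarrow> 'c::real_vector) \<Rightarrow> nat \<Rightarrow> 'a formal_comb \<Rightarrow> 'c" where
  "comb_val \<phi> i c = (case c i of None \<Rightarrow> 0 | Some (g, t) \<Rightarrow> t *\<^sub>R \<phi> g)"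

text \<open>Membership includes that the slot is present. For an open \<open>A\<close> this is an
  open condition, although the group element of a slot is not defined everywhere; together with the
  coefficients these conditions decide continuity into the join.\<close>

definition comb_slot :: "nat \<Rightarrow> 'a set \<Rightarrow> 'a formal_comb set" where
  "comb_slot i A = {c. \<exists>g t. c i = Some (g, t) \<and> g \<in> A}"

lemma coeff_at_eq_comb_val: "coeff_at c i = comb_val (\<lambda>_. 1) i c"
  by (auto simp: coeff_at_def comb_val_def split: option.splits)

lemma join_power_in:
  assumes "c \<in> topspace (join_power T n)" "c i = Some (g, t)"
  shows "g \<in> topspace T" "0 < t" "i \<le> n" "t \<le> 1"
proof -
  have c: "c \<in> convex_combs (topspace T) n" using assms by (simp add: topspace_join_power)
  show "g \<in> topspace T" "0 < t" "i \<le> n"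
    using c assms(2) by (auto simp: convex_combs_def intro: leI)
  have "0 \<le> coeff_at c j" for j
    using c by (fastforce simp: coeff_at_def convex_combs_def split: option.splits)
  then have "coeff_at c i \<le> (\<Sum>i\<le>n. coeff_at c i)" using \<open>i \<le> n\<close>
    by (intro member_le_sum) auto
  then show "t \<le> 1" using c assms(2) by (simp add: convex_combs_def coeff_at_def)
qed

lemma join_power_ex_slot:
  assumes "c \<in> topspace (join_power T n)"
  obtains i g t where "i \<le> n" "c i = Some (g, t)" "0 < t" "g \<in> topspace T"
proof -
  have c: "c \<in> convex_combs (topspace T) n" using assms by (simp add: topspace_join_power)
  then have "(\<Sum>i\<le>n. coeff_at c i) \<noteq> 0" by (simp add: convex_combs_def)
  then obtain i where "i \<le> n" "coeff_at c i \<noteq> 0" by (meson atMost_iff sum.neutral)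
  then obtain g t where "c i = Some (g, t)" by (auto simp: coeff_at_def split: option.splits)
  then show thesis using that \<open>i \<le> n\<close> join_power_in[OF assms] by blast
qed

text \<open>Merges the passage to equivalence classes with the renaming of the classes, so that
  arguments about \<open>join_power T (Suc n)\<close> can work with triples instead of
  classes.\<close>

lemma quotient_map_append_comb:
  "quotient_map (prod_topology (join_power T n) (prod_topology T (top_of_set {0..1})))
     (join_power T (Suc n)) (append_comb n)"
proof -
  let ?P = "prod_topology (join_power T n) (prod_topology T (top_of_set {0..1::real}))"
  have "quotient_map ?P (join_power T (Suc n))
      ((\<lambda>C. the_elem (append_comb n ` C)) \<circ> (\<lambda>p. join_rel (join_power T n) T `` {p}))"
    by (rule quotient_map_compose[of _ "join_space (join_power T n) T"])
       (auto simp: join_space_def quotient_map_quotient_topology)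
  moreover have "((\<lambda>C. the_elem (append_comb n ` C)) \<circ> (\<lambda>p. join_rel (join_power T n) T `` {p})) p
      = append_comb n p" if "p \<in> topspace ?P" for p
    using that append_comb_class[OF topspace_join_power, of p T n] by simp
  ultimately show ?thesis
    using quotient_map_eq by blast
qed

lemma continuous_map_append_comb:
  "continuous_map (prod_topology (join_power T n) (prod_topology T (top_of_set {0..1})))
     (join_power T (Suc n)) (append_comb n)"
  by (rule quotient_imp_continuous_map[OF quotient_map_append_comb])

lemma compact_space_join_power:
  assumes "compact_space T"
  shows "compact_space (join_power T n)"
proof (induction n)
  case 0
  have "compactin (join_power T 0) ((\<lambda>g. [0 \<mapsto> (g, 1)]) ` topspace T)"
    using image_compactin[of T "topspace T"] quotient_imp_continuous_map[OF quotient_map_quotient_topology] assms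
    by (auto simp: compact_space_def)
  then show ?case by (simp add: compact_space_def)
next
  case (Suc n)
  let ?P = "prod_topology (join_power T n) (prod_topology T (top_of_set {0..1::real}))"
  have "compact_space ?P"
    using Suc assms by (simp add: compact_space_prod_topology compact_space_subtopology)
  then have "compactin (join_power T (Suc n)) (append_comb n ` topspace ?P)"
    using image_compactin[OF _ continuous_map_append_comb] by (auto simp: compact_space_def)
  then show ?case
    using quotient_imp_surjective_map[OF quotient_map_append_comb[of T n]] by (simp add: compact_space_def)
qed

lemma comb_val_append_comb:
  assumes "c \<in> topspace (join_power T n)"
  shows "comb_val \<phi> i (append_comb n (c, h, t)) =
    (if i = Suc n then (1 - t) *\<^sub>R \<phi> h else t *\<^sub>R comb_val \<phi> i c)"
  by (auto simp: comb_val_def append_comb_def split: option.splits)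

lemma continuous_map_comb_val:
  fixes \<phi> :: "'a \<Rightarrow> 'c::real_normed_vector"
  assumes \<phi>: "continuous_map T euclidean \<phi>"
  shows "continuous_map (join_power T n) euclidean (comb_val \<phi> i)"
proof (induction n)
  case 0
  have "continuous_map T euclidean (comb_val \<phi> i \<circ> (\<lambda>g. [0 \<mapsto> (g, 1)]))"
    using \<phi> by (cases "i = 0") (simp_all add: comb_val_def o_def)
  then show ?case
    using continuous_compose_quotient_map[OF quotient_map_quotient_topology] by auto
next
  case (Suc n)
  let ?P = "prod_topology (join_power T n) (prod_topology T (top_of_set {0..1::real}))"
  note p = continuous_map_join_param[of "join_power T n" T]
  have t: "continuous_map ?P euclideanreal (\<lambda>p. 1 - snd (snd p))"
    by (intro continuous_intros p)
  have "continuous_map ?P euclidean (comb_val \<phi> i \<circ> append_comb n)"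
  proof (rule continuous_map_eq)
    show "continuous_map ?P euclidean (\<lambda>p. if i = Suc n then (1 - snd (snd p)) *\<^sub>R \<phi> (fst (snd p))
        else snd (snd p) *\<^sub>R comb_val \<phi> i (fst p))"
      by (cases "i = Suc n")
        (simp_all add: continuous_map_scaleR_euclidean[OF t continuous_map_compose_app[OF p(2) \<phi>]]
          continuous_map_scaleR_euclidean[OF p(3) continuous_map_compose_app[OF p(1) Suc]])
  qed (auto simp: comb_val_append_comb[where T=T])
  then show ?case
    using continuous_compose_quotient_map[OF quotient_map_append_comb] by blast
qed

lemma continuous_map_coeff_at: "continuous_map (join_power T n) euclideanreal (\<lambda>c. coeff_at c i)"
  unfolding coeff_at_eq_comb_val by (rule continuous_map_comb_val) simp

lemma comb_slot_append_comb:
  assumes "c \<in> topspace (join_power T n)"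
  shows "append_comb n (c, h, t) \<in> comb_slot i A \<longleftrightarrow>
    (if i = Suc n then t \<noteq> 1 \<and> h \<in> A else t \<noteq> 0 \<and> c \<in> comb_slot i A)"
  by (auto simp: comb_slot_def append_comb_def)

lemma openin_comb_slot:
  assumes A: "openin T A"
  shows "openin (join_power T n) (topspace (join_power T n) \<inter> comb_slot i A)"
proof (induction n)
  case 0
  have eq: "{x \<in> topspace T. [0 \<mapsto> (x, 1::real)] \<in> topspace (join_power T 0) \<inter> comb_slot i A}
      = (if i = 0 then topspace T \<inter> A else {})"
    by (auto simp: comb_slot_def)
  have "openin T {x \<in> topspace T. [0 \<mapsto> (x, 1::real)] \<in> topspace (join_power T 0) \<inter> comb_slot i A}"
    unfolding eq using A by auto
  moreover have "quotient_map T (join_power T 0) (\<lambda>g. [0 \<mapsto> (g, 1)])"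
    by (simp add: quotient_map_quotient_topology)
  ultimately show ?case
    unfolding quotient_map_def by blast
next
  case (Suc n)
  let ?P = "prod_topology (join_power T n) (prod_topology T (top_of_set {0..1::real}))"
  note p = continuous_map_join_param[of "join_power T n" T]
  have surj: "append_comb n x \<in> topspace (join_power T (Suc n))" if "x \<in> topspace ?P" for x
    using quotient_imp_surjective_map[OF quotient_map_append_comb[of T n]] that by blast
  have eq: "{x \<in> topspace ?P. append_comb n x \<in> topspace (join_power T (Suc n)) \<inter> comb_slot i A} =
     (if i = Suc n then {x \<in> topspace ?P. snd (snd x) \<in> - {1}} \<inter> {x \<in> topspace ?P. fst (snd x) \<in> A}
      else {x \<in> topspace ?P. snd (snd x) \<in> - {0}} \<inter>
         {x \<in> topspace ?P. fst x \<in> topspace (join_power T n) \<inter> comb_slot i A})"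
    using surj by (auto simp: comb_slot_append_comb[where T=T] simp del: join_power.simps)
  have "openin ?P {x \<in> topspace ?P. append_comb n x \<in> topspace (join_power T (Suc n)) \<inter> comb_slot i A}"
    unfolding eq
    using openin_continuous_map_preimage[OF p(3), of "- {1}"] openin_continuous_map_preimage[OF p(3), of "- {0}"]
      openin_continuous_map_preimage[OF p(2) A] openin_continuous_map_preimage[OF p(1) Suc]
    by (auto intro!: openin_Int simp: open_Compl)
  then show ?case
    using quotient_map_append_comb[of T n] unfolding quotient_map_def by blast
qed

text \<open>The target is compact, so it suffices to separate each value of \<^term>\<open>q\<close> from the
  other points by open conditions on coefficients and group elements.\<close>

lemma continuous_map_into_join_power:
  assumes T: "compact_space T" "Hausdorff_space T"
    and q: "\<And>z. z \<in> topspace Z \<Longrightarrow> q z \<in> topspace (join_power T n)"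
    and coeff: "\<And>i. i \<le> n \<Longrightarrow> continuous_map Z euclideanreal (\<lambda>z. coeff_at (q z) i)"
    and slot: "\<And>i A. i \<le> n \<Longrightarrow> openin T A \<Longrightarrow> openin Z {z \<in> topspace Z. q z \<in> comb_slot i A}"
  shows "continuous_map Z (join_power T n) q"
proof -
  let ?E = "join_power T n"
  have sep: "\<exists>U V. openin Z U \<and> openin ?E V \<and> z \<in> U \<and> c \<in> V \<and> q ` U \<inter> V = {}"
    if z: "z \<in> topspace Z" and c: "c \<in> topspace ?E" "c \<noteq> q z" for z c
  proof (cases "\<exists>i\<le>n. coeff_at c i \<noteq> coeff_at (q z) i")
    case True
    then obtain i where i: "i \<le> n" "coeff_at c i \<noteq> coeff_at (q z) i" by blast
    obtain A B :: "real set" where AB: "open A" "open B" "coeff_at (q z) i \<in> A" "coeff_at c i \<in> B" "A \<inter> B = {}"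
      using hausdorff[OF i(2)[symmetric]] by blast
    show ?thesis
      using openin_continuous_map_preimage[OF coeff[OF i(1)], of A]
        openin_continuous_map_preimage[OF continuous_map_coeff_at[of T n i], of B] AB z c(1)
      by (intro exI[of _ "{x \<in> topspace Z. coeff_at (q x) i \<in> A}"]
          exI[of _ "{x \<in> topspace ?E. coeff_at x i \<in> B}"]) auto
  next
    case False
    have none: "coeff_at e i = 0 \<longleftrightarrow> e i = None" if "e \<in> topspace ?E" for e i
      using join_power_in(2)[OF that, of i] by (force simp: coeff_at_def split: option.splits)
    have big: "e i = None" if "e \<in> topspace ?E" "\<not> i \<le> n" for e i
      using join_power_in(3)[OF that(1), of i] that(2) by (cases "e i") auto
    obtain i where i: "c i \<noteq> q z i" using c(2) by blast
    then have "i \<le> n" using big c(1) q[OF z] by metis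
    with False have eq: "coeff_at c i = coeff_at (q z) i" by blast
    then obtain g t g' t' where gt: "c i = Some (g, t)" "q z i = Some (g', t')"
      using i none[OF c(1)] none[OF q[OF z]] by (metis not_None_eq surj_pair)
    with eq i have "g \<noteq> g'" by (auto simp: coeff_at_def)
    then obtain A B where AB: "openin T A" "openin T B" "g' \<in> A" "g \<in> B" "disjnt A B"
      using T(2) join_power_in(1)[OF c(1) gt(1)] join_power_in(1)[OF q[OF z] gt(2)]
      unfolding Hausdorff_space_def by metis
    show ?thesis
      using slot[OF \<open>i \<le> n\<close> AB(1)] openin_comb_slot[OF AB(2), of n i] AB z c(1) gt
      by (intro exI[of _ "{x \<in> topspace Z. q x \<in> comb_slot i A}"]
          exI[of _ "topspace ?E \<inter> comb_slot i B"]) (auto simp: comb_slot_def disjnt_iff)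
  qed
  show ?thesis
    unfolding continuous_map_closedin
  proof (intro conjI allI impI)
    show "q \<in> topspace Z \<rightarrow> topspace ?E" using q by blast
  next
    fix K assume K: "closedin ?E K"
    then have Kc: "compactin ?E K"
      using closedin_compact_space compact_space_join_power[OF T(1)] by blast
    have "\<exists>U. openin Z U \<and> z \<in> U \<and> U \<subseteq> topspace Z - {x \<in> topspace Z. q x \<in> K}"
      if z: "z \<in> topspace Z" "q z \<notin> K" for z
    proof -
      have "\<exists>U V. openin Z U \<and> openin ?E V \<and> z \<in> U \<and> c \<in> V \<and> q ` U \<inter> V = {}" if "c \<in> K" for c
        using sep[OF z(1), of c] that z(2) closedin_subset[OF K] by auto
      then obtain U V where UV: "\<And>c. c \<in> K \<Longrightarrow> openin Z (U c) \<and> openin ?E (V c) \<and> z \<in> U c \<and> c \<in> V c \<and> q ` U c \<inter> V c = {}"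
        by metis
      obtain \<F> where F: "finite \<F>" "\<F> \<subseteq> V ` K" "K \<subseteq> \<Union>\<F>"
        using compactinD[OF Kc, of "V ` K"] UV by blast
      then obtain D where D: "finite D" "D \<subseteq> K" "\<F> = V ` D"
        by (metis finite_subset_image)
      let ?U = "topspace Z \<inter> \<Inter>(U ` D)"
      have "openin Z ?U"
        using D UV by (cases "D = {}") (auto intro!: openin_Int openin_Inter)
      moreover have "z \<in> ?U" using z(1) UV D by auto
      moreover have "?U \<subseteq> topspace Z - {x \<in> topspace Z. q x \<in> K}"
      proof -
        have "q x \<notin> K" if "x \<in> ?U" for x
        proof
          assume "q x \<in> K"
          then obtain d where "d \<in> D" "q x \<in> V d" using F D by blast
          then show False using that UV D(2) by blast
        qed
        then show ?thesis by blast
      qed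
      ultimately show ?thesis by blast
    qed
    then have "openin Z (topspace Z - {x \<in> topspace Z. q x \<in> K})"
      by (subst openin_subopen) blast
    then show "closedin Z {x \<in> topspace Z. q x \<in> K}"
      by (auto simp: closedin_def)
  qed
qed

section \<open>Functoriality of joins, contraction in the next join, equivariant maps between join
  powers\<close>

definition join_map :: "('a \<Rightarrow> 'b) \<Rightarrow> 'a formal_comb \<Rightarrow> 'b formal_comb" where
  "join_map \<phi> c = (\<lambda>i. map_option (\<lambda>(g, t). (\<phi> g, t)) (c i))"

lemma diag_action_eq_join_map: "diag_action G c g = join_map (\<lambda>x. x \<otimes>\<^bsub>G\<^esub> g) c"
  by (simp add: diag_action_def join_map_def)

lemma join_map_compose: "join_map \<phi> (join_map \<psi> c) = join_map (\<lambda>x. \<phi> (\<psi> x)) c"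
  by (auto simp: join_map_def option.map_comp o_def split_def)

lemma coeff_at_join_map [simp]: "coeff_at (join_map \<phi> c) i = coeff_at c i"
  by (auto simp: join_map_def coeff_at_def split: option.splits)

lemma join_map_in_join_power:
  assumes "c \<in> topspace (join_power T n)" "\<And>x. x \<in> topspace T \<Longrightarrow> \<phi> x \<in> topspace T'"
  shows "join_map \<phi> c \<in> topspace (join_power T' n)"
  using assms unfolding topspace_join_power convex_combs_def coeff_at_join_map mem_Collect_eq
  by (auto simp: join_map_def)

lemma join_map_cong:
  assumes "c \<in> topspace (join_power T n)" "\<And>x. x \<in> topspace T \<Longrightarrow> \<phi> x = \<psi> x"
  shows "join_map \<phi> c = join_map \<psi> c"
proof
  fix i show "join_map \<phi> c i = join_map \<psi> c i"
    using assms(2) join_power_in(1)[OF assms(1), of i]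
    by (cases "c i") (auto simp: join_map_def)
qed

lemma join_map_ident [simp]: "join_map (\<lambda>x. x) c = c"
  by (simp add: join_map_def split_def option.map_ident fun_eq_iff)

lemma continuous_map_join_map:
  assumes "compact_space T'" "Hausdorff_space T'" and \<phi>: "continuous_map T T' \<phi>"
  shows "continuous_map (join_power T n) (join_power T' n) (join_map \<phi>)"
proof (rule continuous_map_into_join_power[OF assms(1,2)])
  show "join_map \<phi> c \<in> topspace (join_power T' n)" if "c \<in> topspace (join_power T n)" for c
    using that \<phi> by (auto intro!: join_map_in_join_power simp: continuous_map_def)
  fix i A assume A: "openin T' A"
  have "{c \<in> topspace (join_power T n). join_map \<phi> c \<in> comb_slot i A}
      = topspace (join_power T n) \<inter> comb_slot i {x \<in> topspace T. \<phi> x \<in> A}"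
    using join_power_in(1) by (fastforce simp: comb_slot_def join_map_def)
  then show "openin (join_power T n) {c \<in> topspace (join_power T n). join_map \<phi> c \<in> comb_slot i A}"
    using openin_comb_slot[OF openin_continuous_map_preimage[OF \<phi> A]] by simp
qed (simp add: continuous_map_coeff_at)

lemma append_comb_1:
  assumes "c \<in> topspace (join_power T n)"
  shows "append_comb n (c, h, 1) = c"
proof
  fix i
  show "append_comb n (c, h, 1) i = c i"
    using assms join_power_in(3)[OF assms, of i]
    by (cases "c i") (auto simp: append_comb_def)
qed

lemma append_comb_0: "append_comb n (c, h, 0) = [Suc n \<mapsto> (h, 1)]"
  by (auto simp: append_comb_def)

lemma join_map_append_comb:
  "join_map \<phi> (append_comb n (c, h, t)) = append_comb n (join_map \<phi> c, \<phi> h, t)"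
  by (auto simp: append_comb_def join_map_def option.map_comp o_def split_def)

text \<open>Every point moves along the segment to the new vertex, \<open>t\<close> in
  \<open>append_comb n (x, h, t)\<close> going from 1 to 0. One more join factor makes the inclusion
  null-homotopic, which later fills cycles.\<close>

lemma homotopic_join_power_inclusion:
  assumes h: "h \<in> topspace T"
  shows "homotopic_with (\<lambda>_. True) (join_power T n) (join_power T (Suc n)) id (\<lambda>_. [Suc n \<mapsto> (h, 1)])"
proof -
  let ?E = "join_power T n"
  let ?f = "\<lambda>p. append_comb n (snd p, h, 1 - fst p)"
  have "continuous_map (prod_topology (top_of_set {0..1::real}) ?E)
      (prod_topology ?E (prod_topology T (top_of_set {0..1}))) (\<lambda>p. (snd p, h, 1 - fst p))"
    using h
    by (auto intro!: continuous_map_pairedI continuous_map_snd continuous_map_into_subtopology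
        continuous_map_diff continuous_map_into_fulltopology[OF continuous_map_fst])
  then have "continuous_map (prod_topology (top_of_set {0..1::real}) ?E) (join_power T (Suc n)) ?f"
    by (rule continuous_map_compose_app[OF _ continuous_map_append_comb])
  then have "homotopic_with (\<lambda>_. True) ?E (join_power T (Suc n)) (\<lambda>x. append_comb n (x, h, 1)) (\<lambda>x. append_comb n (x, h, 0))" 
    unfolding homotopic_with_def by (intro exI[of _ ?f]) simp
  then show ?thesis
    by (rule homotopic_with_eq) (simp_all add: append_comb_1 append_comb_0 del: join_power.simps)
qed

lemma quotient_map_lift_ex:
  assumes "quotient_map X Y f" "continuous_map X Z h"
    and "\<And>x y. \<lbrakk>x \<in> topspace X; y \<in> topspace X; f x = f y\<rbrakk> \<Longrightarrow> h x = h y"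
  shows "\<exists>g. continuous_map Y Z g \<and> (\<forall>x\<in>topspace X. g (f x) = h x)"
proof (rule quotient_map_lift_exists[OF assms(1,2)])
  show "h x = h y" if "x \<in> topspace X" "y \<in> topspace X" "f x = f y" for x y
    using assms(3) that by blast
qed blast

lemma join_power_step_map:
  assumes f: "continuous_map (join_power T (Suc m)) (join_power T m) f"
    and eq: "equivariant_map G (topspace (join_power T (Suc m))) f"
    and act: "\<And>x g. x \<in> topspace T \<Longrightarrow> g \<in> carrier G \<Longrightarrow> x \<otimes>\<^bsub>G\<^esub> g \<in> topspace T"
  shows "\<exists>f'. continuous_map (join_power T (Suc (Suc m))) (join_power T (Suc m)) f' \<and>
     equivariant_map G (topspace (join_power T (Suc (Suc m)))) f'"
proof -
  let ?P = "prod_topology (join_power T (Suc m)) (prod_topology T (top_of_set {0..1::real}))"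
  let ?h = "\<lambda>p. append_comb m (f (fst p), snd p)"
  have fin: "f c \<in> topspace (join_power T m)" if "c \<in> topspace (join_power T (Suc m))" for c
    using f that by (auto simp: continuous_map_def)
  have "continuous_map ?P (prod_topology (join_power T m) (prod_topology T (top_of_set {0..1::real}))) (\<lambda>p. (f (fst p), snd p))"
    by (intro continuous_map_pairedI continuous_map_snd continuous_map_compose_app[OF continuous_map_fst f])
  then have h: "continuous_map ?P (join_power T (Suc m)) ?h"
    by (rule continuous_map_compose_app[OF _ continuous_map_append_comb])
  \<comment> \<open>At both levels \<open>append_comb\<close> forgets the same data, the combination
    at \<open>t = 0\<close> and the group element at \<open>t = 1\<close>, so replacing
    \<open>c\<close> by \<open>f c\<close> respects the identifications.\<close>
  have well_defined: "?h x = ?h y" if xy: "x \<in> topspace ?P" "y \<in> topspace ?P"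
    and e: "append_comb (Suc m) x = append_comb (Suc m) y" for x y
  proof -
    obtain c k t where x: "x = (c, k, t)" by (cases x)
    obtain c' k' t' where y: "y = (c', k', t')" by (cases y)
    have "t' = t \<and> (c = c' \<and> k = k' \<or> t = 0 \<and> k = k' \<or> t = 1 \<and> c = c')"
      using xy e append_comb_eq_iff[of c "topspace T" "Suc m" c' t t' k k'] unfolding x y
      by (simp add: topspace_join_power del: join_power.simps)
    then show ?thesis
      using append_comb_eq_iff[of "f c" "topspace T" m "f c'" t t' k k'] fin[of c] fin[of c'] xy unfolding x y
      by (simp add: topspace_join_power del: join_power.simps) blast
  qed
  have "\<exists>f'. continuous_map (join_power T (Suc (Suc m))) (join_power T (Suc m)) f' \<and>
      (\<forall>x\<in>topspace ?P. f' (append_comb (Suc m) x) = ?h x)"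
    by (rule quotient_map_lift_ex[OF quotient_map_append_comb h well_defined])
  then obtain f' where f'_cont: "continuous_map (join_power T (Suc (Suc m))) (join_power T (Suc m)) f'"
    and f'_val: "\<forall>x\<in>topspace ?P. f' (append_comb (Suc m) x) = ?h x"
    by (elim exE conjE)
  have "f' (join_map (\<lambda>x. x \<otimes>\<^bsub>G\<^esub> g) c) = join_map (\<lambda>x. x \<otimes>\<^bsub>G\<^esub> g) (f' c)"
    if c: "c \<in> topspace (join_power T (Suc (Suc m)))" and g: "g \<in> carrier G" for c g
  proof -
    let ?R = "join_map (\<lambda>x. x \<otimes>\<^bsub>G\<^esub> g)"
    have "c \<in> append_comb (Suc m) ` topspace ?P"
      using c quotient_imp_surjective_map[OF quotient_map_append_comb[of T "Suc m"]] by (simp only:)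
    then obtain p where p: "c = append_comb (Suc m) p" "p \<in> topspace ?P" by (elim imageE)
    obtain d k t where dk: "p = (d, k, t)" by (cases p)
    have mem: "d \<in> topspace (join_power T (Suc m))" "k \<in> topspace T" "t \<in> {0..1}"
      using p(2) unfolding dk topspace_prod_topology mem_Times_iff by simp_all
    have "?R d \<in> topspace (join_power T (Suc m))"
      by (rule join_map_in_join_power[OF mem(1)]) (rule act[OF _ g])
    with act[OF mem(2) g] have "(?R d, k \<otimes>\<^bsub>G\<^esub> g, t) \<in> topspace ?P"
      using mem(3) unfolding topspace_prod_topology mem_Times_iff by simp
    then have "f' (?R c) = append_comb m (f (?R d), k \<otimes>\<^bsub>G\<^esub> g, t)"
      using bspec[OF f'_val] unfolding p(1) dk join_map_append_comb by simp
    also have "f (?R d) = ?R (f d)"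
      using eq mem(1) g unfolding equivariant_map_def diag_action_eq_join_map by blast
    also have "append_comb m (?R (f d), k \<otimes>\<^bsub>G\<^esub> g, t) = ?R (f' c)"
      using bspec[OF f'_val p(2)] unfolding p(1) dk by (simp add: join_map_append_comb del: join_power.simps)
    finally show ?thesis .
  qed
  then show ?thesis using f'_cont unfolding equivariant_map_def diag_action_eq_join_map by blast
qed

text \<open>Right multiplication in selected slots only. It repairs the map
  \<open>k \<mapsto> h [^] k\<close> on residues modulo \<open>p\<close>: the slots in
  \<open>S\<close> will be those where an exponent wraps around, and \<open>w\<close> will be
  \<open>h [^] p\<close>.\<close>

definition slot_act :: "('a, 'b) monoid_scheme \<Rightarrow> nat set \<Rightarrow> 'a formal_comb \<Rightarrow> 'a \<Rightarrow> 'a formal_comb" where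
  "slot_act G S c w = (\<lambda>i. map_option (\<lambda>(g, t). (if i \<in> S then g \<otimes>\<^bsub>G\<^esub> w else g, t)) (c i))"

lemma coeff_at_slot_act [simp]: "coeff_at (slot_act G S c w) i = coeff_at c i"
  by (auto simp: slot_act_def coeff_at_def split: option.splits)

section \<open>Evaluating cochains on singular chains\<close>

abbreviation vertices :: "((nat \<Rightarrow> real) \<Rightarrow> 'a) \<Rightarrow> nat \<Rightarrow> 'a" where
  "vertices f \<equiv> \<lambda>i. simplicial_vertex i f"

text \<open>Only cochains that see a singular simplex through its vertices occur. They suffice for
  cocycles made from labels of points, and vertices are easy to follow under faces and chain
  maps.\<close>

definition chain_pair :: "((nat \<Rightarrow> 'a) \<Rightarrow> int) \<Rightarrow> 'a chain \<Rightarrow> int" where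
  "chain_pair C c = (\<Sum>f\<in>Poly_Mapping.keys c. Poly_Mapping.lookup c f * C (vertices f))"

definition depends_on :: "nat \<Rightarrow> ((nat \<Rightarrow> 'a) \<Rightarrow> int) \<Rightarrow> bool" where
  "depends_on q C \<longleftrightarrow> (\<forall>v w. (\<forall>i\<le>q. v i = w i) \<longrightarrow> C v = C w)"

definition skip :: "nat \<Rightarrow> nat \<Rightarrow> nat" where
  "skip k i = (if i < k then i else Suc i)"

definition cobdry :: "nat \<Rightarrow> ((nat \<Rightarrow> 'a) \<Rightarrow> int) \<Rightarrow> (nat \<Rightarrow> 'a) \<Rightarrow> int" where
  "cobdry q C v = (\<Sum>k\<le>Suc q. (-1) ^ k * C (v \<circ> skip k))"

text \<open>The Alexander-Whitney product: \<open>F\<close> sees the front face and \<open>H\<close>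
  the back face, and they share the vertex \<open>q\<close>.\<close>

definition cup :: "nat \<Rightarrow> ((nat \<Rightarrow> 'a) \<Rightarrow> int) \<Rightarrow> ((nat \<Rightarrow> 'a) \<Rightarrow> int) \<Rightarrow> (nat \<Rightarrow> 'a) \<Rightarrow> int" where
  "cup q F H v = F v * H (\<lambda>i. v (q + i))"

lemma depends_onD: "depends_on q C \<Longrightarrow> (\<And>i. i \<le> q \<Longrightarrow> v i = w i) \<Longrightarrow> C v = C w"
  unfolding depends_on_def by blast

lemma chain_pair_superset:
  assumes "finite S" "Poly_Mapping.keys c \<subseteq> S"
  shows "chain_pair C c = (\<Sum>f\<in>S. Poly_Mapping.lookup c f * C (vertices f))"
  unfolding chain_pair_def
  using assms by (intro sum.mono_neutral_left) (auto simp: in_keys_iff)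

lemma chain_pair_diff: "chain_pair C (a - b) = chain_pair C a - chain_pair C b"
proof -
  let ?S = "Poly_Mapping.keys a \<union> Poly_Mapping.keys b"
  have "Poly_Mapping.keys (a - b) \<subseteq> ?S" by (rule keys_diff)
  then show ?thesis
    by (simp add: chain_pair_superset[of ?S] lookup_minus left_diff_distrib sum_subtractf)
qed

lemma chain_pair_0 [simp]: "chain_pair C 0 = 0"
  by (simp add: chain_pair_def)

lemma chain_pair_uminus: "chain_pair C (- a) = - chain_pair C a"
  using chain_pair_diff[of C 0 a] by simp

lemma chain_pair_add: "chain_pair C (a + b) = chain_pair C a + chain_pair C b"
  using chain_pair_diff[of C a "- b"] by (simp add: chain_pair_uminus)

lemma chain_pair_sum: "chain_pair C (\<Sum>i\<in>I. c i) = (\<Sum>i\<in>I. chain_pair C (c i))"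
  by (induction I rule: infinite_finite_induct) (simp_all add: chain_pair_add)

lemma chain_pair_of [simp]: "chain_pair C (frag_of f) = C (vertices f)"
  by (simp add: chain_pair_def)

lemma chain_pair_cmul: "chain_pair C (frag_cmul a c) = a * chain_pair C c"
  by (subst chain_pair_superset[of "Poly_Mapping.keys c"])
     (auto simp: chain_pair_def keys_cmul sum_distrib_left mult.assoc in_keys_iff)

lemma chain_pair_cong:
  "(\<And>f. f \<in> Poly_Mapping.keys c \<Longrightarrow> C (vertices f) = D (vertices f)) \<Longrightarrow> chain_pair C c = chain_pair D c"
  unfolding chain_pair_def by (rule sum.cong) auto

lemma chain_pair_cong_mod:
  assumes "\<And>f. f \<in> Poly_Mapping.keys c \<Longrightarrow> C (vertices f) mod m = D (vertices f) mod m"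
  shows "chain_pair C c mod m = chain_pair D c mod m"
proof -
  let ?l = "Poly_Mapping.lookup c"
  have "chain_pair C c mod m = (\<Sum>f\<in>Poly_Mapping.keys c. (?l f * C (vertices f)) mod m) mod m"
    unfolding chain_pair_def by (rule mod_sum_eq[symmetric])
  also have "(\<Sum>f\<in>Poly_Mapping.keys c. (?l f * C (vertices f)) mod m)
      = (\<Sum>f\<in>Poly_Mapping.keys c. (?l f * D (vertices f)) mod m)"
    by (rule sum.cong[OF refl], rule mod_mult_cong[OF refl], rule assms)
  also have "\<dots> mod m = chain_pair D c mod m"
    unfolding chain_pair_def by (rule mod_sum_eq)
  finally show ?thesis .
qed

lemma chain_pair_sum_fun: "chain_pair (\<lambda>v. \<Sum>i\<in>I. C i v) c = (\<Sum>i\<in>I. chain_pair (C i) c)"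
  unfolding chain_pair_def sum_distrib_left by (rule sum.swap)

lemma vertices_in_topspace:
  assumes "singular_chain q X c" "f \<in> Poly_Mapping.keys c" "i \<le> q"
  shows "vertices f i \<in> topspace X"
proof -
  have "singular_simplex q X f" using assms by (auto simp: singular_chain_def)
  then have "continuous_map (subtopology (powertop_real UNIV) (standard_simplex q)) X f"
    by (simp add: singular_simplex_def)
  then have "f \<in> standard_simplex q \<rightarrow> topspace X" by (simp add: continuous_map_def)
  then show ?thesis using assms(3) by (auto simp: simplicial_vertex_def)
qed

lemma vertices_singular_face:
  assumes "i \<le> q" "k \<le> Suc q"
  shows "vertices (singular_face (Suc q) k f) i = vertices f (skip k i)"
proof -
  have "simplical_face k (\<lambda>j. if j = i then 1 else (0::real)) = (\<lambda>j. if j = skip k i then 1 else 0)"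
    by (auto simp: simplical_face_def skip_def fun_eq_iff)
  then show ?thesis
    using assms by (simp add: singular_face_def simplicial_vertex_def)
qed

lemma chain_pair_boundary:
  assumes C: "depends_on q C" and c: "singular_chain (Suc q) X c"
  shows "chain_pair C (chain_boundary (Suc q) c) = chain_pair (cobdry q C) c"
  using c unfolding singular_chain_def
proof (induction c rule: frag_induction)
  case (one f)
  have "C (vertices (singular_face (Suc q) k f)) = C (vertices f \<circ> skip k)" if "k \<le> Suc q" for k
    using that by (intro depends_onD[OF C]) (simp add: vertices_singular_face)
  then have "(\<Sum>k\<le>Suc q. (-1) ^ k * C (vertices (singular_face (Suc q) k f))) = cobdry q C (vertices f)"
    unfolding cobdry_def by (intro sum.cong) simp_all
  then show ?case
    unfolding chain_boundary_of by (simp add: chain_pair_sum chain_pair_cmul del: sum.atMost_Suc)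
next
  case (diff a b)
  then show ?case by (simp add: chain_boundary_diff chain_pair_diff)
qed simp

lemma chain_pair_chain_map:
  assumes C: "depends_on q C" and c: "singular_chain q X c"
  shows "chain_pair C (chain_map q R c) = chain_pair (\<lambda>v. C (R \<circ> v)) c"
  using c unfolding singular_chain_def
proof (induction c rule: frag_induction)
  case (one f)
  have "C (vertices (simplex_map q R f)) = C (R \<circ> vertices f)"
    by (intro depends_onD[OF C]) (simp add: simplex_map_def simplicial_vertex_def)
  then show ?case by (simp only: chain_map_of chain_pair_of)
next
  case (diff a b)
  then show ?case by (simp only: chain_map_diff chain_pair_diff)
qed simp

lemma depends_on_cup:
  assumes "depends_on q F" "depends_on r H"
  shows "depends_on (q + r) (cup q F H)"
proof -
  have "F v = F w" "H (\<lambda>i. v (q + i)) = H (\<lambda>i. w (q + i))" if "\<forall>i\<le>q + r. v i = w i" for v w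
    using that by (auto intro!: depends_onD[OF assms(1)] depends_onD[OF assms(2)])
  then show ?thesis unfolding depends_on_def cup_def by metis
qed

text \<open>The Leibniz rule. The left-hand side contains all faces of the two factors except the
  last one of \<open>F\<close> and the first one of \<open>H\<close>; on the right-hand side these
  two contribute the same product with opposite signs.\<close>

lemma cobdry_cup:
  assumes F: "depends_on q F"
  shows "cobdry (q + r) (cup q F H) v =
    cobdry q F v * H (\<lambda>i. v (Suc q + i)) + (-1) ^ q * F v * cobdry r H (\<lambda>i. v (q + i))"
proof -
  let ?g = "\<lambda>k. (-1) ^ k * cup q F H (v \<circ> skip k)"
  have split: "(\<Sum>k\<le>Suc (q + r). ?g k) = (\<Sum>k\<le>q. ?g k) + (\<Sum>k\<le>r. ?g (Suc q + k))"
  proof -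
    have "{..Suc (q + r)} = {..q} \<union> {Suc q..Suc q + r}" by auto
    then have "(\<Sum>k\<le>Suc (q + r). ?g k) = (\<Sum>k\<le>q. ?g k) + (\<Sum>k=Suc q..Suc q + r. ?g k)"
      by (simp add: sum.union_disjoint)
    also have "(\<Sum>k=Suc q..Suc q + r. ?g k) = (\<Sum>k\<le>r. ?g (Suc q + k))"
      using sum.shift_bounds_cl_nat_ivl[of ?g 0 "Suc q" r] by (simp add: atLeast0AtMost add.commute)
    finally show ?thesis .
  qed
  have lo: "(\<Sum>k\<le>q. ?g k) = (\<Sum>k\<le>q. (-1) ^ k * F (v \<circ> skip k)) * H (\<lambda>i. v (Suc q + i))"
    unfolding sum_distrib_right by (rule sum.cong) (simp_all add: cup_def skip_def o_def mult.assoc)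
  have F0: "F (v \<circ> skip (Suc q)) = F v"
    by (rule depends_onD[OF F]) (simp add: skip_def)
  have hi: "?g (Suc q + k) = (-1) ^ q * F v * ((-1) ^ Suc k * H ((\<lambda>i. v (q + i)) \<circ> skip (Suc k)))" for k
  proof -
    have "F (v \<circ> skip (Suc q + k)) = F v"
      by (rule depends_onD[OF F]) (simp add: skip_def)
    moreover have "(\<lambda>i. (v \<circ> skip (Suc q + k)) (q + i)) = (\<lambda>i. v (q + i)) \<circ> skip (Suc k)"
      by (auto simp: skip_def fun_eq_iff)
    ultimately show ?thesis by (simp add: cup_def power_add)
  qed
  have "cobdry r H (\<lambda>i. v (q + i)) = H (\<lambda>i. v (Suc q + i)) + (\<Sum>k\<le>r. (-1) ^ Suc k * H ((\<lambda>i. v (q + i)) \<circ> skip (Suc k)))"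
    unfolding cobdry_def sum.atMost_Suc_shift by (simp add: skip_def o_def)
  moreover have "cobdry q F v = (\<Sum>k\<le>q. (-1) ^ k * F (v \<circ> skip k)) + (-1) ^ Suc q * F v"
    unfolding cobdry_def by (simp add: F0)
  moreover have "cobdry (q + r) (cup q F H) v = (\<Sum>k\<le>q. (-1) ^ k * F (v \<circ> skip k)) * H (\<lambda>i. v (Suc q + i))
      + (-1) ^ q * F v * (\<Sum>k\<le>r. (-1) ^ Suc k * H ((\<lambda>i. v (q + i)) \<circ> skip (Suc k)))"
    unfolding cobdry_def split lo hi sum_distrib_left by simp
  ultimately show ?thesis by (simp add: ring_distribs)
qed

section \<open>A Borsuk-Ulam theorem for cyclic groups\<close>

text \<open>Each \<open>\<tau> l\<close> is an equivariant map to Z/p, on which \<open>R\<close>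
  acts by adding 1. Such maps jump, and the classes below arise from comparing the labels at the
  vertices of a simplex.\<close>

locale cyclic_labels =
  fixes p :: nat and X :: "'a topology" and R :: "'a \<Rightarrow> 'a" and \<tau> :: "nat \<Rightarrow> 'a \<Rightarrow> int"
  assumes p: "p \<ge> 2"
    and R: "x \<in> topspace X \<Longrightarrow> R x \<in> topspace X"
    and \<tau>_range: "x \<in> topspace X \<Longrightarrow> 0 \<le> \<tau> l x \<and> \<tau> l x < int p"
    and \<tau>_R: "x \<in> topspace X \<Longrightarrow> \<tau> l (R x) = (\<tau> l x + 1) mod int p"
begin

text \<open>The labels make the differences \<open>\<tau> l (v 1) - \<tau> l (v 0)\<close> a coboundary modulo \<open>p\<close>;
  \<open>wrap\<close> records the carries, so that \<open>bock l\<close> represents the Bockstein class of the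
  \<open>l\<close>-th labelling and \<open>bock_power k\<close> a product of \<open>k\<close> such classes.\<close>

definition wrap :: "nat \<Rightarrow> (nat \<Rightarrow> 'a) \<Rightarrow> int" where
  "wrap l v = (if \<tau> l (v 1) < \<tau> l (v 0) then 1 else 0)"

definition bock :: "nat \<Rightarrow> (nat \<Rightarrow> 'a) \<Rightarrow> int" where
  "bock l = cobdry 1 (wrap l)"

primrec bock_power :: "nat \<Rightarrow> (nat \<Rightarrow> 'a) \<Rightarrow> int" where
  "bock_power 0 = (\<lambda>_. 1)"
| "bock_power (Suc k) = cup (2 * k) (bock_power k) (bock k)"

lemma bock_eq: "bock l v = wrap l (v \<circ> skip 0) - wrap l (v \<circ> skip 1) + wrap l (v \<circ> skip 2)"
  by (simp add: bock_def cobdry_def numeral_2_eq_2)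

lemma depends_on_wrap: "depends_on 1 (wrap l)"
  by (auto simp: depends_on_def wrap_def)

lemma depends_on_bock: "depends_on 2 (bock l)"
  by (auto simp: depends_on_def bock_eq wrap_def skip_def)

lemma depends_on_bock_power: "depends_on (2 * k) (bock_power k)"
proof (induction k)
  case (Suc k)
  then show ?case using depends_on_cup[OF Suc depends_on_bock] by simp
qed (simp add: depends_on_def)

lemma cobdry_bock: "cobdry 2 (bock l) v = 0"
  by (simp add: cobdry_def bock_eq wrap_def skip_def numeral_3_eq_3 numeral_2_eq_2)

lemma cobdry_bock_power: "cobdry (2 * k) (bock_power k) v = 0"
proof (induction k arbitrary: v)
  case (Suc k)
  then show ?case
    using cobdry_cup[OF depends_on_bock_power, of k 2 "bock k" v] by (simp add: cobdry_bock)
qed (simp add: cobdry_def)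

definition jump :: "nat \<Rightarrow> 'a \<Rightarrow> 'a \<Rightarrow> int" where
  "jump l x y = (\<tau> l y - \<tau> l x) mod int p"

text \<open>The carry in a subtraction modulo \<open>p\<close>. It exhibits
  \<open>int p * wrap l\<close> as \<open>jump l\<close>, which is invariant under \<open>R\<close>,
  minus the coboundary of \<open>\<tau> l\<close>; this is what makes \<open>bock l\<close> a
  Bockstein.\<close>

lemma wrap_eq_jump:
  assumes "v 0 \<in> topspace X" "v 1 \<in> topspace X"
  shows "int p * wrap l v = jump l (v 0) (v 1) - (\<tau> l (v 1) - \<tau> l (v 0))"
proof -
  have r: "0 \<le> \<tau> l (v 0)" "\<tau> l (v 0) < int p" "0 \<le> \<tau> l (v 1)" "\<tau> l (v 1) < int p"
    using \<tau>_range assms by auto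
  show ?thesis
  proof (cases "\<tau> l (v 1) < \<tau> l (v 0)")
    case True
    then have "(\<tau> l (v 1) - \<tau> l (v 0)) mod int p = (\<tau> l (v 1) - \<tau> l (v 0) + int p) mod int p" by simp
    also have "\<dots> = \<tau> l (v 1) - \<tau> l (v 0) + int p"
      using r True by (intro mod_pos_pos_trivial) linarith+
    finally show ?thesis using True by (simp add: wrap_def jump_def)
  qed (use r in \<open>simp add: wrap_def jump_def\<close>)
qed

lemma jump_R:
  assumes "x \<in> topspace X" "y \<in> topspace X"
  shows "jump l (R x) (R y) = jump l x y"
  using assms by (simp add: jump_def \<tau>_R mod_diff_eq)

lemma R_pow: "x \<in> topspace X \<Longrightarrow> (R ^^ i) x \<in> topspace X"
  by (induction i) (auto intro: R)

lemma \<tau>_R_pow: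
  assumes "x \<in> topspace X"
  shows "\<tau> l ((R ^^ i) x) = (\<tau> l x + int i) mod int p"
proof (induction i)
  case 0 then show ?case using \<tau>_range[OF assms] by simp
next
  case (Suc i)
  then show ?case using \<tau>_R[OF R_pow[OF assms]] by (simp add: mod_simps algebra_simps)
qed

lemma jump_R_pow:
  assumes "x \<in> topspace X" "y \<in> topspace X"
  shows "jump l ((R ^^ i) x) ((R ^^ i) y) = jump l x y"
  by (induction i) (simp_all add: jump_R R_pow assms)

lemma bock_R_pow:
  assumes "\<And>i. i \<le> 2 \<Longrightarrow> v i \<in> topspace X"
  shows "bock l ((R ^^ j) \<circ> v) = bock l v"
proof -
  \<comment> \<open>The differences of \<open>\<tau> l\<close> cancel around a triangle, so
    \<open>int p * bock l\<close> is the coboundary of \<open>jump l\<close> and inherits its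
    invariance, although \<open>wrap l\<close> itself is not invariant.\<close>
  have *: "int p * bock l w = jump l (w 1) (w 2) - jump l (w 0) (w 2) + jump l (w 0) (w 1)"
    if w: "\<And>i. i \<le> 2 \<Longrightarrow> w i \<in> topspace X" for w
    using wrap_eq_jump[of "w \<circ> skip 0" l] wrap_eq_jump[of "w \<circ> skip 1" l] wrap_eq_jump[of "w \<circ> skip 2" l]
      w[of 0] w[of 1] w[of 2]
    by (simp add: bock_eq algebra_simps skip_def numeral_2_eq_2)
  have "int p * bock l ((R ^^ j) \<circ> v) = int p * bock l v"
    by (subst *, use assms R_pow in simp, subst *[OF assms], simp, simp add: jump_R_pow assms)
  then show ?thesis using p by simp
qed

lemma bock_power_R_pow:
  assumes "\<And>i. i \<le> 2 * k \<Longrightarrow> v i \<in> topspace X"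
  shows "bock_power k ((R ^^ j) \<circ> v) = bock_power k v"
  using assms
proof (induction k)
  case (Suc k)
  have "bock k (\<lambda>i. ((R ^^ j) \<circ> v) (2 * k + i)) = bock k ((R ^^ j) \<circ> (\<lambda>i. v (2 * k + i)))"
    by (simp add: o_def)
  also have "\<dots> = bock k (\<lambda>i. v (2 * k + i))"
    by (rule bock_R_pow) (use Suc.prems in simp)
  finally show ?case using Suc by (simp add: cup_def)
qed simp

text \<open>Along an orbit the label takes every residue once, so the labels have the same sum over
  the orbits of \<open>v 0\<close> and \<open>v 1\<close>. Adding up \<open>wrap_eq_jump\<close>
  over the orbit therefore leaves only \<open>jump\<close>.\<close>

lemma sum_wrap_R_pow:
  assumes "v 0 \<in> topspace X" "v 1 \<in> topspace X"
  shows "(\<Sum>i<p. wrap l ((R ^^ i) \<circ> v)) = jump l (v 0) (v 1)"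
proof -
  have const: "(\<Sum>i<p. \<tau> l ((R ^^ i) x)) = (\<Sum>i<p. int i)" if x: "x \<in> topspace X" for x
  proof -
    have "bij_betw (\<lambda>i. nat ((\<tau> l x + int i) mod int p)) {..<p} {..<p}"
    proof (rule bij_betwI')
      fix i j assume ij: "i \<in> {..<p}" "j \<in> {..<p}"
      show "nat ((\<tau> l x + int i) mod int p) = nat ((\<tau> l x + int j) mod int p) \<longleftrightarrow> i = j"
      proof
        assume "nat ((\<tau> l x + int i) mod int p) = nat ((\<tau> l x + int j) mod int p)"
        then have "(\<tau> l x + int i) mod int p = (\<tau> l x + int j) mod int p"
          using p by (simp add: eq_nat_nat_iff)
        then have "int i mod int p = int j mod int p" by (simp add: mod_eq_dvd_iff)
        then show "i = j" using ij by simp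
      qed simp
    next
      fix i assume "i \<in> {..<p}" then show "nat ((\<tau> l x + int i) mod int p) \<in> {..<p}"
        using p by (simp add: nat_less_iff)
    next
      fix j assume j: "j \<in> {..<p}"
      have "j = nat ((\<tau> l x + int (nat ((int j - \<tau> l x) mod int p))) mod int p)"
        using j p by (simp add: mod_add_right_eq)
      moreover have "nat ((int j - \<tau> l x) mod int p) \<in> {..<p}" using p by (simp add: nat_less_iff)
      ultimately show "\<exists>i\<in>{..<p}. j = nat ((\<tau> l x + int i) mod int p)" by blast
    qed
    from sum.reindex_bij_betw[OF this, of int] show ?thesis
      using p by (simp add: \<tau>_R_pow[OF x])
  qed
  have "int p * (\<Sum>i<p. wrap l ((R ^^ i) \<circ> v)) =
      (\<Sum>i<p. jump l (v 0) (v 1) - (\<tau> l ((R ^^ i) (v 1)) - \<tau> l ((R ^^ i) (v 0))))"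
    unfolding sum_distrib_left
    by (rule sum.cong[OF refl], subst wrap_eq_jump) (simp_all add: R_pow assms[unfolded One_nat_def] jump_R_pow)
  also have "\<dots> = int p * jump l (v 0) (v 1)"
    by (simp add: sum_subtractf const assms[unfolded One_nat_def])
  finally show ?thesis using p by simp
qed

text \<open>One factor is removed by using twice that coboundary and boundary are adjoint. In degree
  \<open>2 * k + 2\<close> the cochain is the coboundary of a product with \<open>wrap k\<close>,
  and the sum over all \<open>R ^^ i\<close> turns \<open>wrap k\<close> into \<open>jump k\<close>.
  Modulo \<open>p\<close> the latter is the coboundary of \<open>\<tau> k\<close>, and the
  difference between \<open>R\<close> and the identity turns \<open>\<tau> k\<close> into 1.\<close>

lemma chain_pair_bock_power:
  assumes chain: "\<And>k. k \<le> d \<Longrightarrow> singular_chain k X (y k)"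
    and to_odd: "\<And>k. even k \<Longrightarrow> Suc k \<le> d \<Longrightarrow> chain_boundary (Suc k) (y (Suc k)) = chain_map k R (y k) - y k"
    and to_even: "\<And>k. odd k \<Longrightarrow> Suc k \<le> d \<Longrightarrow>
      chain_boundary (Suc k) (y (Suc k)) = (\<Sum>i<p. chain_map k (R ^^ i) (y k))"
    and aug: "chain_pair (\<lambda>_. 1) (y 0) = 1"
  shows "2 * k \<le> d \<Longrightarrow> chain_pair (bock_power k) (y (2 * k)) mod int p = 1"
proof (induction k)
  case 0 then show ?case using aug p by simp
next
  case (Suc k)
  let ?C = "bock_power k"
  define q where "q = 2 * k"
  have q: "Suc (Suc q) \<le> d" "even q" "2 * Suc k = Suc (Suc q)" using Suc.prems by (simp_all add: q_def)
  note dep = depends_on_bock_power[of k, folded q_def]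
  have sc: "singular_chain q X (y q)" "singular_chain (Suc q) X (y (Suc q))" "singular_chain (Suc (Suc q)) X (y (Suc (Suc q)))"
    using chain q(1) by simp_all
  have vin: "vertices f i \<in> topspace X" if "f \<in> Poly_Mapping.keys (y (Suc q))" "i \<le> Suc q" for f i
    using vertices_in_topspace[OF sc(2) that] .
  have vin0: "vertices f i \<in> topspace X" if "f \<in> Poly_Mapping.keys (y q)" "i \<le> q" for f i
    using vertices_in_topspace[OF sc(1) that] .
  let ?t = "\<lambda>v. \<tau> k (v 0)"
  let ?W = "cup q ?C (wrap k)"
  let ?J = "cup q ?C (\<lambda>v. jump k (v 0) (v 1))"
  let ?D = "cup q ?C ?t"
  have dW: "depends_on (Suc q) ?W" using depends_on_cup[OF dep depends_on_wrap] by simp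
  have dD: "depends_on q ?D" using depends_on_cup[OF dep, of 0 ?t] by (simp add: depends_on_def)
  \<comment> \<open>In the Leibniz rule the first term vanishes because \<open>bock_power k\<close>
    is a cocycle, and the sign of the second is 1 because \<open>q\<close> is even.\<close>
  have "bock_power (Suc k) v = cobdry (Suc q) ?W v" for v
    using cobdry_cup[OF dep, of 1 "wrap k" v] cobdry_bock_power[of k] q(2)
    by (simp add: q_def[symmetric]) (simp add: cup_def bock_def)
  then have "chain_pair (bock_power (Suc k)) (y (2 * Suc k)) = chain_pair (cobdry (Suc q) ?W) (y (Suc (Suc q)))"
    unfolding q(3) by (intro chain_pair_cong) simp
  also have "\<dots> = chain_pair ?W (chain_boundary (Suc (Suc q)) (y (Suc (Suc q))))"
    by (rule chain_pair_boundary[OF dW sc(3), symmetric])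
  also have "\<dots> = (\<Sum>i<p. chain_pair ?W (chain_map (Suc q) (R ^^ i) (y (Suc q))))"
    using to_even[of "Suc q"] q by (simp add: chain_pair_sum)
  also have "\<dots> = (\<Sum>i<p. chain_pair (\<lambda>v. ?W ((R ^^ i) \<circ> v)) (y (Suc q)))"
    by (simp add: chain_pair_chain_map[OF dW sc(2)])
  also have "\<dots> = chain_pair (\<lambda>v. \<Sum>i<p. ?W ((R ^^ i) \<circ> v)) (y (Suc q))"
    by (rule chain_pair_sum_fun[symmetric])
  also have "\<dots> = chain_pair ?J (y (Suc q))"
  proof (rule chain_pair_cong)
    fix f assume f: "f \<in> Poly_Mapping.keys (y (Suc q))"
    have C: "?C ((R ^^ i) \<circ> vertices f) = ?C (vertices f)" for i
      by (rule bock_power_R_pow) (use vin[OF f] q_def in simp)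
    have "(\<Sum>i<p. ?W ((R ^^ i) \<circ> vertices f)) =
        ?C (vertices f) * (\<Sum>i<p. wrap k ((R ^^ i) \<circ> (\<lambda>i. vertices f (q + i))))"
      unfolding cup_def C sum_distrib_left by (simp add: o_def)
    also have "\<dots> = ?J (vertices f)"
      using sum_wrap_R_pow[of "\<lambda>i. vertices f (q + i)" k] vin[OF f] by (simp add: cup_def)
    finally show "(\<Sum>i<p. ?W ((R ^^ i) \<circ> vertices f)) = ?J (vertices f)" .
  qed
  finally have 1: "chain_pair (bock_power (Suc k)) (y (2 * Suc k)) = chain_pair ?J (y (Suc q))" .
  have "cobdry q ?D v = cup q ?C (\<lambda>v. \<tau> k (v 1) - \<tau> k (v 0)) v" for v
    using cobdry_cup[OF dep, of 0 ?t v] cobdry_bock_power[of k] q(2)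
    by (simp add: q_def[symmetric]) (simp add: cup_def cobdry_def skip_def)
  then have "chain_pair ?J (y (Suc q)) mod int p = chain_pair (cobdry q ?D) (y (Suc q)) mod int p"
    by (intro chain_pair_cong_mod) (simp add: cup_def jump_def mod_simps)
  also have "chain_pair (cobdry q ?D) (y (Suc q)) = chain_pair ?D (chain_boundary (Suc q) (y (Suc q)))"
    by (rule chain_pair_boundary[OF dD sc(2), symmetric])
  also have "\<dots> = chain_pair (\<lambda>v. ?D (R \<circ> v)) (y q) - chain_pair ?D (y q)"
    using to_odd[of q] q by (simp add: chain_pair_diff chain_pair_chain_map[OF dD sc(1)])
  also have "\<dots> mod int p = (chain_pair (\<lambda>v. ?D v + ?C v) (y q) - chain_pair ?D (y q)) mod int p"
  proof (rule mod_diff_cong[OF chain_pair_cong_mod refl])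
    fix f assume f: "f \<in> Poly_Mapping.keys (y q)"
    have "?C ((R ^^ 1) \<circ> vertices f) = ?C (vertices f)"
      by (rule bock_power_R_pow) (use vin0[OF f] q_def in simp)
    then have "?D (R \<circ> vertices f) = ?C (vertices f) * ((\<tau> k (vertices f q) + 1) mod int p)"
      using \<tau>_R[OF vin0[OF f, of q]] by (simp add: cup_def)
    then show "?D (R \<circ> vertices f) mod int p = (?D (vertices f) + ?C (vertices f)) mod int p"
      by (simp add: cup_def mod_simps distrib_left)
  qed
  also have "chain_pair (\<lambda>v. ?D v + ?C v) (y q) - chain_pair ?D (y q) = chain_pair ?C (y q)"
    unfolding chain_pair_def by (simp add: distrib_left sum.distrib)
  finally show ?case using 1 Suc.IH q(1) by (simp add: q_def)
qed

text \<open>The factor \<open>bock l\<close> sees only the vertices from \<open>2 * l\<close> to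
  \<open>2 * l + 2\<close>, and nothing wraps if its label is constant there.\<close>

lemma bock_power_eq_0:
  assumes "l < k" "\<tau> l (v (2 * l)) = \<tau> l (v (2 * l + 1))" "\<tau> l (v (2 * l)) = \<tau> l (v (2 * l + 2))"
  shows "bock_power k v = 0"
  using assms(1)
proof (induction k)
  case (Suc k)
  show ?case
  proof (cases "l = k")
    case True
    have "bock k (\<lambda>i. v (2 * k + i)) = 0"
      using assms(2,3) unfolding True by (simp add: bock_eq wrap_def skip_def numeral_2_eq_2)
    then show ?thesis by (simp add: cup_def)
  next
    case False
    then show ?thesis using Suc by (simp add: cup_def)
  qed
qed simp

end

section \<open>Lens chains in the join powers\<close>

lemma chain_map_funpow:
  assumes "singular_chain q X c"
  shows "chain_map q (R ^^ Suc i) c = chain_map q (R ^^ i) (chain_map q R c)"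
  using chain_map_compose[of q "R ^^ i" R] by (simp add: funpow_Suc_right del: funpow.simps)

text \<open>The identity N R = N for the norm N = 1 + R + ... + R^(p-1). It makes the two kinds of
  boundary formulas of the lens chains compose to 0.\<close>

lemma sum_chain_map_rotate:
  assumes c: "singular_chain q X c" and p: "\<And>x. x \<in> topspace X \<Longrightarrow> (R ^^ p) x = x"
  shows "(\<Sum>i<p. chain_map q (R ^^ i) (chain_map q R c)) = (\<Sum>i<p. chain_map q (R ^^ i) c)"
proof -
  have "(\<Sum>i<p. chain_map q (R ^^ i) (chain_map q R c)) + c = (\<Sum>i<p. chain_map q (R ^^ Suc i) c) + chain_map q (R ^^ 0) c"
    using chain_map_funpow[OF c] chain_map_ident[OF c] by (simp add: id_def del: funpow.simps) (simp add: id_def)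
  also have "\<dots> = (\<Sum>i<Suc p. chain_map q (R ^^ i) c)"
    by (simp add: sum.lessThan_Suc_shift del: funpow.simps sum.lessThan_Suc)
  also have "\<dots> = (\<Sum>i<p. chain_map q (R ^^ i) c) + c"
    using chain_map_id_gen[OF c p] by simp
  finally show ?thesis by simp
qed

lemma join_power_inclusion:
  assumes "topspace T \<noteq> {}" "k \<le> d"
  shows "continuous_map (join_power T k) (join_power T d) id"
  using assms(2)
proof (induction d)
  case (Suc d)
  obtain h where "h \<in> topspace T" using assms(1) by blast
  then have 1: "continuous_map (join_power T d) (join_power T (Suc d)) id"
    using homotopic_with_imp_continuous_maps[OF homotopic_join_power_inclusion[of h T d]] by (simp del: join_power.simps)
  show ?case
  proof (cases "k = Suc d")
    case False
    then show ?thesis using continuous_map_compose[OF _ 1] Suc by (simp del: join_power.simps)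
  qed simp
qed simp

lemma singular_chain_join_power_mono:
  assumes "topspace T \<noteq> {}" "k \<le> d" "singular_chain q (join_power T k) c"
  shows "singular_chain q (join_power T d) c"
  using singular_chain_chain_map[OF assms(3) join_power_inclusion[OF assms(1,2)]] chain_map_ident[OF assms(3)] by simp

lemma single_in_join_power:
  assumes "h \<in> topspace T"
  shows "[0 \<mapsto> (h, 1)] \<in> topspace (join_power T n)"
proof -
  have "coeff_at [0 \<mapsto> (h, 1)] i = (if i = 0 then 1 else 0)" for i by (simp add: coeff_at_def)
  then show ?thesis using assms by (simp add: topspace_join_power convex_combs_def split: if_splits)
qed

text \<open>In the next join the cycle is homologous to its image in the apex \<open>a\<close>. A
  point has no homology in positive degrees; in degree 0 the assumption \<open>zero\<close> says
  that the coefficients of \<open>c\<close> add up to 0.\<close>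

lemma join_power_cycle_bounds:
  fixes T :: "'a topology"
  assumes T: "topspace T \<noteq> {}" and c: "singular_relcycle k (join_power T k) {} c"
    and zero: "k = 0 \<Longrightarrow> (\<And>a::'a formal_comb. chain_map 0 (\<lambda>_. a) c = 0)"
  obtains d where "singular_chain (Suc k) (join_power T (Suc k)) d" "chain_boundary (Suc k) d = c"
proof -
  let ?X = "join_power T (Suc k)"
  obtain h where h: "h \<in> topspace T" using T by blast
  define a where "a = [Suc k \<mapsto> (h, 1::real)]"
  note hom = homotopic_join_power_inclusion[OF h, of k, folded a_def]
  have cc: "continuous_map (join_power T k) ?X (\<lambda>_. a)"
    using homotopic_with_imp_continuous_maps[OF hom] by blast
  have sc: "singular_chain k (join_power T k) c" "chain_boundary k c = 0" using c by (simp_all add: singular_cycle)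
  have "homologous_rel k ?X {} (chain_map k id c) (chain_map k (\<lambda>_. a) c)"
    by (rule homotopic_imp_homologous_rel_chain_maps[OF homotopic_with_mono[OF hom] c]) auto
  then have 1: "singular_relboundary k ?X {} (c - chain_map k (\<lambda>_. a) c)"
    by (simp add: homologous_rel_def chain_map_ident[OF sc(1)])
  have "singular_relboundary k ?X {} (chain_map k (\<lambda>_. a) c)"
  proof (cases "k = 0")
    case True then show ?thesis using zero[OF True] by (simp del: join_power.simps)
  next
    case False
    have a: "a \<in> topspace ?X"
    proof -
      have "[0 \<mapsto> (h, 1::real)] \<in> topspace (join_power T k)"
        by (rule single_in_join_power[OF h])
      then show ?thesis using cc by (auto simp: continuous_map_def)
    qed
    then have top: "topspace (subtopology ?X {a}) = {a}" by auto
    have "continuous_map (join_power T k) (subtopology ?X {a}) (\<lambda>_. a)"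
      using cc by (simp add: continuous_map_in_subtopology del: join_power.simps)
    then have "singular_relcycle k (subtopology ?X {a}) {} (chain_map k (\<lambda>_. a) c)"
      by (rule singular_relcycle_chain_map[OF c]) simp
    then have "singular_relboundary k (subtopology ?X {a}) {} (chain_map k (\<lambda>_. a) c)"
      using singular_boundary_eq_cycle_singleton[OF top, of k] False by simp
    from singular_boundary_mono[OF subset_UNIV this] show ?thesis by (simp del: join_power.simps)
  qed
  from singular_relboundary_add[OF 1 this] have "singular_relboundary k ?X {} c" by simp
  then show thesis using that by (auto simp: singular_boundary)
qed

text \<open>A cellular resolution of the cyclic group inside the join powers: the cone construction
  makes every cycle of one join power bound in the next.\<close>

lemma lens_chains:
  assumes T: "compact_space T" "Hausdorff_space T" "topspace T \<noteq> {}"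
    and r: "continuous_map T T r" and p: "\<And>x. x \<in> topspace T \<Longrightarrow> (r ^^ p) x = x"
  shows "\<exists>y. (\<forall>k. singular_chain k (join_power T k) (y k)) \<and>
    (\<forall>k. even k \<longrightarrow> chain_boundary (Suc k) (y (Suc k)) = chain_map k (join_map r) (y k) - y k) \<and>
    (\<forall>k. odd k \<longrightarrow> chain_boundary (Suc k) (y (Suc k)) = (\<Sum>i<p. chain_map k (join_map r ^^ i) (y k))) \<and>
    chain_pair (\<lambda>_. 1) (y 0) = 1"
proof -
  let ?R = "join_map r"
  have R: "continuous_map (join_power T k) (join_power T k) ?R" for k
    by (rule continuous_map_join_map[OF T(1,2) r])
  have Ri: "continuous_map (join_power T k) (join_power T k) (?R ^^ i)" for k i
  proof (induction i)
    case (Suc i) show ?case unfolding funpow.simps by (rule continuous_map_compose[OF Suc R])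
  qed simp
  have Rpow: "(?R ^^ i) c = join_map (r ^^ i) c" for i c
    by (induction i arbitrary: c) (simp_all add: join_map_compose id_def o_def)
  have Rp: "(?R ^^ p) c = c" if "c \<in> topspace (join_power T k)" for c k
    using join_map_cong[OF that, of "r ^^ p" "\<lambda>x. x"] p by (simp add: Rpow)
  let ?N = "\<lambda>k c. \<Sum>i<p. chain_map k (?R ^^ i) c"
  \<comment> \<open>The invariant contains what the next step needs for a cycle:
    \<open>chain_map k ?R y - y\<close> is one if the boundary of \<open>y\<close> is invariant
    under \<open>?R\<close>, and \<open>?N k y\<close> is one if the norm kills that boundary. For
    \<open>k = 0\<close> the boundary is 0, whatever the truncated \<open>k - 1\<close>
    means.\<close>
  define P where "P k y \<longleftrightarrow> singular_chain k (join_power T k) y \<and>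
    (k = 0 \<longrightarrow> chain_pair (\<lambda>_. 1) y = 1) \<and>
    (even k \<longrightarrow> chain_map (k - 1) ?R (chain_boundary k y) = chain_boundary k y) \<and>
    (odd k \<longrightarrow> ?N (k - 1) (chain_boundary k y) = 0)" for k y
  define Q where "Q k y y' \<longleftrightarrow> chain_boundary (Suc k) y' = (if even k then chain_map k ?R y - y else ?N k y)" for k y y'
  obtain h where h: "h \<in> topspace T" using T(3) by blast
  have "\<exists>y. \<forall>k. P k (y k) \<and> Q k (y k) (y (Suc k))"
  proof (rule dependent_nat_choice)
    let ?f = "restrict (\<lambda>_. [0 \<mapsto> (h, 1::real)]) (standard_simplex 0)"
    have "[0 \<mapsto> (h, 1::real)] \<in> topspace (join_power T 0)" using h by simp
    then have "singular_simplex 0 (join_power T 0) ?f"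
      by (simp add: singular_simplex_def)
    then show "\<exists>y. P 0 y"
      by (intro exI[of _ "frag_of ?f"]) (simp add: P_def singular_chain_of chain_boundary_def del: join_power.simps)
  next
    fix y k assume P: "P k y"
    let ?z = "if even k then chain_map k ?R y - y else ?N k y"
    have y: "singular_chain k (join_power T k) y" using P by (simp add: P_def)
    have RN: "chain_map k ?R (?N k y) = ?N k y"
    proof -
      have comm: "chain_map k ?R (chain_map k (?R ^^ i) y) = chain_map k (?R ^^ i) (chain_map k ?R y)" for i
        using chain_map_funpow[OF y, where R = "?R" and i = i] fun_cong[OF chain_map_compose[of k ?R "?R ^^ i"], of y]
        by simp
      have "chain_map k ?R (?N k y) = (\<Sum>i<p. chain_map k (?R ^^ i) (chain_map k ?R y))"
        by (simp add: chain_map_sum comm)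
      then show ?thesis using sum_chain_map_rotate[OF y Rp] by simp
    qed
    have z: "singular_chain k (join_power T k) ?z"
      using singular_chain_chain_map[OF y Ri] singular_chain_chain_map[OF y R] y
      by (auto intro!: singular_chain_diff singular_chain_sum)
    have "chain_boundary k ?z = 0"
    proof (cases "even k")
      case True
      then show ?thesis using P chain_boundary_chain_map[OF y, of ?R]
        by (simp add: P_def chain_boundary_diff)
    next
      case False
      have "chain_boundary k (chain_map k (?R ^^ i) y) = chain_map (k - Suc 0) (?R ^^ i) (chain_boundary k y)" for i
        by (rule chain_boundary_chain_map[OF y])
      with False show ?thesis using P
        by (simp add: P_def chain_boundary_sum o_def)
    qed
    then have cyc: "singular_relcycle k (join_power T k) {} ?z" using z by (simp add: singular_cycle)
    have "chain_map 0 (\<lambda>_. a) ?z = 0" if "k = 0" for a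
      using that chain_map_compose[of 0 "\<lambda>_. a" ?R] by (simp add: chain_map_diff o_def fun_eq_iff)
    then obtain y' where y': "singular_chain (Suc k) (join_power T (Suc k)) y'" "chain_boundary (Suc k) y' = ?z"
      using join_power_cycle_bounds[OF T(3) cyc] by metis
    have "P (Suc k) y'"
    proof -
      have "?N k (chain_map k ?R y - y) = 0"
        using sum_chain_map_rotate[OF y Rp] by (simp add: chain_map_diff sum_subtractf)
      then show ?thesis using y' RN by (simp add: P_def del: join_power.simps)
    qed
    moreover have "Q k y y'" using y' by (simp add: Q_def)
    ultimately show "\<exists>y'. P (Suc k) y' \<and> Q k y y'" by blast
  qed
  then obtain y where "\<And>k. P k (y k)" "\<And>k. Q k (y k) (y (Suc k))" by blast
  then show ?thesis unfolding P_def Q_def by (intro exI[of _ y]) simp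
qed

section \<open>Angular sectors as labels, and the Borsuk-Ulam theorem\<close>

definition sector :: "nat \<Rightarrow> complex \<Rightarrow> int" where
  "sector p z = \<lfloor>p * Arg2pi z / (2 * pi)\<rfloor>"

lemma sector_range:
  assumes "p > 0" shows "0 \<le> sector p z" "sector p z < int p"
proof -
  have "0 \<le> p * Arg2pi z / (2 * pi)" using Arg2pi_ge_0 by simp
  then show "0 \<le> sector p z" by (simp add: sector_def)
  have "p * Arg2pi z / (2 * pi) < p"
    using Arg2pi_lt_2pi[of z] assms by (simp add: divide_less_eq)
  then show "sector p z < int p" by (simp add: sector_def floor_less_iff)
qed

lemma sector_rotate:
  assumes p: "p > 1" and z: "z \<noteq> 0"
  shows "sector p (cis (2 * pi / p) * z) = (sector p z + 1) mod int p"
proof -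
  have "2 * pi / p < 2 * pi" using p by (simp add: field_simps)
  then have a: "Arg2pi (cis (2 * pi / p)) = 2 * pi / p"
    by (intro Arg2pi_unique[of 1]) (simp_all add: cis_conv_exp mult.commute)
  have sum: "p * (2 * pi / p + Arg2pi z) / (2 * pi) = p * Arg2pi z / (2 * pi) + 1"
    using p by (simp add: field_simps)
  show ?thesis
  proof (cases "2 * pi / p + Arg2pi z < 2 * pi")
    case True
    then have "Arg2pi (cis (2 * pi / p) * z) = 2 * pi / p + Arg2pi z"
      using Arg2pi_times[of "cis (2 * pi / p)" z] z by (simp add: a)
    then have eq: "sector p (cis (2 * pi / p) * z) = sector p z + 1"
      by (simp add: sector_def sum)
    with sector_range[of p "cis (2 * pi / p) * z"] p show ?thesis by simp
  next
    case False
    then have "Arg2pi (cis (2 * pi / p) * z) = 2 * pi / p + Arg2pi z - 2 * pi"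
      using Arg2pi_times[of "cis (2 * pi / p)" z] z by (simp add: a)
    moreover have "p * (2 * pi / p + Arg2pi z - 2 * pi) / (2 * pi) = p * Arg2pi z / (2 * pi) + of_int (1 - int p)"
      using p by (simp add: field_simps)
    ultimately have eq: "sector p (cis (2 * pi / p) * z) = sector p z + (1 - int p)"
      unfolding sector_def by (metis floor_add_int)
    have "0 \<le> sector p z + 1 - int p" "sector p z + 1 - int p < int p"
      using sector_range[of p "cis (2 * pi / p) * z"] p eq by simp_all
    then have "(sector p z + 1 - int p) mod int p = sector p z + 1 - int p" by (rule mod_pos_pos_trivial)
    moreover have "(sector p z + 1 - int p) mod int p = (sector p z + 1) mod int p" by simp
    ultimately show ?thesis using eq by linarith
  qed
qed

text \<open>The rays that bound the \<open>p\<close> sectors consist exactly of the points whose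
  \<open>p\<close>-th power is a nonnegative real. On a connected set whose image avoids them, the
  real number under the floor varies continuously and is never an integer.\<close>

lemma sector_constant:
  assumes S: "connectedin X S" and f: "continuous_map X euclidean f"
    and avoid: "\<And>x. x \<in> S \<Longrightarrow> f x ^ p \<notin> \<real>\<^sub>\<ge>\<^sub>0" and p: "p > 0"
    and xy: "x \<in> S" "y \<in> S"
  shows "sector p (f x) = sector p (f y)"
proof -
  let ?g = "\<lambda>z. p * Arg2pi z / (2 * pi)"
  have nn: "z \<notin> \<real>\<^sub>\<ge>\<^sub>0" if "z ^ p \<notin> \<real>\<^sub>\<ge>\<^sub>0" for z :: complex
  proof
    assume "z \<in> \<real>\<^sub>\<ge>\<^sub>0"
    then obtain r where "z = of_real r" "0 \<le> r" by (rule nonneg_Reals_cases)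
    then have *: "z ^ p = of_real (r ^ p)" "0 \<le> r ^ p" by simp_all
    have "z ^ p \<in> \<real>\<^sub>\<ge>\<^sub>0" unfolding *(1) nonneg_Reals_of_real_iff by (rule *(2))
    with that show False by contradiction
  qed
  have fS: "f ` S \<subseteq> - \<real>\<^sub>\<ge>\<^sub>0"
  proof (rule image_subsetI)
    fix x assume "x \<in> S"
    from nn[OF avoid[OF this]] show "f x \<in> - \<real>\<^sub>\<ge>\<^sub>0" by simp
  qed
  have "connected (f ` S)"
    using connectedin_continuous_map_image[OF f S] by (simp add: connectedin_iff_connected)
  moreover have "continuous_on (f ` S) Arg2pi"
    by (rule continuous_at_imp_continuous_on) (use fS continuous_at_Arg2pi in blast)
  then have "continuous_on (f ` S) ?g" by (intro continuous_intros) simp_all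
  ultimately have conn: "connected (?g ` f ` S)" by (rule connected_continuous_image[rotated])
  have nonint: "?g (f s) \<noteq> of_int m" if "s \<in> S" for s m
  proof
    assume m: "?g (f s) = of_int m"
    have "p * Arg2pi (f s) = 2 * pi * of_int m" using m p by (simp add: field_simps)
    then have "cis (Arg2pi (f s)) ^ p = cis (2 * pi * of_int m)" by (simp only: Complex.DeMoivre)
    also have "\<dots> = 1" by (rule cis_multiple_2pi) simp
    finally have "cis (Arg2pi (f s)) ^ p = 1" .
    moreover have "f s = of_real (norm (f s)) * cis (Arg2pi (f s))"
      unfolding cis_conv_exp by (rule Arg2pi_eq)
    from arg_cong[OF this, of "\<lambda>z. z ^ p"]
    have "f s ^ p = of_real (norm (f s)) ^ p * cis (Arg2pi (f s)) ^ p"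
      by (simp only: power_mult_distrib)
    ultimately have "f s ^ p = of_real (norm (f s) ^ p)" by simp
    then show False using avoid[OF that] by (simp del: of_real_power)
  qed
  have le: "\<lfloor>?g (f b)\<rfloor> \<le> \<lfloor>?g (f a)\<rfloor>" if "a \<in> S" "b \<in> S" for a b
  proof (rule ccontr)
    assume "\<not> ?thesis"
    then have "?g (f a) \<le> of_int \<lfloor>?g (f b)\<rfloor>" "of_int \<lfloor>?g (f b)\<rfloor> \<le> ?g (f b)"
      by linarith+
    then have "of_int \<lfloor>?g (f b)\<rfloor> \<in> ?g ` f ` S"
      using conn that unfolding connected_iff_interval by blast
    then show False using nonint by (metis (no_types, lifting) imageE)
  qed
  show ?thesis unfolding sector_def using le xy by (intro antisym) auto
qed

text \<open>If the conclusion fails, the sectors of the \<open>v l\<close> are labels that do not wrap on the sets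
  where \<open>v l ^ p\<close> avoids the nonnegative reals. The product of all Bockstein classes then vanishes
  on small simplices, although its value on the top lens chain is nonzero modulo \<open>p\<close>.\<close>

theorem cyclic_borsuk_ulam_aux:
  fixes v :: "nat \<Rightarrow> 'a formal_comb \<Rightarrow> complex"
  assumes T: "compact_space T" "Hausdorff_space T" "topspace T \<noteq> {}" and p: "p \<ge> 2"
    and r: "continuous_map T T r" "\<And>x. x \<in> topspace T \<Longrightarrow> (r ^^ p) x = x"
    and v: "\<And>l. l < L \<Longrightarrow> continuous_map (join_power T (2 * L)) euclidean (v l)"
    and equi: "\<And>l c. l < L \<Longrightarrow> c \<in> topspace (join_power T (2 * L)) \<Longrightarrow>
      v l (join_map r c) = cis (2 * pi / p) * v l c"
  shows "\<exists>c\<in>topspace (join_power T (2 * L)). \<forall>l<L. v l c ^ p \<in> \<real>\<^sub>\<ge>\<^sub>0"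
proof (rule ccontr)
  let ?X = "join_power T (2 * L)" and ?R = "join_map r"
  assume "\<not> ?thesis"
  then have cover: "\<exists>l<L. v l c ^ p \<notin> \<real>\<^sub>\<ge>\<^sub>0" if "c \<in> topspace ?X" for c using that by blast
  \<comment> \<open>The label needs a value also where \<open>v l\<close> vanishes, and takes it
    from the first of the functions that does not vanish there. The zero sets are invariant under
    \<open>?R\<close>, hence so is this choice, and the label stays equivariant.\<close>
  define first where "first c = (LEAST l. l < L \<and> v l c \<noteq> 0)" for c
  define \<tau> where "\<tau> l c = sector p (if l < L \<and> v l c \<noteq> 0 then v l c else v (first c) c)" for l c
  have nz: "z \<noteq> 0" if "z ^ p \<notin> \<real>\<^sub>\<ge>\<^sub>0" for z :: complex using that p by (auto simp: power_0_left)
  have first: "first c < L \<and> v (first c) c \<noteq> 0" if "c \<in> topspace ?X" for c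
    unfolding first_def by (rule LeastI_ex) (use cover[OF that] nz in blast)
  have R: "continuous_map ?X ?X ?R" by (rule continuous_map_join_map[OF T(1,2) r(1)])
  interpret cyclic_labels p ?X ?R \<tau>
  proof
    show "2 \<le> p" by (rule p)
    show "?R c \<in> topspace ?X" if "c \<in> topspace ?X" for c using R that by (auto simp: continuous_map_def)
    show "0 \<le> \<tau> l c \<and> \<tau> l c < int p" for l c using sector_range p by (simp add: \<tau>_def)
    show "\<tau> l (?R c) = (\<tau> l c + 1) mod int p" if c: "c \<in> topspace ?X" for l c
    proof -
      have nz_iff: "v l (?R c) = 0 \<longleftrightarrow> v l c = 0" if "l < L" for l using equi[OF that c] by simp
      then have "first (?R c) = first c"
        unfolding first_def by (intro arg_cong[of _ _ Least]) (auto simp: fun_eq_iff)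
      then show ?thesis
        using nz_iff[of l] first[OF c] equi[OF _ c] sector_rotate[of p] p by (auto simp: \<tau>_def)
    qed
  qed
  obtain y where y: "\<And>k. singular_chain k (join_power T k) (y k)"
    "\<And>k. even k \<Longrightarrow> chain_boundary (Suc k) (y (Suc k)) = chain_map k ?R (y k) - y k"
    "\<And>k. odd k \<Longrightarrow> chain_boundary (Suc k) (y (Suc k)) = (\<Sum>i<p. chain_map k (?R ^^ i) (y k))"
    "chain_pair (\<lambda>_. 1) (y 0) = 1"
    using lens_chains[OF T r(1), of p] r(2) by blast
  have yX: "singular_chain k ?X (y k)" if "k \<le> 2 * L" for k
    by (rule singular_chain_join_power_mono[OF T(3) that y(1)])
  define \<C> where "\<C> = (\<lambda>l. {c \<in> topspace ?X. v l c ^ p \<notin> \<real>\<^sub>\<ge>\<^sub>0}) ` {..<L}"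
  have op: "openin ?X U" if U: "U \<in> \<C>" for U
  proof -
    obtain l where l: "l < L" "U = {c \<in> topspace ?X. v l c ^ p \<notin> \<real>\<^sub>\<ge>\<^sub>0}" using U by (auto simp: \<C>_def)
    have "open {z :: complex. z ^ p \<notin> \<real>\<^sub>\<ge>\<^sub>0}"
      using open_vimage[of "- \<real>\<^sub>\<ge>\<^sub>0" "\<lambda>z::complex. z ^ p"]
      by (simp add: vimage_def open_Compl continuous_on_power)
    then show ?thesis
      using openin_continuous_map_preimage[OF v[OF l(1)], of "{z. z ^ p \<notin> \<real>\<^sub>\<ge>\<^sub>0}"] l(2) by simp
  qed
  have cov: "topspace ?X \<subseteq> \<Union>\<C>" using cover by (auto simp: \<C>_def)
  obtain s where s: "\<And>m f. s \<le> m \<Longrightarrow> f \<in> Poly_Mapping.keys ((singular_subdivision (2 * L) ^^ m) (y (2 * L))) \<Longrightarrow>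
      \<exists>V\<in>\<C>. f \<in> standard_simplex (2 * L) \<rightarrow> V"
    using sufficient_iterated_singular_subdivision_exists[OF op cov yX[OF order_refl]] by metis
  \<comment> \<open>All lens chains are subdivided equally often. Subdivision commutes with
    boundaries and chain maps, so the boundary formulas survive while the simplices of the top chain
    become small.\<close>
  define z where "z m k = (singular_subdivision k ^^ m) (y k)" for m k
  have z: "(\<forall>k\<le>2 * L. singular_chain k ?X (z m k)) \<and>
    (\<forall>k. even k \<and> Suc k \<le> 2 * L \<longrightarrow> chain_boundary (Suc k) (z m (Suc k)) = chain_map k ?R (z m k) - z m k) \<and>
    (\<forall>k. odd k \<and> Suc k \<le> 2 * L \<longrightarrow> chain_boundary (Suc k) (z m (Suc k)) = (\<Sum>i<p. chain_map k (?R ^^ i) (z m k))) \<and>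
    z m 0 = y 0" for m
  proof (induction m)
    case 0 then show ?case using y yX by (simp add: z_def)
  next
    case (Suc m)
    have zS: "z (Suc m) k = singular_subdivision k (z m k)" for k by (simp add: z_def)
    have sc: "singular_chain k ?X (z m k)" if "k \<le> 2 * L" for k using Suc that by blast
    have nat: "singular_subdivision k (chain_map k g (z m k)) = chain_map k g (singular_subdivision k (z m k))"
      if "k \<le> 2 * L" for k and g :: "'a formal_comb \<Rightarrow> 'a formal_comb"
      by (rule naturality_singular_subdivision[OF sc[OF that]])
    have bd: "chain_boundary (Suc k) (singular_subdivision (Suc k) (z m (Suc k))) =
        singular_subdivision k (chain_boundary (Suc k) (z m (Suc k)))" if "Suc k \<le> 2 * L" for k
      using chain_boundary_singular_subdivision[OF sc[OF that]] by simp
    have sd_sum: "singular_subdivision k (\<Sum>i<p. c i) = (\<Sum>i<p. singular_subdivision k (c i))" for k c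
      by (induction p) (simp_all add: singular_subdivision_add)
    have "singular_chain 0 ?X (y 0)" by (rule yX) simp
    then have 0: "z (Suc m) 0 = y 0" using Suc by (simp add: zS singular_subdivision_zero)
    show ?case
      using Suc 0 sc by (auto simp: zS bd nat singular_subdivision_diff sd_sum intro: singular_chain_singular_subdivision)
  qed
  have "chain_pair (bock_power L) (z s (2 * L)) mod int p = 1"
    by (rule chain_pair_bock_power[where d = "2 * L"]) (use z y(4) in simp_all)
  moreover have "chain_pair (bock_power L) (z s (2 * L)) = chain_pair (\<lambda>_. 0) (z s (2 * L))"
  proof (rule chain_pair_cong)
    fix f assume f: "f \<in> Poly_Mapping.keys (z s (2 * L))"
    then obtain V where "V \<in> \<C>" "f \<in> standard_simplex (2 * L) \<rightarrow> V" using s[of s f] by (auto simp: z_def)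
    then obtain l where l: "l < L" "\<And>x. x \<in> standard_simplex (2 * L) \<Longrightarrow> v l (f x) ^ p \<notin> \<real>\<^sub>\<ge>\<^sub>0"
      by (fastforce simp: \<C>_def)
    have fc: "continuous_map (subtopology (powertop_real UNIV) (standard_simplex (2 * L))) ?X f"
    proof -
      have "singular_chain (2 * L) ?X (z s (2 * L))" using z by blast
      then have "singular_simplex (2 * L) ?X f" using f unfolding singular_chain_def by blast
      then show ?thesis by (simp add: singular_simplex_def)
    qed
    have const: "sector p (v l (f x)) = sector p (v l (f x'))"
      if "x \<in> standard_simplex (2 * L)" "x' \<in> standard_simplex (2 * L)" for x x'
      by (rule sector_constant[OF _ continuous_map_compose_app[OF fc v[OF l(1)]] l(2) _ that])
        (use p connectedin_standard_simplex in \<open>simp_all add: connectedin_subtopology\<close>)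
    have "\<tau> l (vertices f i) = \<tau> l (vertices f j)" if "i \<le> 2 * L" "j \<le> 2 * L" for i j
      using that const[of "\<lambda>k. if k = i then 1 else 0" "\<lambda>k. if k = j then 1 else 0"] l nz
      by (simp add: \<tau>_def simplicial_vertex_def)
    then show "bock_power L (vertices f) = 0"
      using l(1) by (intro bock_power_eq_0[OF l(1)]) simp_all
  qed
  ultimately show False by (simp add: chain_pair_def)
qed

text \<open>The previous theorem leaves the \<open>p\<close>-th powers nonnegative instead of zero.
  Adding the functions turned by half a sector excludes positive values; this makes
  \<open>2 * N\<close> functions, and each costs two dimensions.\<close>

theorem cyclic_borsuk_ulam:
  fixes w :: "nat \<Rightarrow> 'a formal_comb \<Rightarrow> complex"
  assumes T: "compact_space T" "Hausdorff_space T" "topspace T \<noteq> {}" and p: "p \<ge> 2"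
    and r: "continuous_map T T r" "\<And>x. x \<in> topspace T \<Longrightarrow> (r ^^ p) x = x"
    and w: "\<And>l. l < N \<Longrightarrow> continuous_map (join_power T (4 * N)) euclidean (w l)"
    and equi: "\<And>l c. l < N \<Longrightarrow> c \<in> topspace (join_power T (4 * N)) \<Longrightarrow>
      w l (join_map r c) = cis (2 * pi / p) * w l c"
  shows "\<exists>c\<in>topspace (join_power T (4 * N)). \<forall>l<N. w l c = 0"
proof -
  \<comment> \<open>The \<open>p\<close>-th powers of \<open>w l\<close> and of \<open>cis (pi / p) * w l\<close> are opposite.\<close>
  define v where "v l = (if l < N then w l else (\<lambda>c. cis (pi / p) * w (l - N) c))" for l
  have N4: "2 * (2 * N) = 4 * N" by simp
  have v: "continuous_map (join_power T (4 * N)) euclidean (v l)" if "l < 2 * N" for l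
    using that w by (auto simp: v_def intro!: continuous_map_mult_euclidean)
  have ve: "v l (join_map r c) = cis (2 * pi / p) * v l c"
    if "l < 2 * N" "c \<in> topspace (join_power T (4 * N))" for l c
    using that equi by (auto simp: v_def)
  obtain c where c: "c \<in> topspace (join_power T (4 * N))" "\<And>l. l < 2 * N \<Longrightarrow> v l c ^ p \<in> \<real>\<^sub>\<ge>\<^sub>0"
    using cyclic_borsuk_ulam_aux[OF T p r(1), of "2 * N" v, unfolded N4] r(2) v ve by blast
  have "w l c = 0" if "l < N" for l
  proof -
    have "w l c ^ p \<in> \<real>\<^sub>\<ge>\<^sub>0" using c(2)[of l] that by (simp add: v_def)
    moreover have "cis (pi / p) ^ p = - 1" using p by (simp add: Complex.DeMoivre)
    then have "- (w l c ^ p) \<in> \<real>\<^sub>\<ge>\<^sub>0"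
      using c(2)[of "l + N"] that by (simp add: v_def power_mult_distrib)
    ultimately have "w l c ^ p = 0"
      by (auto simp: complex_nonneg_Reals_iff complex_eq_iff)
    then show ?thesis by simp
  qed
  then show ?thesis using c(1) by blast
qed

section \<open>Approximate rotations\<close>

lemma compact_space_attains_inf:
  fixes f :: "'a \<Rightarrow> real"
  assumes "compact_space X" "topspace X \<noteq> {}" "continuous_map X euclideanreal f"
  obtains x where "x \<in> topspace X" "\<And>y. y \<in> topspace X \<Longrightarrow> f x \<le> f y"
proof -
  have "compact (f ` topspace X)"
    using image_compactin[OF _ assms(3)] assms(1) by (auto simp: compact_space_def)
  then obtain s where "s \<in> f ` topspace X" "\<And>t. t \<in> f ` topspace X \<Longrightarrow> s \<le> t"
    using compact_attains_inf[of "f ` topspace X"] assms(2) by blast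
  then show thesis using that by blast
qed

lemma compact_space_attains_sup:
  fixes f :: "'a \<Rightarrow> real"
  assumes "compact_space X" "topspace X \<noteq> {}" "continuous_map X euclideanreal f"
  obtains x where "x \<in> topspace X" "\<And>y. y \<in> topspace X \<Longrightarrow> f y \<le> f x"
  using compact_space_attains_inf[OF assms(1,2) continuous_map_minus[OF assms(3)]] by auto

locale compact_topological_group = topological_group G T for G (structure) and T +
  assumes compact: "compact_space T" and Hausdorff: "Hausdorff_space T"
begin

lemma nonempty: "topspace T \<noteq> {}"
  using topspace_eq by auto

lemma continuous_mult_of:
  assumes "continuous_map X T f" "continuous_map X T g"
  shows "continuous_map X T (\<lambda>x. f x \<otimes> g x)"
  using continuous_map_compose_app[OF continuous_map_pairedI[OF assms] continuous_mult] by simp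

lemma continuous_left_mult: "a \<in> carrier G \<Longrightarrow> continuous_map T T (\<lambda>x. a \<otimes> x)"
  by (rule continuous_mult_of) (simp_all add: topspace_eq)

lemma continuous_right_mult: "a \<in> carrier G \<Longrightarrow> continuous_map T T (\<lambda>x. x \<otimes> a)"
  by (rule continuous_mult_of) (simp_all add: topspace_eq)

lemma finite_translates_cover:
  assumes U: "openin T U" "u \<in> U"
  obtains Y where "finite Y" "Y \<subseteq> carrier G" "\<And>x. x \<in> carrier G \<Longrightarrow> \<exists>y\<in>Y. y \<otimes> x \<in> U"
proof -
  have u: "u \<in> carrier G" using U openin_subset topspace_eq by blast
  define V where "V y = {x \<in> topspace T. y \<otimes> x \<in> U}" for y
  have op: "openin T (V y)" if "y \<in> carrier G" for y
    unfolding V_def by (rule openin_continuous_map_preimage[OF continuous_left_mult[OF that] U(1)])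
  have "topspace T \<subseteq> \<Union>(V ` carrier G)"
  proof
    fix x assume x: "x \<in> topspace T"
    then have "x \<in> V (u \<otimes> inv x)" using U u by (simp add: V_def topspace_eq m_assoc)
    then show "x \<in> \<Union>(V ` carrier G)" using x u topspace_eq by auto
  qed
  then obtain \<F> where F: "finite \<F>" "\<F> \<subseteq> V ` carrier G" "topspace T \<subseteq> \<Union>\<F>"
    using compactinD[of T "topspace T" "V ` carrier G"] compact op unfolding compact_space_def by blast
  then obtain Y where "finite Y" "Y \<subseteq> carrier G" "\<F> = V ` Y" by (metis finite_subset_image)
  then show thesis using that[of Y] F(3) unfolding V_def topspace_eq by blast
qed

lemma slot_act_in_join_power:
  assumes "c \<in> topspace (join_power T n)" "w \<in> carrier G"
  shows "slot_act G S c w \<in> topspace (join_power T n)"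
proof -
  have c: "c \<in> convex_combs (carrier G) n" using assms(1) by (simp add: topspace_join_power topspace_eq)
  have "slot_act G S c w \<in> convex_combs (carrier G) n"
    unfolding convex_combs_def mem_Collect_eq coeff_at_slot_act
  proof (intro conjI allI impI)
    show "slot_act G S c w i = None" if "n < i" for i
      using c that by (simp add: convex_combs_def slot_act_def)
    fix i g t assume "slot_act G S c w i = Some (g, t)"
    then obtain k where "c i = Some (k, t)" "g = (if i \<in> S then k \<otimes> w else k)"
      by (auto simp: slot_act_def)
    then show "g \<in> carrier G" "0 < t" using c assms(2) by (auto simp: convex_combs_def)
  next
    show "(\<Sum>i\<le>n. coeff_at c i) = 1" using c by (simp add: convex_combs_def)
  qed
  then show ?thesis by (simp add: topspace_join_power topspace_eq)
qed

lemma continuous_map_slot_act: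
  "continuous_map (prod_topology (join_power T n) T) (join_power T n) (\<lambda>(c, w). slot_act G S c w)"
proof (rule continuous_map_into_join_power[OF compact Hausdorff])
  let ?P = "prod_topology (join_power T n) T"
  show "(case z of (c, w) \<Rightarrow> slot_act G S c w) \<in> topspace (join_power T n)" if "z \<in> topspace ?P" for z
    using that slot_act_in_join_power topspace_eq by auto
  show "continuous_map ?P euclideanreal (\<lambda>z. coeff_at (case z of (c, w) \<Rightarrow> slot_act G S c w) i)" for i
    by (simp add: split_def continuous_map_compose_app[OF continuous_map_fst continuous_map_coeff_at])
  fix i A assume A: "openin T A"
  show "openin ?P {z \<in> topspace ?P. (case z of (c, w) \<Rightarrow> slot_act G S c w) \<in> comb_slot i A}"
  proof (subst openin_subopen, clarify)
    fix c w assume cw: "(c, w) \<in> topspace ?P" "slot_act G S c w \<in> comb_slot i A"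
    show "\<exists>U. openin ?P U \<and> (c, w) \<in> U \<and> U \<subseteq> {z \<in> topspace ?P. (case z of (c, w) \<Rightarrow> slot_act G S c w) \<in> comb_slot i A}"
    proof (cases "i \<in> S")
      case False
      then have "slot_act G S c w \<in> comb_slot i A \<longleftrightarrow> c \<in> comb_slot i A" for c w
        by (auto simp: slot_act_def comb_slot_def)
      then show ?thesis
        using cw openin_comb_slot[OF A, of n i]
        by (intro exI[of _ "(topspace (join_power T n) \<inter> comb_slot i A) \<times> topspace T"])
          (auto simp: openin_prod_Times_iff)
    next
      case True
      from cw(2) True obtain g t where g: "c i = Some (g, t)" "g \<otimes> w \<in> A"
        by (auto simp: slot_act_def comb_slot_def)
      have gT: "g \<in> topspace T" "w \<in> topspace T" using cw(1) join_power_in(1)[of c T n, OF _ g(1)] by auto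
      let ?M = "{p \<in> topspace (prod_topology T T). (case p of (x, y) \<Rightarrow> x \<otimes> y) \<in> A}"
      have "openin (prod_topology T T) ?M"
        by (rule openin_continuous_map_preimage[OF continuous_mult A])
      then have "\<forall>x y. (x, y) \<in> ?M \<longrightarrow> (\<exists>U V. openin T U \<and> openin T V \<and> x \<in> U \<and> y \<in> V \<and> U \<times> V \<subseteq> ?M)"
        by (simp only: openin_prod_topology_alt)
      moreover have "(g, w) \<in> ?M" using gT g(2) by simp
      ultimately have "\<exists>U V. openin T U \<and> openin T V \<and> g \<in> U \<and> w \<in> V \<and> U \<times> V \<subseteq> ?M" by iprover
      then obtain B D where BD: "openin T B" "openin T D" "g \<in> B" "w \<in> D" "B \<times> D \<subseteq> ?M"
        by (elim exE conjE)
      show ?thesis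
        using BD(3-5) cw(1) g(1) True openin_comb_slot[OF BD(1), of n i] BD(2) openin_subset[OF BD(2)]
        by (intro exI[of _ "(topspace (join_power T n) \<inter> comb_slot i B) \<times> D"])
          (auto simp: openin_prod_Times_iff comb_slot_def slot_act_def)
    qed
  qed
qed

lemma slot_act_one:
  assumes "c \<in> topspace (join_power T n)"
  shows "slot_act G S c \<one> = c"
proof
  fix i show "slot_act G S c \<one> i = c i"
    using join_power_in(1)[OF assms, of i] topspace_eq by (cases "c i") (auto simp: slot_act_def)
qed

text \<open>The tube lemma around the compact set of all pairs \<open>(c, \<one>)\<close>, where
  \<open>slot_act\<close> does not move \<open>c\<close>, gives a neighbourhood that serves all
  \<open>c\<close> at once.\<close>

lemma slot_act_uniform:
  fixes u :: "'a formal_comb \<Rightarrow> complex"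
  assumes u: "continuous_map (join_power T m) euclidean u" and e: "e > 0"
  shows "\<exists>W. openin T W \<and> \<one> \<in> W \<and>
    (\<forall>c\<in>topspace (join_power T m). \<forall>w\<in>W. norm (u (slot_act G S c w) - u c) < e)"
proof -
  let ?P = "prod_topology (join_power T m) T"
  let ?H = "\<lambda>p. norm (u (slot_act G S (fst p) (snd p)) - u (fst p))"
  have "continuous_map ?P (join_power T m) (\<lambda>p. slot_act G S (fst p) (snd p))"
    using continuous_map_slot_act[of m S] by (simp add: split_def)
  then have "continuous_map ?P euclideanreal ?H"
    by (intro continuous_intros continuous_map_compose_app[OF _ u] continuous_map_compose_app[OF continuous_map_fst u])
  from openin_continuous_map_preimage[OF this, of "{..<e}"]
  have op: "openin ?P {p \<in> topspace ?P. ?H p < e}" by simp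
  have "compactin (join_power T m) (topspace (join_power T m))"
    using compact_space_join_power[OF compact] by (simp add: compact_space_def)
  moreover have "topspace (join_power T m) \<times> {\<one>} \<subseteq> {p \<in> topspace ?P. ?H p < e}"
    using e by (auto simp: slot_act_one topspace_eq)
  ultimately obtain U V where "openin T V" "topspace (join_power T m) \<subseteq> U" "\<one> \<in> V" "U \<times> V \<subseteq> {p \<in> topspace ?P. ?H p < e}"
    using tube_lemma_left[OF op, of "topspace (join_power T m)" \<one>] topspace_eq by auto
  then show ?thesis by (intro exI[of _ V]) fastforce
qed

end

lemma sum_periodic_shift:
  fixes e :: "nat \<Rightarrow> complex"
  assumes "\<And>k. e (k + p) = e k"
  shows "(\<Sum>k<p. e (k + b)) = (\<Sum>k<p. e k)"
proof (induction b)
  case (Suc b)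
  have "(\<Sum>k<p. e (Suc k + b)) + e b = (\<Sum>k<Suc p. e (k + b))"
    by (simp add: sum.lessThan_Suc_shift del: sum.lessThan_Suc)
  also have "\<dots> = (\<Sum>k<p. e (k + b)) + e b" using assms[of b] by (simp add: add.commute)
  finally show ?case using Suc by simp
qed simp

lemma cis_add_2pi_int: "n \<in> \<int> \<Longrightarrow> cis (x + 2 * pi * n) = cis x"
  by (simp add: cis_multiple_2pi flip: cis_mult)

lemma cis_periodic:
  fixes a k :: nat
  assumes "p > 0"
  shows "cis (2 * pi * (a * (k + p)) / p) = cis (2 * pi * (a * k) / p)"
proof -
  have "2 * pi * (a * (k + p)) / p = 2 * pi * (a * k) / p + 2 * pi * a"
    using assms by (simp add: field_simps)
  then show ?thesis using cis_add_2pi_int[of "real a" "2 * pi * (a * k) / p"] by simp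
qed

context compact_topological_group
begin

text \<open>The powers \<open>h [^] k\<close> with \<open>k < p\<close> map the join of Z/p to that
  of the group. Adding \<open>k\<close> to the exponents modulo \<open>p\<close> differs from
  multiplication by \<open>h [^] k\<close> only by \<open>h [^] p\<close> in some slots, an error
  below \<open>e\<close> because of \<open>W\<close>; \<open>rot\<close> costs another
  \<open>e\<close>. Averaging over Z/p gives exactly equivariant functions which, after division by
  \<open>p\<close>, are within less than \<open>2 * e\<close> of \<open>u l\<close>. At a common
  zero this contradicts \<open>large\<close>.\<close>

lemma no_approximate_rotation_aux:
  fixes a p N :: nat
  assumes F: "continuous_map (join_power T (4 * N)) X F"
    and u: "\<And>l. l < N \<Longrightarrow> continuous_map X euclidean (u l :: _ \<Rightarrow> complex)"
    and W: "\<And>S l c w. S \<subseteq> {..4 * N} \<Longrightarrow> l < N \<Longrightarrow> c \<in> topspace (join_power T (4 * N)) \<Longrightarrow> w \<in> W \<Longrightarrow>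
        norm (u l (F (slot_act G S c w)) - u l (F c)) < e"
    and large: "\<And>c. c \<in> topspace (join_power T (4 * N)) \<Longrightarrow> \<exists>l<N. 2 * e \<le> norm (u l (F c))"
    and p: "p \<ge> 2" and a: "coprime a p" and h: "h \<in> carrier G" "h [^] p \<in> W"
    and rot: "\<And>k l c. k < p \<Longrightarrow> l < N \<Longrightarrow> c \<in> topspace (join_power T (4 * N)) \<Longrightarrow>
        norm (u l (F (join_map (\<lambda>x. x \<otimes> h [^] k) c)) - cis (2 * pi * (a * k) / p) * u l (F c)) \<le> e"
  shows False
proof -
  define T' where "T' = discrete_topology {..<p}"
  have T': "compact_space T'" "Hausdorff_space T'" "topspace T' = {..<p}"
    by (auto simp: T'_def compact_space_discrete_topology Hausdorff_space_discrete_topology)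
  have "a \<noteq> 0" using a p by (intro notI) simp
  \<comment> \<open>A shift by an inverse \<open>b\<close> of \<open>a\<close> modulo
    \<open>p\<close> multiplies the character by exactly \<open>cis (2 * pi / p)\<close>, the
    rotation that \<open>cyclic_borsuk_ulam\<close> asks for.\<close>
  obtain b d where b: "a * b = p * d + 1"
    using bezout_nat[OF \<open>a \<noteq> 0\<close>, of p] unfolding coprime_imp_gcd_eq_1[OF a] by blast
  define sh where "sh k = (\<lambda>j. (j + k) mod p)" for k :: nat
  define \<iota> where "\<iota> = join_map (\<lambda>k::nat. h [^] k)"
  let ?E' = "join_power T' (4 * N)" and ?E = "join_power T (4 * N)"
  have \<iota>: "continuous_map ?E' ?E \<iota>"
    unfolding \<iota>_def
    by (rule continuous_map_join_map[OF compact Hausdorff]) (use h topspace_eq in \<open>simp add: T'_def\<close>)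
  have shc: "continuous_map ?E' ?E' (join_map (sh k))" for k
    by (rule continuous_map_join_map[OF T'(1,2)]) (use p in \<open>simp add: T'_def sh_def\<close>)
  have sh_in: "join_map (sh k) z \<in> topspace ?E'" if "z \<in> topspace ?E'" for k z
    using shc that by (auto simp: continuous_map_def)
  define g where "g l z k = u l (F (\<iota> (join_map (sh k) z)))" for l z k
  have g_shift: "g l (join_map (sh b) z) k = g l z (k + b)" for l z k
    by (simp add: g_def join_map_compose sh_def mod_simps add_ac)
  have g_period: "g l z (k + p) = g l z k" for l z k
    by (simp add: g_def sh_def flip: add.assoc)
  \<comment> \<open>The Fourier coefficient of \<open>k \<mapsto> g l z k\<close> at the character
    \<open>k \<mapsto> cis (2 * pi * (a * k) / p)\<close> of Z/p.\<close>
  define w where "w l z = (\<Sum>k<p. cis (- (2 * pi * (a * k) / p)) * g l z k)" for l z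
  have w_cont: "continuous_map ?E' euclidean (w l)" if "l < N" for l
  proof -
    have "continuous_map ?E' euclidean (\<lambda>z. g l z k)" for k
      unfolding g_def
      by (rule continuous_map_compose_app[OF _ u[OF that]], rule continuous_map_compose_app[OF _ F],
          rule continuous_map_compose_app[OF shc \<iota>])
    then show ?thesis
      unfolding w_def by (intro continuous_map_sum continuous_map_mult_euclidean) auto
  qed
  have w_equi: "w l (join_map (sh b) z) = cis (2 * pi / p) * w l z" for l z
  proof -
    let ?e = "\<lambda>k. cis (- (2 * pi * (a * k) / p)) * g l z k"
    have per: "?e (k + p) = ?e k" for k
    proof -
      have "cnj (cis (2 * pi * (a * (k + p)) / p)) = cnj (cis (2 * pi * (a * k) / p))"
        using cis_periodic[of p a k] p by simp
      then show ?thesis unfolding cis_cnj by (simp only: g_period)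
    qed
    have one: "cis (2 * pi * (a * b) / p) = cis (2 * pi / p)"
    proof -
      have "2 * pi * (a * b) / p = 2 * pi / p + 2 * pi * d"
        using p unfolding b by (simp add: field_simps)
      then show ?thesis using cis_add_2pi_int[of "real d" "2 * pi / p"] by simp
    qed
    have "cis (- (2 * pi * (a * k) / p)) = cis (2 * pi / p) * cis (- (2 * pi * (a * (k + b)) / p))" for k
      unfolding one[symmetric] cis_mult using p by (simp add: field_simps)
    then have "w l (join_map (sh b) z) = cis (2 * pi / p) * (\<Sum>k<p. ?e (k + b))"
      unfolding w_def g_shift sum_distrib_left by (simp add: mult.assoc)
    then show ?thesis unfolding sum_periodic_shift[of ?e, OF per] w_def .
  qed
  have sh_pow: "(sh b ^^ i) x = (x + i * b) mod p" if "x < p" for i x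
    by (induction i) (use that in \<open>simp_all add: sh_def mod_simps add_ac\<close>)
  have "\<exists>z\<in>topspace ?E'. \<forall>l<N. w l z = 0"
  proof (rule cyclic_borsuk_ulam[OF T'(1,2) _ p])
    show "topspace T' \<noteq> {}" using p by (auto simp: T'(3) lessThan_empty_iff)
    show "continuous_map T' T' (sh b)" using p by (simp add: T'_def sh_def)
    show "(sh b ^^ p) x = x" if "x \<in> topspace T'" for x
      using that sh_pow[of x p] by (simp add: T'(3))
  qed (use w_cont w_equi in auto)
  then obtain z where z: "z \<in> topspace ?E'" "\<And>l. l < N \<Longrightarrow> w l z = 0" by blast
  define c where "c = \<iota> z"
  have c: "c \<in> topspace ?E" using \<iota> z(1) by (auto simp: c_def continuous_map_def)
  obtain l where l: "l < N" "2 * e \<le> norm (u l (F c))" using large[OF c] by blast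
  have close: "norm (cis (- (2 * pi * (a * k) / p)) * g l z k - u l (F c)) < 2 * e" if k: "k < p" for k
  proof -
    let ?c' = "\<iota> (join_map (sh k) z)"
    \<comment> \<open>The slots in which adding \<open>k\<close> to the exponent reaches
      \<open>p\<close>, so that reduction modulo \<open>p\<close> loses one factor
      \<open>h [^] p\<close>.\<close>
    define S where "S = {i. i \<le> 4 * N \<and> (\<exists>j t. z i = Some (j, t) \<and> p \<le> j + k)}"
    have c': "?c' \<in> topspace ?E" using \<iota> sh_in[OF z(1)] by (auto simp: continuous_map_def)
    have slot_eq: "slot_act G S ?c' (h [^] p) = join_map (\<lambda>x. x \<otimes> h [^] k) c"
    proof
      fix i
      show "slot_act G S ?c' (h [^] p) i = join_map (\<lambda>x. x \<otimes> h [^] k) c i"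
      proof (cases "z i")
        case None
        then show ?thesis by (simp add: slot_act_def join_map_def \<iota>_def c_def)
      next
        case (Some q)
        obtain j t where q: "z i = Some (j, t)" using Some by (cases q) auto
        have ji: "i \<le> 4 * N" "j < p" using join_power_in(1,3)[OF z(1) q] by (simp_all add: T'(3))
        have "h [^] ((j + k) mod p) \<otimes> h [^] p = h [^] j \<otimes> h [^] k" if "p \<le> j + k"
        proof -
          have "(j + k) mod p = j + k - p" using that ji(2) k by (simp add: mod_if)
          then show ?thesis using that h(1) by (simp add: nat_pow_mult)
        qed
        moreover have "h [^] ((j + k) mod p) = h [^] j \<otimes> h [^] k" if "\<not> p \<le> j + k"
          using that h(1) by (simp add: nat_pow_mult)
        ultimately show ?thesis
          using q ji(1) by (auto simp: slot_act_def join_map_def \<iota>_def c_def S_def sh_def)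
      qed
    qed
    let ?U = "u l (F (join_map (\<lambda>x. x \<otimes> h [^] k) c))" and ?\<zeta> = "cis (2 * pi * (a * k) / p) * u l (F c)"
    have "norm (u l (F (slot_act G S ?c' (h [^] p))) - u l (F ?c')) < e"
      by (rule W[OF _ l(1) c' h(2)]) (auto simp: S_def)
    then have "norm (?U - g l z k) < e" unfolding slot_eq g_def .
    moreover have "norm (?U - ?\<zeta>) \<le> e" by (rule rot[OF k l(1) c])
    moreover have "norm (g l z k - ?\<zeta>) \<le> norm (?U - ?\<zeta>) + norm (?U - g l z k)"
      using norm_triangle_ineq4[of "?U - ?\<zeta>" "?U - g l z k"] by simp
    ultimately have "norm (g l z k - ?\<zeta>) < 2 * e" by linarith
    moreover have "cis (- x) * y - v = cis (- x) * (y - cis x * v)" for x y v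
    proof -
      have "cis (- x) * cis x = 1" by (simp add: cis_mult)
      then show ?thesis unfolding right_diff_distrib mult.assoc[symmetric] by simp
    qed
    ultimately show ?thesis by (simp only: norm_mult norm_cis mult_1)
  qed
  have "w l z - of_nat p * u l (F c) = (\<Sum>k<p. cis (- (2 * pi * (a * k) / p)) * g l z k - u l (F c))"
    by (simp add: w_def sum_subtractf)
  also have "norm \<dots> \<le> (\<Sum>k<p. norm (cis (- (2 * pi * (a * k) / p)) * g l z k - u l (F c)))"
    by (rule norm_sum)
  also have "\<dots> < (\<Sum>k<p. 2 * e)"
  proof (rule sum_strict_mono)
    show "{..<p} \<noteq> {}" using p by (simp add: lessThan_empty_iff)
  qed (use close in blast)+
  finally have "norm (of_nat p * u l (F c)) < p * (2 * e)" using z(2)[OF l(1)] by simp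
  then have "real p * norm (u l (F c)) < p * (2 * e)" by (simp only: norm_mult norm_of_nat)
  then have "norm (u l (F c)) < 2 * e" using p by (simp only: mult_less_cancel_left_pos)
  then show False using l(2) by linarith
qed

text \<open>\<open>W\<close> and \<open>e\<close> have to precede \<open>p\<close>, \<open>a\<close>
  and \<open>h\<close>, since \<open>no_irrational_eigenfunction\<close> finds these three only when
  it knows \<open>W\<close> and \<open>e\<close>.\<close>

lemma no_approximate_rotation:
  fixes \<phi> :: "'a \<Rightarrow> complex"
  assumes maps: "\<And>m. n \<le> m \<Longrightarrow> \<exists>F. continuous_map (join_power T m) (join_power T n) F \<and>
      equivariant_map G (topspace (join_power T m)) F"
    and \<phi>: "continuous_map T euclidean \<phi>" and x0: "x0 \<in> carrier G" "\<phi> x0 \<noteq> 0"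
  shows "\<exists>W e. openin T W \<and> \<one> \<in> W \<and> 0 < e \<and> (\<forall>(p::nat) (a::nat) h. 2 \<le> p \<longrightarrow> coprime a p \<longrightarrow> h \<in> carrier G \<longrightarrow> h [^] p \<in> W \<longrightarrow>
    (\<forall>k<p. \<forall>x\<in>carrier G. norm (\<phi> (x \<otimes> h [^] k) - cis (2 * pi * (a * k) / p) * \<phi> x) \<le> e) \<longrightarrow> False)"
proof -
  have opU: "openin T {x \<in> topspace T. \<phi> x \<in> - {0}}"
    by (rule openin_continuous_map_preimage[OF \<phi>]) (simp add: open_Compl)
  obtain Y where Y: "finite Y" "Y \<subseteq> carrier G" "\<And>x. x \<in> carrier G \<Longrightarrow> \<exists>y\<in>Y. y \<otimes> x \<in> {x \<in> topspace T. \<phi> x \<in> - {0}}"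
    by (rule finite_translates_cover[OF opU, of x0]) (use x0 topspace_eq in auto)
  obtain ys where ys: "set ys = Y" using finite_list[OF Y(1)] by blast
  define M where "M = length ys"
  define N where "N = (n + 1) * M"
  have "Y \<noteq> {}" using Y(3)[OF x0(1)] by blast
  then have M: "M > 0" using ys by (auto simp: M_def)
  then have N: "N > 0" "n \<le> 4 * N" unfolding N_def by (simp_all, cases M, simp_all)
  let ?X = "join_power T n" and ?E = "join_power T (4 * N)"
  \<comment> \<open>The index \<open>l\<close> encodes the slot \<open>l div M\<close> together with
    the translate number \<open>l mod M\<close>.\<close>
  define u where "u l = comb_val (\<lambda>x. \<phi> (ys ! (l mod M) \<otimes> x)) (l div M)" for l
  have ysG: "ys ! (l mod M) \<in> carrier G" for l
    using ys Y(2) M nth_mem[of "l mod M" ys] by (auto simp: M_def)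
  have u: "continuous_map ?X euclidean (u l)" for l
    unfolding u_def
    by (rule continuous_map_comb_val) (rule continuous_map_compose_app[OF continuous_left_mult[OF ysG] \<phi>])
  obtain F where F: "continuous_map ?E ?X F" "equivariant_map G (topspace ?E) F" using maps[OF N(2)] by blast
  have FX: "F c \<in> topspace ?X" if "c \<in> topspace ?E" for c using F(1) that by (auto simp: continuous_map_def)
  have nonzero: "\<exists>l<N. u l c \<noteq> 0" if c: "c \<in> topspace ?X" for c
  proof -
    obtain i g t where igt: "i \<le> n" "c i = Some (g, t)" "0 < t" "g \<in> topspace T" by (rule join_power_ex_slot[OF c])
    obtain y where y: "y \<in> set ys" "\<phi> (y \<otimes> g) \<noteq> 0" using Y(3)[of g] igt(4) topspace_eq ys by auto
    then obtain j where j: "j < M" "ys ! j = y" by (auto simp: in_set_conv_nth M_def)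
    have "i * M + j < N"
    proof -
      have "i * M + j < (i + 1) * M" using j(1) by simp
      also have "\<dots> \<le> N" unfolding N_def using igt(1) by (intro mult_right_mono) auto
      finally show ?thesis .
    qed
    moreover have "u (i * M + j) c \<noteq> 0"
      using j y(2) igt(2,3) by (simp add: u_def comb_val_def)
    ultimately show ?thesis by blast
  qed
  let ?s = "\<lambda>c. \<Sum>l<N. norm (u l c)"
  have s: "continuous_map ?X euclideanreal ?s"
    by (intro continuous_map_sum continuous_map_norm u) simp
  have "topspace ?X \<noteq> {}" using single_in_join_power[of \<one> T n] topspace_eq by auto
  then obtain c0 where c0: "c0 \<in> topspace ?X" "\<And>c. c \<in> topspace ?X \<Longrightarrow> ?s c0 \<le> ?s c"
    using compact_space_attains_inf[OF compact_space_join_power[OF compact] _ s] by blast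
  obtain l0 where "l0 < N" "u l0 c0 \<noteq> 0" using nonzero[OF c0(1)] by blast
  then have s0: "?s c0 > 0" by (intro sum_pos2[of _ l0]) auto
  \<comment> \<open>If the \<open>N\<close> norms add up to at least \<open>?s c0\<close>, one of
    them is at least their average, and \<open>?s c0 / N\<close> is \<open>2 * e\<close>.\<close>
  define e where "e = ?s c0 / (2 * N)"
  have e: "e > 0" using s0 N(1) by (simp add: e_def)
  have large: "\<exists>l<N. 2 * e \<le> norm (u l (F c))" if c: "c \<in> topspace ?E" for c
  proof (rule ccontr)
    assume "\<not> ?thesis"
    then have "?s (F c) < (\<Sum>l<N. 2 * e)"
      using N(1) by (intro sum_strict_mono) (auto simp: lessThan_empty_iff not_le)
    also have "\<dots> = ?s c0" using N(1) by (simp add: e_def)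
    finally show False using c0(2)[OF FX[OF c]] by linarith
  qed
  let ?good = "\<lambda>S l W. openin T W \<and> \<one> \<in> W \<and>
    (\<forall>c\<in>topspace ?E. \<forall>w\<in>W. norm (u l (F (slot_act G S c w)) - u l (F c)) < e)"
  define W where "W S l = (SOME W. ?good S l W)" for S l
  have good: "?good S l (W S l)" for S l
    unfolding W_def
    by (rule someI_ex) (rule slot_act_uniform[OF continuous_map_compose_app[OF F(1) u] e])
  have W: "openin T (W S l)" "\<one> \<in> W S l" for S l using good by blast+
  have W3: "norm (u l (F (slot_act G S c w)) - u l (F c)) < e" if "c \<in> topspace ?E" "w \<in> W S l" for S l c w
    using good that by blast
  \<comment> \<open>Which slots wrap around depends on the point and on \<open>k\<close>, so
    \<open>W'\<close> has to serve all of the finitely many sets \<open>S\<close>.\<close>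
  define W' where "W' = (\<Inter>(S, l)\<in>Pow {..4 * N} \<times> {..<N}. W S l)"
  have "openin T W'" unfolding W'_def
    using N(1) W(1) by (intro openin_INT2) (auto simp: lessThan_empty_iff)
  moreover have "\<one> \<in> W'" using W(2) by (auto simp: W'_def)
  moreover have False
    if p: "2 \<le> p" and a: "coprime a p" and h: "h \<in> carrier G" "h [^] p \<in> W'"
      and rot: "\<forall>k<p. \<forall>x\<in>carrier G. norm (\<phi> (x \<otimes> h [^] k) - cis (2 * pi * (a * k) / p) * \<phi> x) \<le> e"
    for p a :: nat and h
  proof (rule no_approximate_rotation_aux[where N = N and X = ?X and F = F and u = u and W = W' and e = e
        and p = p and a = a and h = h])
    show "continuous_map ?E ?X F" by (rule F(1))
    show "continuous_map ?X euclidean (u l)" for l by (rule u)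
    show "\<exists>l<N. 2 * e \<le> norm (u l (F c))" if "c \<in> topspace ?E" for c by (rule large[OF that])
    show "2 \<le> p" "coprime a p" "h \<in> carrier G" "h [^] p \<in> W'" by (rule p a h)+
    show "norm (u l (F (slot_act G S c w)) - u l (F c)) < e"
      if "S \<subseteq> {..4 * N}" "l < N" "c \<in> topspace ?E" "w \<in> W'" for S l c w
      by (rule W3[OF that(3)]) (use that in \<open>auto simp: W'_def\<close>)
    fix k l c assume k: "k < p" "l < N" and c: "c \<in> topspace ?E"
    let ?z = "cis (2 * pi * (a * k) / p)"
    have hk: "h [^] k \<in> carrier G" using h by simp
    have "F (join_map (\<lambda>x. x \<otimes> h [^] k) c) = join_map (\<lambda>x. x \<otimes> h [^] k) (F c)"
      using F(2) c hk by (simp add: equivariant_map_def diag_action_eq_join_map)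
    moreover have "norm (u l (join_map (\<lambda>x. x \<otimes> h [^] k) d) - ?z * u l d) \<le> e" if d: "d \<in> topspace ?X" for d
    proof (cases "d (l div M)")
      case None
      then show ?thesis using e by (simp add: u_def comb_val_def join_map_def)
    next
      case (Some q)
      obtain g t where q: "d (l div M) = Some (g, t)" using Some by (cases q) auto
      have t: "g \<in> carrier G" "0 < t" "t \<le> 1" using join_power_in[OF d q] topspace_eq by auto
      let ?x = "ys ! (l mod M) \<otimes> g"
      have "u l (join_map (\<lambda>x. x \<otimes> h [^] k) d) - ?z * u l d = t *\<^sub>R (\<phi> (?x \<otimes> h [^] k) - ?z * \<phi> ?x)"
        using q t(1) ysG hk by (simp add: u_def comb_val_def join_map_def m_assoc algebra_simps)
      also have "norm \<dots> \<le> 1 * e"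
        unfolding norm_scaleR using rot k(1) ysG t by (intro mult_mono) auto
      finally show ?thesis by simp
    qed
    ultimately show "norm (u l (F (join_map (\<lambda>x. x \<otimes> h [^] k) c)) - ?z * u l (F c)) \<le> e"
      using FX[OF c] by simp
  qed
  ultimately show ?thesis using e by blast
qed

end

section \<open>Torsion elements, and eigenvalues of translations\<close>

lemma unit_powers_dense:
  fixes \<mu> :: complex
  assumes norm: "norm \<mu> = 1" and irr: "\<And>k::nat. k > 0 \<Longrightarrow> \<mu> ^ k \<noteq> 1" and e: "e > 0"
  obtains s :: nat where "norm (\<mu> ^ s - cis (2 * pi * x)) < e"
proof -
  define \<theta> where "\<theta> = Arg2pi \<mu> / (2 * pi)"
  have \<mu>: "\<mu> = cis (2 * pi * \<theta>)"
    using Arg2pi_eq[of \<mu>] norm by (simp add: \<theta>_def cis_conv_exp)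
  have irr_\<theta>: "\<theta> \<notin> \<rat>"
  proof
    assume "\<theta> \<in> \<rat>"
    then obtain a b :: int where ab: "\<theta> = a / b" "b > 0" by (meson Rats_cases')
    have "real (nat b) * (2 * pi * \<theta>) = 2 * pi * a" using ab by simp
    then have "\<mu> ^ nat b = cis (2 * pi * a)"
      unfolding \<mu> Complex.DeMoivre by (simp only:)
    then show False using irr[of "nat b"] ab(2) by (simp add: cis_multiple_2pi)
  qed
  have "isCont (\<lambda>t. cis (2 * pi * t)) (frac x)" unfolding cis_conv_exp by (intro continuous_intros)
  then obtain d where d: "d > 0" "\<And>t. \<bar>t - frac x\<bar> < d \<Longrightarrow> norm (cis (2 * pi * t) - cis (2 * pi * frac x)) < e"
    using e unfolding continuous_at_eps_delta dist_norm by (metis real_norm_def)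
  have fr: "cis (2 * pi * frac t) = cis (2 * pi * t)" for t
    using cis_add_2pi_int[of "of_int \<lfloor>t\<rfloor>" "2 * pi * frac t"] by (simp add: frac_def algebra_simps)
  obtain k where "\<bar>frac (real k * \<theta>) - frac x\<bar> < d"
    using Kronecker_approx_1_explicit[OF irr_\<theta>, of "frac x" d] d(1) frac_ge_0 frac_lt_1[of x] by (metis less_imp_le)
  then have "norm (cis (2 * pi * (real k * \<theta>)) - cis (2 * pi * x)) < e"
    using d(2)[of "frac (real k * \<theta>)"] by (simp add: fr)
  moreover have "\<mu> ^ k = cis (2 * pi * (real k * \<theta>))"
    unfolding \<mu> Complex.DeMoivre by (simp add: mult_ac)
  ultimately have "norm (\<mu> ^ k - cis (2 * pi * x)) < e" by (simp only:)
  then show thesis by (rule that)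
qed

context compact_topological_group
begin

lemma completely_regular: "completely_regular_space T"
  using compact Hausdorff compact_Hausdorff_or_regular_imp_normal_space normal_imp_completely_regular_space by blast

text \<open>Some power \<open>k\<close> of \<open>h\<close> has prime order \<open>p\<close>. A bump
  function at the identity that vanishes at the other powers of \<open>k\<close> is projected to a
  character of the group generated by \<open>k\<close>. The result rotates exactly under
  \<open>k\<close> and is nonzero at the identity, while \<open>k [^] p = \<one>\<close> lies in
  every \<open>W\<close>.\<close>

lemma no_torsion_element:
  assumes maps: "\<And>m. n \<le> m \<Longrightarrow> \<exists>F. continuous_map (join_power T m) (join_power T n) F \<and>
      equivariant_map G (topspace (join_power T m)) F"
    and h: "h \<in> carrier G" "h \<noteq> \<one>" and q: "q > 0" "h [^] (q::nat) = \<one>"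
  shows False
proof -
  have "\<exists>p k. prime p \<and> k \<in> carrier G \<and> k \<noteq> \<one> \<and> k [^] (p::nat) = \<one>"
    using h q
  proof (induction q arbitrary: h rule: less_induct)
    case (less q)
    have "q \<noteq> 1" using less.prems by auto
    then obtain p where p: "prime p" "p dvd q" using prime_factor_nat by blast
    then obtain r where r: "q = p * r" by (elim dvdE)
    show ?case
    proof (cases "h [^] p = \<one>")
      case True then show ?thesis using p(1) less.prems by blast
    next
      case False
      have "(h [^] p) [^] r = \<one>" using less.prems r by (simp add: nat_pow_pow)
      moreover have "r < q" "0 < r" using r less.prems(3) prime_gt_1_nat[OF p(1)] by auto
      ultimately show ?thesis using less.IH[of r "h [^] p"] False less.prems(1) by auto
    qed
  qed
  then obtain p k where p: "prime (p::nat)" and k: "k \<in> carrier G" "k \<noteq> \<one>" "k [^] p = \<one>" by blast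
  have p2: "2 \<le> p" using prime_ge_2_nat[OF p] .
  have nontriv: "k [^] j \<noteq> \<one>" if j: "0 < j" "j < p" for j :: nat
  proof
    assume kj: "k [^] j = \<one>"
    have "coprime j p" using prime_imp_coprime[OF p, of j] nat_dvd_not_less[of j p] j by (auto simp: coprime_commute)
    then obtain b d where b: "j * b = p * d + 1"
      using bezout_nat[of j p] j(1) by (auto simp: coprime_imp_gcd_eq_1)
    have "k = k [^] (p * d + 1)" using k by (simp add: nat_pow_mult[symmetric] nat_pow_pow[symmetric])
    also have "\<dots> = \<one>" unfolding b[symmetric] using kj k by (simp add: nat_pow_pow[symmetric])
    finally show False using k(2) by simp
  qed
  define Q where "Q = (\<lambda>j::nat. k [^] j) ` {0<..<p}"
  have "closedin T Q"
    using k(1) Hausdorff unfolding Q_def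
    by (intro closedin_Hausdorff_finite) (auto simp: topspace_eq)
  then obtain f where f: "continuous_map T (top_of_set {0..1::real}) f" "f \<one> = 0" "f ` Q \<subseteq> {1}"
    using completely_regular nontriv unfolding completely_regular_space_def Q_def topspace_eq
    by (metis (no_types, lifting) DiffI greaterThanLessThan_iff imageE one_closed)
  define f' where "f' x = complex_of_real (1 - f x)" for x
  have f'c: "continuous_map T euclidean f'"
    unfolding f'_def
    by (rule continuous_map_compose_app[where Y = euclideanreal])
      (auto intro!: continuous_intros continuous_map_into_fulltopology[OF f(1)])
  define \<phi> where "\<phi> x = (\<Sum>j<p. cis (- (2 * pi * (1 * j) / p)) * f' (x \<otimes> k [^] (j::nat)))" for x
  have \<phi>c: "continuous_map T euclidean \<phi>"
    unfolding \<phi>_def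
    by (intro continuous_map_sum continuous_map_mult_euclidean continuous_map_compose_app[OF continuous_right_mult f'c])
       (use k in auto)
  have "f (k [^] j) = 1" if "0 < j" "j < p" for j
  proof -
    have "f (k [^] j) \<in> f ` Q" using that by (auto simp: Q_def)
    then show ?thesis using f(3) by blast
  qed
  then have "f' (k [^] j) = (if j = 0 then 1 else 0)" if "j < p" for j
    using that f(2) by (auto simp: f'_def)
  then have "\<phi> \<one> = (\<Sum>j<p. if j = 0 then 1 else 0)"
    unfolding \<phi>_def using k(1) by (intro sum.cong) auto
  then have \<phi>1: "\<phi> \<one> \<noteq> 0" using p2 by simp
  have rot: "\<phi> (x \<otimes> k [^] i) = cis (2 * pi * (1 * i) / p) * \<phi> x" if x: "x \<in> carrier G" for x and i :: nat
  proof -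
    let ?e = "\<lambda>j::nat. cis (- (2 * pi * (1 * j) / p)) * f' (x \<otimes> k [^] (j::nat))"
    have per: "?e (j + p) = ?e j" for j
    proof -
      have "cnj (cis (2 * pi * (1 * (j + p)) / p)) = cnj (cis (2 * pi * (1 * j) / p))"
        using cis_periodic[of p 1 j] p2 by simp
      moreover have "k [^] (j + p) = k [^] j" using k by (simp add: nat_pow_mult[symmetric])
      ultimately show ?thesis unfolding cis_cnj by (simp only: of_nat_mult of_nat_add of_nat_1)
    qed
    have "cis (- (2 * pi * (1 * j) / p)) * f' ((x \<otimes> k [^] i) \<otimes> k [^] j) = cis (2 * pi * (1 * i) / p) * ?e (j + i)" for j :: nat
    proof -
      have "cis (- (2 * pi * (1 * j) / p)) = cis (2 * pi * (1 * i) / p) * cis (- (2 * pi * (1 * (j + i)) / p))"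
        unfolding cis_mult using p2 by (simp add: field_simps)
      moreover have "(x \<otimes> k [^] i) \<otimes> k [^] j = x \<otimes> k [^] (j + i)"
        using x k(1) by (simp add: m_assoc nat_pow_mult add.commute)
      ultimately show ?thesis by (simp only: mult.assoc)
    qed
    then have "\<phi> (x \<otimes> k [^] i) = cis (2 * pi * (1 * i) / p) * (\<Sum>j<p. ?e (j + i))"
      unfolding \<phi>_def sum_distrib_left by (rule sum.cong[OF refl])
    then show ?thesis unfolding sum_periodic_shift[of ?e, OF per] \<phi>_def .
  qed
  obtain W e where W: "openin T W" "\<one> \<in> W" "0 < e"
    "\<And>(p::nat) (a::nat) h. 2 \<le> p \<Longrightarrow> coprime a p \<Longrightarrow> h \<in> carrier G \<Longrightarrow> h [^] p \<in> W \<Longrightarrow>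
    (\<forall>k<p. \<forall>x\<in>carrier G. norm (\<phi> (x \<otimes> h [^] k) - cis (2 * pi * (a * k) / p) * \<phi> x) \<le> e) \<Longrightarrow> False"
    using no_approximate_rotation[OF maps \<phi>c one_closed \<phi>1] by blast
  show False
    by (rule W(4)[OF p2, of 1 k]) (use k W(2,3) rot in simp_all)
qed

lemma open_translate_difference:
  assumes "openin T W" "\<one> \<in> W"
  obtains V where "openin T V" "\<one> \<in> V" "\<And>x y. x \<in> V \<Longrightarrow> y \<in> V \<Longrightarrow> inv x \<otimes> y \<in> W"
proof -
  let ?M = "{p \<in> topspace (prod_topology T T). inv (fst p) \<otimes> snd p \<in> W}"
  have "continuous_map (prod_topology T T) T (\<lambda>p. inv (fst p) \<otimes> snd p)"
    by (intro continuous_mult_of continuous_map_snd continuous_map_compose_app[OF continuous_map_fst continuous_inv])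
  then have "openin (prod_topology T T) ?M"
    by (rule openin_continuous_map_preimage[OF _ assms(1)])
  then have "\<forall>x y. (x, y) \<in> ?M \<longrightarrow> (\<exists>U V. openin T U \<and> openin T V \<and> x \<in> U \<and> y \<in> V \<and> U \<times> V \<subseteq> ?M)"
    by (simp only: openin_prod_topology_alt)
  moreover have "(\<one>, \<one>) \<in> ?M" using assms topspace_eq by simp
  ultimately have "\<exists>U V. openin T U \<and> openin T V \<and> \<one> \<in> U \<and> \<one> \<in> V \<and> U \<times> V \<subseteq> ?M" by iprover
  then obtain U V where UV: "openin T U" "openin T V" "\<one> \<in> U" "\<one> \<in> V" "U \<times> V \<subseteq> ?M"
    by (elim exE conjE)
  show thesis
    by (rule that[of "U \<inter> V"]) (use UV in auto)
qed

lemma no_irrational_eigenfunction: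
  fixes \<phi> :: "'a \<Rightarrow> complex"
  assumes maps: "\<And>m. n \<le> m \<Longrightarrow> \<exists>F. continuous_map (join_power T m) (join_power T n) F \<and>
      equivariant_map G (topspace (join_power T m)) F"
    and \<phi>: "continuous_map T euclidean \<phi>" and x0: "x0 \<in> carrier G" "\<phi> x0 \<noteq> 0"
    and g: "g \<in> carrier G" and eig: "\<And>x. x \<in> carrier G \<Longrightarrow> \<phi> (x \<otimes> g) = \<mu> * \<phi> x"
  shows "\<exists>k::nat. k > 0 \<and> \<mu> ^ k = 1"
proof (rule ccontr)
  assume "\<not> ?thesis"
  then have irr: "\<mu> ^ k \<noteq> 1" if "k > 0" for k :: nat using that by blast
  obtain xm where xm: "xm \<in> carrier G" "\<And>x. x \<in> carrier G \<Longrightarrow> norm (\<phi> x) \<le> norm (\<phi> xm)"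
    using compact_space_attains_sup[OF compact nonempty continuous_map_norm[OF \<phi>]] topspace_eq by metis
  define C where "C = norm (\<phi> xm)"
  have C: "C > 0" using xm(2)[OF x0(1)] x0(2) by (simp add: C_def) (metis zero_less_norm_iff less_le_trans)
  \<comment> \<open>At a maximum of \<open>norm (\<phi> x)\<close> neither the translate by
    \<open>g\<close> nor the one by its inverse can have a larger value.\<close>
  have norm1: "norm \<mu> = 1"
  proof (rule antisym)
    have "norm \<mu> * C \<le> C"
      using xm(2)[of "xm \<otimes> g"] eig[OF xm(1)] g xm(1) by (simp add: C_def norm_mult)
    then show "norm \<mu> \<le> 1" using C by simp
    have "xm = (xm \<otimes> inv g) \<otimes> g" using xm(1) g by (simp add: m_assoc)
    then have "C = norm \<mu> * norm (\<phi> (xm \<otimes> inv g))"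
      using eig[of "xm \<otimes> inv g"] xm(1) g by (metis C_def inv_closed m_closed norm_mult)
    also have "\<dots> \<le> norm \<mu> * C" using xm g by (simp add: C_def mult_left_mono)
    finally show "1 \<le> norm \<mu>" using C by simp
  qed
  obtain W e where W: "openin T W" "\<one> \<in> W" "0 < e"
    "\<And>(p::nat) (a::nat) h. 2 \<le> p \<Longrightarrow> coprime a p \<Longrightarrow> h \<in> carrier G \<Longrightarrow> h [^] p \<in> W \<Longrightarrow>
    (\<forall>k<p. \<forall>x\<in>carrier G. norm (\<phi> (x \<otimes> h [^] k) - cis (2 * pi * (a * k) / p) * \<phi> x) \<le> e) \<Longrightarrow> False"
    using no_approximate_rotation[OF maps \<phi> x0] by blast
  obtain V where V: "openin T V" "\<one> \<in> V" "\<And>x y. x \<in> V \<Longrightarrow> y \<in> V \<Longrightarrow> inv x \<otimes> y \<in> W"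
    by (rule open_translate_difference[OF W(1,2)]) blast
  obtain Y where Y: "finite Y" "Y \<subseteq> carrier G" "\<And>x. x \<in> carrier G \<Longrightarrow> \<exists>y\<in>Y. y \<otimes> x \<in> V"
    by (rule finite_translates_cover[OF V(1,2)]) blast
  \<comment> \<open>Pigeonhole: for \<open>b = g ^ s\<close> with \<open>\<mu> ^ s\<close> close to \<open>cis (2 * pi / p)\<close>, two of the powers
    \<open>b ^ (i * p)\<close> lie in a common small translate, and \<open>h\<close> is the quotient of the two \<open>b ^ i\<close>.\<close>
  obtain p where p: "prime p" "card Y < p" using bigger_prime by blast
  have p2: "2 \<le> p" using prime_ge_2_nat[OF p(1)] .
  \<comment> \<open>The error of \<open>\<mu> ^ s\<close> is amplified by the exponent
    \<open>a * k\<close>, which is at most \<open>p * p\<close>, and by a value of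
    \<open>\<phi>\<close>, which is at most \<open>C\<close>; the total must not exceed
    \<open>e\<close>.\<close>
  define \<delta> where "\<delta> = e / (real p * real p * C)"
  have \<delta>: "\<delta> > 0" using W(3) p2 C by (simp add: \<delta>_def)
  obtain s where s: "norm (\<mu> ^ s - cis (2 * pi * (1 / p))) < \<delta>"
    by (rule unit_powers_dense[OF norm1 irr \<delta>, where x = "1 / p"])
  define b where "b = g [^] s"
  have b: "b \<in> carrier G" using g by (simp add: b_def)
  have "\<forall>i. \<exists>y. y \<in> Y \<and> y \<otimes> b [^] (i * p) \<in> V" using Y(3) b by (meson nat_pow_closed)
  then obtain y where y: "\<And>i. y i \<in> Y" "\<And>i. y i \<otimes> b [^] (i * p) \<in> V" by metis
  have "\<not> inj_on y {..<p}"
  proof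
    assume "inj_on y {..<p}"
    then have "card {..<p} \<le> card Y" using y(1) Y(1) by (intro card_inj_on_le[of y]) auto
    then show False using p(2) by simp
  qed
  then obtain i j where ij: "i < j" "j < p" "y i = y j"
    unfolding inj_on_def by (metis lessThan_iff linorder_neqE_nat)
  define a where "a = j - i"
  define h where "h = b [^] a"
  have h: "h \<in> carrier G" using b by (simp add: h_def)
  have yG: "y i \<in> carrier G" for i using y(1) Y(2) by blast
  have "b [^] (j * p) = b [^] (i * p) \<otimes> h [^] p"
  proof -
    have "j * p = i * p + a * p" using ij(1) by (simp add: a_def algebra_simps)
    then show ?thesis using b by (simp add: h_def nat_pow_mult nat_pow_pow)
  qed
  then have "y j \<otimes> b [^] (j * p) = (y i \<otimes> b [^] (i * p)) \<otimes> h [^] p"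
    using ij(3) yG[of j] b h by (simp add: m_assoc)
  then have "inv (y i \<otimes> b [^] (i * p)) \<otimes> (y j \<otimes> b [^] (j * p)) = h [^] p"
    using yG[of i] b h by (simp add: inv_solve_left')
  then have hW: "h [^] p \<in> W" using V(3)[OF y(2)[of i] y(2)[of j]] by simp
  have a: "0 < a" "a < p" using ij by (simp_all add: a_def)
  \<comment> \<open>Here \<open>p\<close> has to be prime: the pigeonhole argument only yields some
    \<open>a\<close> strictly between 0 and \<open>p\<close>.\<close>
  have cop: "coprime a p" using prime_imp_coprime[OF p(1), of a] nat_dvd_not_less[of a p] a by (auto simp: coprime_commute)
  have pow: "\<phi> (x \<otimes> g [^] k) = \<mu> ^ k * \<phi> x" if x: "x \<in> carrier G" for x and k :: nat
  proof (induction k)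
    case (Suc k)
    have "\<phi> (x \<otimes> g [^] Suc k) = \<phi> ((x \<otimes> g [^] k) \<otimes> g)" using x g by (simp add: m_assoc)
    then show ?case using eig[of "x \<otimes> g [^] k"] x g Suc by simp
  qed (use x in simp)
  have close: "norm (\<phi> (x \<otimes> h [^] k) - cis (2 * pi * (a * k) / p) * \<phi> x) \<le> e"
    if k: "k < p" and x: "x \<in> carrier G" for k x
  proof -
    have hk: "h [^] k = g [^] (s * (a * k))" using g by (simp add: h_def b_def nat_pow_pow mult.assoc)
    have z: "cis (2 * pi * (a * k) / p) = cis (2 * pi * (1 / p)) ^ (a * k)"
      unfolding Complex.DeMoivre by (simp add: field_simps)
    have "norm ((\<mu> ^ s) ^ (a * k) - cis (2 * pi * (1 / p)) ^ (a * k)) \<le> (a * k) * norm (\<mu> ^ s - cis (2 * pi * (1 / p)))"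
      by (rule norm_power_diff) (simp_all add: norm_power norm1)
    also have "\<dots> \<le> (real p * real p) * \<delta>"
    proof (rule mult_mono)
      have "a * k \<le> p * p" using a(2) k by (intro mult_mono) simp_all
      then show "real (a * k) \<le> real p * real p" by (metis of_nat_mono of_nat_mult)
    qed (use s in simp_all)
    finally have "norm ((\<mu> ^ s) ^ (a * k) - cis (2 * pi * (1 / p)) ^ (a * k)) * norm (\<phi> x) \<le> (real p * real p) * \<delta> * C"
      using xm(2)[OF x] \<delta> by (intro mult_mono) (simp_all add: C_def)
    also have "\<dots> = e" using p2 C by (simp add: \<delta>_def)
    finally have *: "norm ((\<mu> ^ s) ^ (a * k) - cis (2 * pi * (1 / p)) ^ (a * k)) * norm (\<phi> x) \<le> e" .
    have "\<phi> (x \<otimes> h [^] k) - cis (2 * pi * (a * k) / p) * \<phi> x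
        = ((\<mu> ^ s) ^ (a * k) - cis (2 * pi * (1 / p)) ^ (a * k)) * \<phi> x"
      unfolding hk pow[OF x] z power_mult by (simp only: left_diff_distrib)
    then show ?thesis using * by (simp only: norm_mult)
  qed
  show False
    by (rule W(4)[OF p2 cop h hW]) (use close in blast)
qed

end

section \<open>The invariant mean\<close>

context compact_topological_group
begin

abbreviation cont :: "('a \<Rightarrow> real) \<Rightarrow> bool" where
  "cont f \<equiv> continuous_map T euclideanreal f"

lemma cont_left: "cont f \<Longrightarrow> a \<in> carrier G \<Longrightarrow> cont (\<lambda>x. f (a \<otimes> x))"
  by (rule continuous_map_compose_app[OF continuous_left_mult])

lemma cont_right: "cont f \<Longrightarrow> a \<in> carrier G \<Longrightarrow> cont (\<lambda>x. f (x \<otimes> a))"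
  by (rule continuous_map_compose_app[OF continuous_right_mult])

lemma cont_inv: "cont f \<Longrightarrow> cont (\<lambda>x. f (inv x))"
  by (rule continuous_map_compose_app[OF continuous_inv])

text \<open>Finite convex combinations of right translations, as operators on functions. Generating
  them by composition and mixing, instead of writing sums, lets their properties be proved by
  induction.\<close>

inductive ravg :: "(('a \<Rightarrow> real) \<Rightarrow> 'a \<Rightarrow> real) \<Rightarrow> bool" where
  translate: "a \<in> carrier G \<Longrightarrow> ravg (\<lambda>f x. f (x \<otimes> a))"
| comp: "ravg \<Phi> \<Longrightarrow> ravg \<Psi> \<Longrightarrow> ravg (\<lambda>f. \<Phi> (\<Psi> f))"
| mix: "ravg \<Phi> \<Longrightarrow> ravg \<Psi> \<Longrightarrow> 0 \<le> u \<Longrightarrow> u \<le> 1 \<Longrightarrow> ravg (\<lambda>f x. u * \<Phi> f x + (1 - u) * \<Psi> f x)"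

lemma ravg_add: "ravg \<Phi> \<Longrightarrow> \<Phi> (\<lambda>x. f x + g x) = (\<lambda>x. \<Phi> f x + \<Phi> g x)"
proof (induction arbitrary: f g rule: ravg.induct)
  case (comp \<Phi> \<Psi>) then show ?case by simp
next
  case (mix \<Phi> \<Psi> u)
  then show ?case by (simp add: fun_eq_iff algebra_simps)
qed simp

lemma ravg_cmul: "ravg \<Phi> \<Longrightarrow> \<Phi> (\<lambda>x. c * f x) = (\<lambda>x. c * \<Phi> f x)"
proof (induction arbitrary: f rule: ravg.induct)
  case (comp \<Phi> \<Psi>) then show ?case by simp
next
  case (mix \<Phi> \<Psi> u)
  then show ?case by (simp add: fun_eq_iff algebra_simps)
qed simp

lemma ravg_const: "ravg \<Phi> \<Longrightarrow> \<Phi> (\<lambda>x. c) = (\<lambda>x. c)"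
proof (induction rule: ravg.induct)
  case (mix \<Phi> \<Psi> u)
  then show ?case by (simp add: fun_eq_iff algebra_simps)
qed simp_all

lemma ravg_mono:
  "ravg \<Phi> \<Longrightarrow> (\<And>x. x \<in> carrier G \<Longrightarrow> f x \<le> g x) \<Longrightarrow> x \<in> carrier G \<Longrightarrow> \<Phi> f x \<le> \<Phi> g x"
proof (induction arbitrary: f g x rule: ravg.induct)
  case (mix \<Phi> \<Psi> u)
  then show ?case by (intro add_mono mult_left_mono) simp_all
qed simp_all

lemma ravg_cong:
  "ravg \<Phi> \<Longrightarrow> (\<And>x. x \<in> carrier G \<Longrightarrow> f x = g x) \<Longrightarrow> x \<in> carrier G \<Longrightarrow> \<Phi> f x = \<Phi> g x"
  using ravg_mono[of \<Phi> f g x] ravg_mono[of \<Phi> g f x] by force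

lemma ravg_close:
  assumes "ravg \<Phi>" "\<And>x. x \<in> carrier G \<Longrightarrow> \<bar>f x - g x\<bar> \<le> e" "x \<in> carrier G"
  shows "\<bar>\<Phi> f x - \<Phi> g x\<bar> \<le> e"
proof -
  have "\<Phi> f x \<le> \<Phi> (\<lambda>x. g x + e) x"
    by (rule ravg_mono[OF assms(1) _ assms(3)]) (use assms(2) in force)
  moreover have "\<Phi> g x \<le> \<Phi> (\<lambda>x. f x + e) x"
    by (rule ravg_mono[OF assms(1) _ assms(3)]) (use assms(2) in force)
  ultimately show ?thesis by (simp add: ravg_add[OF assms(1)] ravg_const[OF assms(1)])
qed

lemma ravg_close_const:
  assumes "ravg \<Phi>" "\<And>x. x \<in> carrier G \<Longrightarrow> \<bar>f x - c\<bar> \<le> e" "x \<in> carrier G"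
  shows "\<bar>\<Phi> f x - c\<bar> \<le> e"
  using ravg_close[OF assms(1), of f "\<lambda>_. c"] assms by (simp add: ravg_const)

lemma ravg_cont: "ravg \<Phi> \<Longrightarrow> cont f \<Longrightarrow> cont (\<Phi> f)"
proof (induction arbitrary: f rule: ravg.induct)
  case (translate a) then show ?case by (simp add: cont_right)
next
  case (mix \<Phi> \<Psi> u)
  then show ?case by (intro continuous_intros) auto
qed simp

lemma ravg_left:
  "ravg \<Phi> \<Longrightarrow> b \<in> carrier G \<Longrightarrow> x \<in> carrier G \<Longrightarrow> \<Phi> (\<lambda>x. f (b \<otimes> x)) x = \<Phi> f (b \<otimes> x)"
proof (induction arbitrary: f x rule: ravg.induct)
  case (comp \<Phi> \<Psi>)
  have "\<Phi> (\<Psi> (\<lambda>x. f (b \<otimes> x))) x = \<Phi> (\<lambda>x. \<Psi> f (b \<otimes> x)) x"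
    by (rule ravg_cong) (use comp in simp_all)
  then show ?case using comp by simp
qed (simp_all add: m_assoc)

lemma ravg_average:
  assumes "finite Y" "Y \<noteq> {}" "Y \<subseteq> carrier G"
  shows "ravg (\<lambda>f x. (\<Sum>y\<in>Y. f (x \<otimes> y)) / card Y)"
  using assms
proof (induction Y rule: finite_ne_induct)
  case (singleton y) then show ?case using translate[of y] by simp
next
  case (insert y Y)
  define u where "u = 1 / (1 + real (card Y))"
  have u: "0 \<le> u" "u \<le> 1" by (simp_all add: u_def field_simps)
  have "u * f (x \<otimes> y) + (1 - u) * ((\<Sum>y\<in>Y. f (x \<otimes> y)) / card Y) = (\<Sum>y\<in>insert y Y. f (x \<otimes> y)) / card (insert y Y)"
    for f and x
  proof -
    have "card Y > 0" using insert.hyps by (simp add: card_gt_0_iff)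
    then have "(1 - u) * ((\<Sum>y\<in>Y. f (x \<otimes> y)) / card Y) = u * (\<Sum>y\<in>Y. f (x \<otimes> y))"
      by (simp add: u_def divide_simps)
    then show ?thesis using insert.hyps by (simp add: u_def add_divide_distrib)
  qed
  then show ?case using mix[OF translate insert.IH u, of y] insert.prems by simp
qed

lemma finite_right_translates_cover:
  assumes U: "openin T U" "u \<in> U"
  obtains Y where "finite Y" "Y \<subseteq> carrier G" "Y \<noteq> {}" "\<And>x. x \<in> carrier G \<Longrightarrow> \<exists>y\<in>Y. x \<otimes> y \<in> U"
proof -
  have u: "u \<in> carrier G" using U openin_subset topspace_eq by blast
  have op: "openin T {x \<in> topspace T. inv x \<in> U}"
    by (rule openin_continuous_map_preimage[OF continuous_inv U(1)])
  obtain Y where Y: "finite Y" "Y \<subseteq> carrier G" "\<And>x. x \<in> carrier G \<Longrightarrow> \<exists>y\<in>Y. y \<otimes> x \<in> {x \<in> topspace T. inv x \<in> U}"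
    by (rule finite_translates_cover[OF op, of "inv u"]) (use u U topspace_eq in auto)
  have "\<exists>y\<in>(\<lambda>y. inv y) ` Y. x \<otimes> y \<in> U" if x: "x \<in> carrier G" for x
  proof -
    obtain y where y: "y \<in> Y" "inv (y \<otimes> inv x) \<in> U" using Y(3)[of "inv x"] x by auto
    then have "x \<otimes> inv y \<in> U" using x Y(2) by (auto simp: inv_mult_group)
    then show ?thesis using y(1) by blast
  qed
  then show thesis using that[of "(\<lambda>y. inv y) ` Y"] Y one_closed by blast
qed

lemma uniform_in_parameter:
  assumes H: "continuous_map (prod_topology X T) euclideanreal H" and x: "x \<in> topspace X" and e: "e > 0"
  obtains U where "openin X U" "x \<in> U" "\<And>x' y. x' \<in> U \<Longrightarrow> y \<in> carrier G \<Longrightarrow> \<bar>H (x', y) - H (x, y)\<bar> < e"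
proof -
  let ?W = "{p \<in> topspace (prod_topology X T). \<bar>H p - H (x, snd p)\<bar> < e}"
  have "continuous_map (prod_topology X T) (prod_topology X T) (\<lambda>p. (x, snd p))"
    using x by (intro continuous_map_pairedI continuous_map_snd) simp
  then have "continuous_map (prod_topology X T) euclideanreal (\<lambda>p. H (x, snd p))"
    by (rule continuous_map_compose_app[OF _ H])
  then have "continuous_map (prod_topology X T) euclideanreal (\<lambda>p. \<bar>H p - H (x, snd p)\<bar>)"
    by (intro continuous_intros H)
  from openin_continuous_map_preimage[OF this, of "{..<e}"]
  have op: "openin (prod_topology X T) ?W" by simp
  have "compactin T (topspace T)" using compact by (simp add: compact_space_def)
  moreover have "{x} \<times> topspace T \<subseteq> ?W" using x e by auto
  ultimately have "\<exists>U V. openin X U \<and> openin T V \<and> x \<in> U \<and> topspace T \<subseteq> V \<and> U \<times> V \<subseteq> ?W"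
    by (intro tube_lemma_right[OF op _ x])
  then obtain U V where UV: "openin X U" "x \<in> U" "topspace T \<subseteq> V" "U \<times> V \<subseteq> ?W"
    by (elim exE conjE)
  show thesis
  proof (rule that[OF UV(1,2)])
    fix x' y assume "x' \<in> U" "y \<in> carrier G"
    then have "(x', y) \<in> ?W" using UV(3,4) topspace_eq by blast
    then show "\<bar>H (x', y) - H (x, y)\<bar> < e" by simp
  qed
qed

lemma continuous_map_mult_pair:
  assumes "cont f"
  shows "continuous_map (prod_topology T T) euclideanreal (\<lambda>p. f (fst p \<otimes> snd p))"
  by (rule continuous_map_compose_app[OF continuous_mult_of[OF continuous_map_fst continuous_map_snd] assms])

text \<open>The constant \<open>c\<close> is the infimum of the upper bounds of averages of
  \<open>f\<close>. If an average with a bound close to \<open>c\<close> had a value far below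
  \<open>c\<close>, it would be small on a whole translate of a neighbourhood of the identity;
  averaging once more, over finitely many translations, would give a bound below
  \<open>c\<close>.\<close>

lemma ravg_nearly_constant:
  assumes f: "cont f"
  shows "\<exists>c. \<forall>e>0. \<exists>\<Phi>. ravg \<Phi> \<and> (\<forall>x\<in>carrier G. \<bar>\<Phi> f x - c\<bar> \<le> e)"
proof -
  define A where "A = {M. \<exists>\<Phi>. ravg \<Phi> \<and> (\<forall>x\<in>carrier G. \<Phi> f x \<le> M)}"
  define c where "c = Inf A"
  obtain xl where xl: "\<And>y. y \<in> carrier G \<Longrightarrow> f xl \<le> f y"
    using compact_space_attains_inf[OF compact nonempty f] topspace_eq by metis
  obtain xu where xu: "\<And>y. y \<in> carrier G \<Longrightarrow> f y \<le> f xu"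
    using compact_space_attains_sup[OF compact nonempty f] topspace_eq by metis
  have lower: "f xl \<le> M" if "M \<in> A" for M
  proof -
    obtain \<Phi> where \<Phi>: "ravg \<Phi>" "\<And>x. x \<in> carrier G \<Longrightarrow> \<Phi> f x \<le> M" using \<open>M \<in> A\<close> by (auto simp: A_def)
    have "\<Phi> (\<lambda>_. f xl) \<one> \<le> \<Phi> f \<one>" by (rule ravg_mono[OF \<Phi>(1) xl]) simp_all
    then show ?thesis using \<Phi>(2)[of \<one>] by (simp add: ravg_const[OF \<Phi>(1)])
  qed
  have "f xu \<in> A"
    unfolding A_def using translate[OF one_closed] xu by (intro CollectI exI[of _ "\<lambda>f x. f (x \<otimes> \<one>)"]) simp
  then have ne: "A \<noteq> {}" by blast
  have bdd: "bdd_below A" using lower by (auto simp: bdd_below_def)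
  have "\<exists>\<Phi>. ravg \<Phi> \<and> (\<forall>x\<in>carrier G. \<bar>\<Phi> f x - c\<bar> \<le> 2 * e)" if e: "e > 0" for e
  proof -
    \<comment> \<open>\<open>V\<close> is found from \<open>f\<close> alone: averages commute with
      left translations and do not enlarge uniform distances, so \<open>V\<close> controls every
      \<open>\<Phi> f\<close>. Hence \<open>Y\<close> and \<open>N\<close> are known before
      \<open>\<Phi>\<close> is chosen.\<close>
    obtain V where V: "openin T V" "\<one> \<in> V" "\<And>v x. v \<in> V \<Longrightarrow> x \<in> carrier G \<Longrightarrow> \<bar>f (v \<otimes> x) - f (\<one> \<otimes> x)\<bar> < e"
      using uniform_in_parameter[OF continuous_map_mult_pair[OF f] _ e, of \<one>] topspace_eq by auto
    have VG: "V \<subseteq> carrier G" using V(1) openin_subset topspace_eq by blast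
    obtain Y where Y: "finite Y" "Y \<subseteq> carrier G" "Y \<noteq> {}" "\<And>x. x \<in> carrier G \<Longrightarrow> \<exists>y\<in>Y. x \<otimes> y \<in> V"
      by (rule finite_right_translates_cover[OF V(1,2)]) blast
    define N where "N = real (card Y)"
    have N: "N \<ge> 1" using Y(1,3) by (simp add: N_def Suc_le_eq card_gt_0_iff)
    \<comment> \<open>Of the \<open>N\<close> values that are averaged, one lies below
      \<open>c - e\<close> and the others are at most \<open>c + \<eta>\<close>. With
      \<open>N * \<eta> = e\<close> their sum is at most \<open>N * c - \<eta>\<close>.\<close>
    define \<eta> where "\<eta> = e / N"
    have \<eta>: "\<eta> > 0" "\<eta> \<le> e" using e N by (simp_all add: \<eta>_def divide_le_eq)
    obtain M where M: "M \<in> A" "M < c + \<eta>"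
      using cInf_lessD[OF ne, of "c + \<eta>"] \<eta>(1) by (auto simp: c_def)
    then obtain \<Phi> where \<Phi>: "ravg \<Phi>" "\<And>x. x \<in> carrier G \<Longrightarrow> \<Phi> f x \<le> M" by (auto simp: A_def)
    have "c - 2 * e \<le> \<Phi> f x0" if x0: "x0 \<in> carrier G" for x0
    proof (rule ccontr)
      assume "\<not> ?thesis"
      then have small: "\<Phi> f x0 < c - 2 * e" by simp
      have near: "\<Phi> f (v \<otimes> x0) < c - e" if v: "v \<in> V" for v
      proof -
        have vG: "v \<in> carrier G" using v VG by blast
        have "\<bar>\<Phi> (\<lambda>x. f (v \<otimes> x)) x0 - \<Phi> f x0\<bar> \<le> e"
          by (rule ravg_close[OF \<Phi>(1) _ x0]) (use V(3)[OF v] in \<open>force intro: less_imp_le\<close>)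
        then show ?thesis using ravg_left[OF \<Phi>(1) vG x0, of f] small by linarith
      qed
      define Z where "Z = (\<lambda>y. y \<otimes> x0) ` Y"
      have Z: "finite Z" "Z \<noteq> {}" "Z \<subseteq> carrier G" using Y x0 by (auto simp: Z_def)
      have inj: "inj_on (\<lambda>y. y \<otimes> x0) Y" using Y(2) x0 by (auto simp: inj_on_def subset_iff)
      have cardZ: "real (card Z) = N" using card_image[OF inj] by (simp add: Z_def N_def)
      note \<Psi> = ravg_average[OF Z]
      have "(\<Sum>z\<in>Z. \<Phi> f (x \<otimes> z)) / card Z \<le> c - \<eta> / N" if x: "x \<in> carrier G" for x
      proof -
        obtain y where y: "y \<in> Y" "x \<otimes> y \<in> V" using Y(4)[OF x] by blast
        let ?z = "y \<otimes> x0"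
        have z: "?z \<in> Z" "\<Phi> f (x \<otimes> ?z) < c - e"
          using y near[OF y(2)] x x0 Y(2) by (auto simp: Z_def m_assoc[symmetric])
        have le: "\<Phi> f (x \<otimes> z) \<le> c + \<eta>" if "z \<in> Z" for z
          using \<Phi>(2)[of "x \<otimes> z"] M(2) Z(3) x that by (auto simp: subset_iff)
        have "(\<Sum>z\<in>Z. \<Phi> f (x \<otimes> z)) = \<Phi> f (x \<otimes> ?z) + (\<Sum>z\<in>Z - {?z}. \<Phi> f (x \<otimes> z))"
          by (rule sum.remove[OF Z(1) z(1)])
        also have "\<dots> \<le> (c - e) + (\<Sum>z\<in>Z - {?z}. c + \<eta>)"
          using z(2) le by (intro add_mono sum_mono) auto
        also have "(\<Sum>z\<in>Z - {?z}. c + \<eta>) = (N - 1) * (c + \<eta>)"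
          using z(1) Z(1) cardZ[symmetric] N by (simp add: card_Diff_singleton of_nat_diff)
        also have "(c - e) + (N - 1) * (c + \<eta>) = N * c - \<eta>"
          using N by (simp add: \<eta>_def field_simps)
        finally show ?thesis using N by (simp add: cardZ field_simps)
      qed
      then have "c - \<eta> / N \<in> A"
        unfolding A_def using comp[OF \<Psi> \<Phi>(1)] by blast
      then have "c \<le> c - \<eta> / N" unfolding c_def by (rule cInf_lower[OF _ bdd])
      then show False using \<eta>(1) N by (simp add: divide_le_0_iff)
    qed
    then have "\<bar>\<Phi> f x - c\<bar> \<le> 2 * e" if "x \<in> carrier G" for x
      using that \<Phi>(2)[OF that] M(2) \<eta>(2) e by (force simp: abs_le_iff)
    then show ?thesis using \<Phi>(1) by blast
  qed
  then have "\<exists>\<Phi>. ravg \<Phi> \<and> (\<forall>x\<in>carrier G. \<bar>\<Phi> f x - c\<bar> \<le> e)" if "e > 0" for e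
    using that by (metis half_gt_zero field_sum_of_halves mult_2)
  then show ?thesis by blast
qed

definition is_mean :: "('a \<Rightarrow> real) \<Rightarrow> real \<Rightarrow> bool" where
  "is_mean f c \<longleftrightarrow> (\<forall>e>0. \<exists>\<Phi>. ravg \<Phi> \<and> (\<forall>x\<in>carrier G. \<bar>\<Phi> f x - c\<bar> \<le> e))"

text \<open>Conjugation by inversion turns right averages into left averages.\<close>

definition lavg :: "(('a \<Rightarrow> real) \<Rightarrow> 'a \<Rightarrow> real) \<Rightarrow> ('a \<Rightarrow> real) \<Rightarrow> 'a \<Rightarrow> real" where
  "lavg \<Phi> f x = \<Phi> (\<lambda>y. f (inv y)) (inv x)"

lemma lavg_ravg_commute:
  assumes \<Phi>: "ravg \<Phi>" and \<Psi>: "ravg \<Psi>"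
  shows "x \<in> carrier G \<Longrightarrow> lavg \<Phi> (\<Psi> f) x = \<Psi> (lavg \<Phi> f) x"
  using \<Phi>
proof (induction arbitrary: f x rule: ravg.induct)
  case (translate a)
  have "\<Psi> (\<lambda>y. f (inv (inv y \<otimes> a))) x = \<Psi> (\<lambda>y. f (inv a \<otimes> y)) x"
    by (rule ravg_cong[OF \<Psi>]) (use translate in \<open>simp_all add: inv_mult_group\<close>)
  also have "\<dots> = \<Psi> f (inv a \<otimes> x)" by (rule ravg_left[OF \<Psi>]) (use translate in simp_all)
  finally show ?case using translate by (simp add: lavg_def inv_mult_group)
next
  case (comp \<Phi> \<Phi>')
  have eq: "\<Phi> (\<Phi>' (\<lambda>y. f (inv y))) (inv x) = lavg \<Phi> (lavg \<Phi>' f) x" if "x \<in> carrier G" for f x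
    unfolding lavg_def by (rule ravg_cong[OF comp.hyps(1)]) (use that in simp_all)
  have "lavg (\<lambda>f. \<Phi> (\<Phi>' f)) (\<Psi> f) x = lavg \<Phi> (lavg \<Phi>' (\<Psi> f)) x"
    using eq[OF comp.prems] by (simp add: lavg_def)
  also have "\<dots> = lavg \<Phi> (\<Psi> (lavg \<Phi>' f)) x"
    unfolding lavg_def[of \<Phi>]
    by (rule ravg_cong[OF comp.hyps(1)]) (use comp.IH(2) comp.prems in simp_all)
  also have "\<dots> = \<Psi> (lavg \<Phi> (lavg \<Phi>' f)) x" by (rule comp.IH(1)[OF comp.prems])
  also have "\<dots> = \<Psi> (lavg (\<lambda>f. \<Phi> (\<Phi>' f)) f) x"
    by (rule ravg_cong[OF \<Psi> _ comp.prems]) (simp add: eq[symmetric] lavg_def[of "\<lambda>f. \<Phi> (\<Phi>' f)"])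
  finally show ?case .
next
  case (mix \<Phi> \<Phi>' u)
  have "lavg (\<lambda>f x. u * \<Phi> f x + (1 - u) * \<Phi>' f x) h = (\<lambda>x. u * lavg \<Phi> h x + (1 - u) * lavg \<Phi>' h x)" for h
    by (simp add: lavg_def fun_eq_iff)
  then show ?case using mix by (simp add: ravg_add[OF \<Psi>] ravg_cmul[OF \<Psi>])
qed

text \<open>The double average \<open>lavg \<Phi> (\<Psi> f)\<close> is close to \<open>c\<close>
  because \<open>\<Psi> f\<close> is, and close to \<open>d\<close> because it equals
  \<open>\<Psi> (lavg \<Phi> f)\<close>.\<close>

lemma is_mean_inv:
  assumes "is_mean f c" "is_mean (\<lambda>x. f (inv x)) d"
  shows "c = d"
proof (rule ccontr)
  assume "c \<noteq> d"
  define e where "e = \<bar>c - d\<bar> / 3"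
  have e: "e > 0" using \<open>c \<noteq> d\<close> by (simp add: e_def)
  obtain \<Psi> where \<Psi>: "ravg \<Psi>" "\<And>x. x \<in> carrier G \<Longrightarrow> \<bar>\<Psi> f x - c\<bar> \<le> e"
    using assms(1) e unfolding is_mean_def by blast
  obtain \<Phi> where \<Phi>: "ravg \<Phi>" "\<And>x. x \<in> carrier G \<Longrightarrow> \<bar>\<Phi> (\<lambda>x. f (inv x)) x - d\<bar> \<le> e"
    using assms(2) e unfolding is_mean_def by blast
  have "\<bar>lavg \<Phi> (\<Psi> f) \<one> - c\<bar> \<le> e"
    unfolding lavg_def by (rule ravg_close_const[OF \<Phi>(1)]) (use \<Psi>(2) in simp_all)
  moreover have "\<bar>\<Psi> (lavg \<Phi> f) \<one> - d\<bar> \<le> e"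
    by (rule ravg_close_const[OF \<Psi>(1)]) (use \<Phi>(2) in \<open>simp_all add: lavg_def\<close>)
  ultimately have "\<bar>c - d\<bar> \<le> e + e"
    using lavg_ravg_commute[OF \<Phi>(1) \<Psi>(1) one_closed, of f] by linarith
  then show False using e by (simp add: e_def)
qed

text \<open>Left and right averages commute, which makes the constant approximated by right averages
  unique. On discontinuous functions \<^term>\<open>mean\<close> may be an arbitrary value.\<close>

definition mean :: "('a \<Rightarrow> real) \<Rightarrow> real" where
  "mean f = (THE c. is_mean f c)"

lemma is_mean_mean:
  assumes "cont f" shows "is_mean f (mean f)"
proof -
  obtain c where c: "is_mean f c" using ravg_nearly_constant[OF assms] unfolding is_mean_def by blast
  obtain d where d: "is_mean (\<lambda>x. f (inv x)) d"
    using ravg_nearly_constant[OF cont_inv[OF assms]] unfolding is_mean_def by blast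
  have "is_mean f a \<Longrightarrow> a = c" for a using is_mean_inv[OF c d] is_mean_inv[OF _ d, of a] by simp
  with c show ?thesis unfolding mean_def by (rule theI)
qed

lemma mean_eqI:
  assumes "cont f" "is_mean f c" shows "mean f = c"
proof -
  obtain d where d: "is_mean (\<lambda>x. f (inv x)) d"
    using ravg_nearly_constant[OF cont_inv[OF assms(1)]] unfolding is_mean_def by blast
  show ?thesis using is_mean_inv[OF is_mean_mean[OF assms(1)] d] is_mean_inv[OF assms(2) d] by simp
qed

lemma mean_ravg:
  assumes "ravg \<Phi>" "cont f" shows "mean (\<Phi> f) = mean f"
proof (rule sym, rule mean_eqI[OF assms(2)])
  show "is_mean f (mean (\<Phi> f))"
    using is_mean_mean[OF ravg_cont[OF assms]] comp[OF _ assms(1)] unfolding is_mean_def by metis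
qed

lemma mean_right: "cont f \<Longrightarrow> a \<in> carrier G \<Longrightarrow> mean (\<lambda>x. f (x \<otimes> a)) = mean f"
  using mean_ravg[OF translate] by simp

lemma mean_left:
  assumes "cont f" "a \<in> carrier G" shows "mean (\<lambda>x. f (a \<otimes> x)) = mean f"
proof (rule mean_eqI[OF cont_left[OF assms]])
  have "\<exists>\<Phi>. ravg \<Phi> \<and> (\<forall>x\<in>carrier G. \<bar>\<Phi> (\<lambda>x. f (a \<otimes> x)) x - mean f\<bar> \<le> e)" if "e > 0" for e
  proof -
    obtain \<Phi> where \<Phi>: "ravg \<Phi>" "\<And>x. x \<in> carrier G \<Longrightarrow> \<bar>\<Phi> f x - mean f\<bar> \<le> e"
      using is_mean_mean[OF assms(1)] \<open>e > 0\<close> unfolding is_mean_def by blast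
    then show ?thesis using ravg_left[OF \<Phi>(1) assms(2)] assms(2) by (intro exI[of _ \<Phi>]) simp
  qed
  then show "is_mean (\<lambda>x. f (a \<otimes> x)) (mean f)" by (simp add: is_mean_def)
qed

lemma mean_cong:
  assumes "\<And>x. x \<in> carrier G \<Longrightarrow> f x = g x" shows "mean f = mean g"
proof -
  have "is_mean f = is_mean g"
    unfolding is_mean_def using ravg_cong[of _ f g] assms by (auto simp: fun_eq_iff) (metis ravg_cong)+
  then show ?thesis by (simp add: mean_def)
qed

lemma mean_const [simp]: "mean (\<lambda>_. c) = c"
  by (rule mean_eqI) (auto simp: is_mean_def ravg_const intro!: exI[of _ "\<lambda>f x. f (x \<otimes> \<one>)"] translate)

text \<open>A further average does not spoil functions that are already nearly constant, so the
  functions can be treated one after another. The additivity of the mean and the exchange of two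
  means rest on such a common \<open>\<Phi>\<close>.\<close>

lemma mean_simultaneous:
  assumes "finite F" "\<And>f. f \<in> F \<Longrightarrow> cont f" "e > 0"
  shows "\<exists>\<Phi>. ravg \<Phi> \<and> (\<forall>f\<in>F. \<forall>x\<in>carrier G. \<bar>\<Phi> f x - mean f\<bar> \<le> e)"
  using assms(1,2)
proof (induction F rule: finite_induct)
  case empty then show ?case using translate[OF one_closed] by blast
next
  case (insert f F)
  then obtain \<Phi> where \<Phi>: "ravg \<Phi>" "\<And>g x. g \<in> F \<Longrightarrow> x \<in> carrier G \<Longrightarrow> \<bar>\<Phi> g x - mean g\<bar> \<le> e" by blast
  have cf: "cont f" using insert.prems by blast
  obtain \<Psi> where \<Psi>: "ravg \<Psi>" "\<And>x. x \<in> carrier G \<Longrightarrow> \<bar>\<Psi> (\<Phi> f) x - mean (\<Phi> f)\<bar> \<le> e"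
    using is_mean_mean[OF ravg_cont[OF \<Phi>(1) cf]] assms(3) unfolding is_mean_def by blast
  have "\<bar>\<Psi> (\<Phi> g) x - mean g\<bar> \<le> e" if "g \<in> insert f F" "x \<in> carrier G" for g x
    using that \<Psi>(2) mean_ravg[OF \<Phi>(1) cf] ravg_close_const[OF \<Psi>(1) \<Phi>(2)] by auto
  then show ?case using comp[OF \<Psi>(1) \<Phi>(1)] by blast
qed

lemma mean_add:
  assumes "cont f" "cont g" shows "mean (\<lambda>x. f x + g x) = mean f + mean g"
proof (rule mean_eqI)
  show "cont (\<lambda>x. f x + g x)" by (intro continuous_intros assms)
  have "\<exists>\<Phi>. ravg \<Phi> \<and> (\<forall>x\<in>carrier G. \<bar>\<Phi> (\<lambda>x. f x + g x) x - (mean f + mean g)\<bar> \<le> e)" if e: "e > 0" for e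
  proof -
    obtain \<Phi> where \<Phi>: "ravg \<Phi>" "\<forall>h\<in>{f, g}. \<forall>x\<in>carrier G. \<bar>\<Phi> h x - mean h\<bar> \<le> e / 2"
      using mean_simultaneous[of "{f, g}" "e / 2"] assms e by auto
    have "\<bar>\<Phi> (\<lambda>x. f x + g x) x - (mean f + mean g)\<bar> \<le> e" if x: "x \<in> carrier G" for x
    proof -
      have "\<bar>\<Phi> f x - mean f\<bar> \<le> e / 2" "\<bar>\<Phi> g x - mean g\<bar> \<le> e / 2" using \<Phi>(2) x by auto
      then show ?thesis unfolding ravg_add[OF \<Phi>(1)] by linarith
    qed
    then show ?thesis using \<Phi>(1) by blast
  qed
  then show "is_mean (\<lambda>x. f x + g x) (mean f + mean g)" by (simp add: is_mean_def)
qed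

lemma mean_cmul:
  assumes "cont f" shows "mean (\<lambda>x. c * f x) = c * mean f"
proof (rule mean_eqI)
  show "cont (\<lambda>x. c * f x)" by (intro continuous_intros assms) simp
  have "\<exists>\<Phi>. ravg \<Phi> \<and> (\<forall>x\<in>carrier G. \<bar>\<Phi> (\<lambda>x. c * f x) x - c * mean f\<bar> \<le> e)" if e: "e > 0" for e
  proof -
    have "e / (1 + \<bar>c\<bar>) > 0" using e by simp
    then obtain \<Phi> where \<Phi>: "ravg \<Phi>" "\<And>x. x \<in> carrier G \<Longrightarrow> \<bar>\<Phi> f x - mean f\<bar> \<le> e / (1 + \<bar>c\<bar>)"
      using is_mean_mean[OF assms] unfolding is_mean_def by blast
    have "\<bar>\<Phi> (\<lambda>x. c * f x) x - c * mean f\<bar> \<le> e" if x: "x \<in> carrier G" for x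
    proof -
      have "\<bar>\<Phi> (\<lambda>x. c * f x) x - c * mean f\<bar> = \<bar>c\<bar> * \<bar>\<Phi> f x - mean f\<bar>"
        by (simp add: ravg_cmul[OF \<Phi>(1)] abs_mult right_diff_distrib[symmetric])
      also have "\<dots> \<le> (1 + \<bar>c\<bar>) * (e / (1 + \<bar>c\<bar>))" using \<Phi>(2)[OF x] by (intro mult_mono) auto
      also have "\<dots> = e" by (simp add: add_pos_nonneg less_imp_neq[symmetric])
      finally show ?thesis .
    qed
    then show ?thesis using \<Phi>(1) by blast
  qed
  then show "is_mean (\<lambda>x. c * f x) (c * mean f)" by (simp add: is_mean_def)
qed

lemma mean_diff:
  assumes "cont f" "cont g" shows "mean (\<lambda>x. f x - g x) = mean f - mean g"
  using mean_add[OF assms(1), of "\<lambda>x. - 1 * g x"] mean_cmul[OF assms(2), of "- 1"] assms(2) by simp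

lemma mean_nonneg:
  assumes f: "cont f" and nn: "\<And>x. x \<in> carrier G \<Longrightarrow> 0 \<le> f x" shows "0 \<le> mean f"
proof (rule ccontr)
  assume "\<not> ?thesis"
  then obtain \<Phi> where \<Phi>: "ravg \<Phi>" "\<And>x. x \<in> carrier G \<Longrightarrow> \<bar>\<Phi> f x - mean f\<bar> \<le> - mean f / 2"
    using is_mean_mean[OF f, unfolded is_mean_def, rule_format, of "- mean f / 2"] by auto
  have "0 \<le> \<Phi> f \<one>"
    using ravg_mono[OF \<Phi>(1), of "\<lambda>_. 0" f \<one>] nn by (simp add: ravg_const[OF \<Phi>(1)])
  then show False using \<Phi>(2)[of \<one>] \<open>\<not> 0 \<le> mean f\<close> by simp
qed

lemma mean_mono:
  assumes "cont f" "cont g" "\<And>x. x \<in> carrier G \<Longrightarrow> f x \<le> g x" shows "mean f \<le> mean g"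
  using mean_nonneg[of "\<lambda>x. g x - f x"] mean_diff[OF assms(2,1)] assms by (simp add: continuous_map_diff)

lemma mean_close:
  assumes "cont f" "cont g" "\<And>x. x \<in> carrier G \<Longrightarrow> \<bar>f x - g x\<bar> \<le> e" shows "\<bar>mean f - mean g\<bar> \<le> e"
proof -
  have "mean f \<le> mean (\<lambda>x. g x + e)"
    by (rule mean_mono) (use assms in \<open>force intro!: continuous_intros\<close>)+
  moreover have "mean g \<le> mean (\<lambda>x. f x + e)"
    by (rule mean_mono) (use assms in \<open>force intro!: continuous_intros\<close>)+
  ultimately show ?thesis using mean_add[OF assms(1), of "\<lambda>_. e"] mean_add[OF assms(2), of "\<lambda>_. e"] by simp
qed

text \<open>Finitely many right translates of the set where \<open>f\<close> exceeds half of
  \<open>f x0\<close> cover the group, so some average of \<open>f\<close> is bounded below by a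
  positive constant.\<close>

lemma mean_pos:
  assumes f: "cont f" and nn: "\<And>x. x \<in> carrier G \<Longrightarrow> 0 \<le> f x" and x0: "x0 \<in> carrier G" "f x0 > 0"
  shows "0 < mean f"
proof -
  define d where "d = f x0 / 2"
  have d: "d > 0" using x0(2) by (simp add: d_def)
  have op: "openin T {x \<in> topspace T. f x \<in> {d<..}}"
    by (rule openin_continuous_map_preimage[OF f]) simp
  obtain Y where Y: "finite Y" "Y \<subseteq> carrier G" "Y \<noteq> {}"
    "\<And>x. x \<in> carrier G \<Longrightarrow> \<exists>y\<in>Y. x \<otimes> y \<in> {x \<in> topspace T. f x \<in> {d<..}}"
    by (rule finite_right_translates_cover[OF op, of x0]) (use x0 topspace_eq in \<open>auto simp: d_def\<close>)
  note \<Psi> = ravg_average[OF Y(1,3,2)]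
  have "d / card Y \<le> (\<Sum>y\<in>Y. f (x \<otimes> y)) / card Y" if x: "x \<in> carrier G" for x
  proof -
    obtain y where y: "y \<in> Y" "d < f (x \<otimes> y)" using Y(4)[OF x] by auto
    have "f (x \<otimes> y) \<le> (\<Sum>y\<in>Y. f (x \<otimes> y))"
      using y(1) Y(1,2) nn x by (intro member_le_sum) auto
    then show ?thesis using y(2) by (intro divide_right_mono) auto
  qed
  then have "mean (\<lambda>_. d / card Y) \<le> mean (\<lambda>x. (\<Sum>y\<in>Y. f (x \<otimes> y)) / card Y)"
    using ravg_cont[OF \<Psi> f] by (intro mean_mono) simp_all
  moreover have "d / card Y > 0" using d Y(1,3) by (simp add: card_gt_0_iff)
  ultimately show ?thesis using mean_ravg[OF \<Psi> f] by simp
qed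

end

lemma continuous_map_real_epsilon:
  fixes f :: "'a \<Rightarrow> real"
  assumes "\<And>x e. x \<in> topspace X \<Longrightarrow> e > 0 \<Longrightarrow> \<exists>U. openin X U \<and> x \<in> U \<and> (\<forall>x'\<in>U. \<bar>f x' - f x\<bar> < e)"
  shows "continuous_map X euclideanreal f"
  unfolding continuous_map_def
proof (intro conjI allI impI)
  fix S :: "real set" assume S: "openin euclidean S"
  show "openin X {x \<in> topspace X. f x \<in> S}"
  proof (subst openin_subopen, intro ballI)
    fix x assume x: "x \<in> {x \<in> topspace X. f x \<in> S}"
    then obtain e where e: "e > 0" "\<And>t. \<bar>t - f x\<bar> < e \<Longrightarrow> t \<in> S"
      using S by (auto simp: open_dist dist_real_def)
    obtain U where U: "openin X U" "x \<in> U" "\<And>x'. x' \<in> U \<Longrightarrow> \<bar>f x' - f x\<bar> < e"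
      using assms[of x e] x e(1) by blast
    have "U \<subseteq> {x \<in> topspace X. f x \<in> S}"
      using U(3) e(2) openin_subset[OF U(1)] by blast
    then show "\<exists>U. openin X U \<and> x \<in> U \<and> U \<subseteq> {x \<in> topspace X. f x \<in> S}" using U(1,2) by blast
  qed
qed simp

context compact_topological_group
begin

lemma cont_slice:
  assumes "continuous_map (prod_topology X T) euclideanreal H" "x \<in> topspace X"
  shows "cont (\<lambda>y. H (x, y))"
  by (rule continuous_map_compose_app[OF continuous_map_pairedI assms(1)]) (use assms(2) in simp_all)

lemma cont_slice':
  assumes "continuous_map (prod_topology T X) euclideanreal H" "y \<in> topspace X"
  shows "cont (\<lambda>x. H (x, y))"
  by (rule continuous_map_compose_app[OF continuous_map_pairedI assms(1)]) (use assms(2) in simp_all)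

lemma continuous_mean:
  assumes H: "continuous_map (prod_topology X T) euclideanreal H"
  shows "continuous_map X euclideanreal (\<lambda>x. mean (\<lambda>y. H (x, y)))"
proof (rule continuous_map_real_epsilon)
  fix x and e :: real assume x: "x \<in> topspace X" and e: "e > 0"
  obtain U where U: "openin X U" "x \<in> U" "\<And>x' y. x' \<in> U \<Longrightarrow> y \<in> carrier G \<Longrightarrow> \<bar>H (x', y) - H (x, y)\<bar> < e / 2"
    by (rule uniform_in_parameter[OF H x, of "e / 2"]) (use e in auto)
  have "\<bar>mean (\<lambda>y. H (x', y)) - mean (\<lambda>y. H (x, y))\<bar> < e" if x': "x' \<in> U" for x'
  proof -
    have "x' \<in> topspace X" using x' openin_subset[OF U(1)] by blast
    then have "\<bar>mean (\<lambda>y. H (x', y)) - mean (\<lambda>y. H (x, y))\<bar> \<le> e / 2"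
      using U(3)[OF x'] x by (intro mean_close cont_slice[OF H]) (auto intro: less_imp_le)
    then show ?thesis using e by linarith
  qed
  then show "\<exists>U. openin X U \<and> x \<in> U \<and> (\<forall>x'\<in>U. \<bar>mean (\<lambda>y. H (x', y)) - mean (\<lambda>y. H (x, y))\<bar> < e)"
    using U(1,2) by blast
qed

lemma finite_parameter_net:
  assumes H: "continuous_map (prod_topology X T) euclideanreal H" and X: "compact_space X" and e: "e > 0"
  obtains D where "finite D" "D \<subseteq> topspace X"
    "\<And>x. x \<in> topspace X \<Longrightarrow> \<exists>d\<in>D. \<forall>y\<in>carrier G. \<bar>H (x, y) - H (d, y)\<bar> < e"
proof -
  have "\<exists>U. openin X U \<and> x \<in> U \<and> (\<forall>x'\<in>U. \<forall>y\<in>carrier G. \<bar>H (x', y) - H (x, y)\<bar> < e)" if "x \<in> topspace X" for x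
    using uniform_in_parameter[OF H that e] by metis
  then obtain U where U: "\<And>x. x \<in> topspace X \<Longrightarrow> openin X (U x) \<and> x \<in> U x \<and> (\<forall>x'\<in>U x. \<forall>y\<in>carrier G. \<bar>H (x', y) - H (x, y)\<bar> < e)"
    by metis
  have "topspace X \<subseteq> \<Union>(U ` topspace X)" using U by blast
  moreover have "compactin X (topspace X)" using X by (simp add: compact_space_def)
  ultimately obtain \<F> where F: "finite \<F>" "\<F> \<subseteq> U ` topspace X" "topspace X \<subseteq> \<Union>\<F>"
    using compactinD[of X "topspace X" "U ` topspace X"] U by blast
  then obtain D where D: "finite D" "D \<subseteq> topspace X" "\<F> = U ` D" by (metis finite_subset_image)
  show thesis
  proof (rule that[OF D(1,2)])
    fix x assume "x \<in> topspace X"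
    then obtain d where "d \<in> D" "x \<in> U d" using F(3) D(3) by blast
    then show "\<exists>d\<in>D. \<forall>y\<in>carrier G. \<bar>H (x, y) - H (d, y)\<bar> < e" using U D(2) by blast
  qed
qed

text \<open>An average in \<open>y\<close> is a finite combination of translations, so the linearity
  of the mean in \<open>x\<close> is enough for the exchange. Joint continuity is carried along
  because composition needs it.\<close>

lemma ravg_param:
  assumes "ravg \<Phi>" "continuous_map (prod_topology T T) euclideanreal H"
  shows "continuous_map (prod_topology T T) euclideanreal (\<lambda>p. \<Phi> (\<lambda>y. H (fst p, y)) (snd p)) \<and>
    (\<forall>y\<in>carrier G. mean (\<lambda>x. \<Phi> (\<lambda>y. H (x, y)) y) = \<Phi> (\<lambda>y. mean (\<lambda>x. H (x, y))) y)"
  using assms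
proof (induction arbitrary: H rule: ravg.induct)
  case (translate a)
  have "continuous_map (prod_topology T T) (prod_topology T T) (\<lambda>p. (fst p, snd p \<otimes> a))"
    by (intro continuous_map_pairedI continuous_map_fst continuous_map_compose_app[OF continuous_map_snd continuous_right_mult[OF translate(1)]])
  then show ?case using continuous_map_compose_app[OF _ translate(2)] by simp
next
  case (comp \<Phi> \<Psi>)
  define H' where "H' p = \<Psi> (\<lambda>y. H (fst p, y)) (snd p)" for p
  have H': "continuous_map (prod_topology T T) euclideanreal H'"
    "\<And>y. y \<in> carrier G \<Longrightarrow> mean (\<lambda>x. H' (x, y)) = \<Psi> (\<lambda>y. mean (\<lambda>x. H (x, y))) y"
    using comp.IH(2)[OF comp.prems] by (simp_all add: H'_def[abs_def])
  have eta: "(\<lambda>y. H' (x, y)) = \<Psi> (\<lambda>y. H (x, y))" for x by (simp add: H'_def)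
  have "\<Phi> (\<lambda>y. mean (\<lambda>x. H' (x, y))) y = \<Phi> (\<Psi> (\<lambda>y. mean (\<lambda>x. H (x, y)))) y" if "y \<in> carrier G" for y
    by (rule ravg_cong[OF comp.hyps(1) _ that]) (rule H'(2))
  then show ?case using comp.IH(1)[OF H'(1)] by (simp add: eta)
next
  case (mix \<Phi> \<Psi> u)
  note a = mix.IH(1)[OF mix.prems] and b = mix.IH(2)[OF mix.prems]
  let ?A = "\<lambda>p. \<Phi> (\<lambda>y. H (fst p, y)) (snd p)" and ?B = "\<lambda>p. \<Psi> (\<lambda>y. H (fst p, y)) (snd p)"
  have cA: "continuous_map (prod_topology T T) euclideanreal ?A"
    and cB: "continuous_map (prod_topology T T) euclideanreal ?B" using a b by blast+
  have "mean (\<lambda>x. u * \<Phi> (\<lambda>y. H (x, y)) y + (1 - u) * \<Psi> (\<lambda>y. H (x, y)) y) =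
      u * \<Phi> (\<lambda>y. mean (\<lambda>x. H (x, y))) y + (1 - u) * \<Psi> (\<lambda>y. mean (\<lambda>x. H (x, y))) y" if y: "y \<in> carrier G" for y
  proof -
    have cy: "cont (\<lambda>x. \<Phi> (\<lambda>y. H (x, y)) y)" "cont (\<lambda>x. \<Psi> (\<lambda>y. H (x, y)) y)"
      using cont_slice'[OF cA] cont_slice'[OF cB] y topspace_eq by simp_all
    then have "cont (\<lambda>x. u * \<Phi> (\<lambda>y. H (x, y)) y)" "cont (\<lambda>x. (1 - u) * \<Psi> (\<lambda>y. H (x, y)) y)"
      by (auto intro!: continuous_intros)
    from mean_add[OF this] show ?thesis using cy a b y by (simp add: mean_cmul)
  qed
  moreover have "continuous_map (prod_topology T T) euclideanreal (\<lambda>p. u * ?A p + (1 - u) * ?B p)"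
    by (intro continuous_intros cA cB) auto
  ultimately show ?case by simp
qed

text \<open>A form of Fubini's theorem. A finite net of slices yields one average
  \<open>\<Phi>\<close> in \<open>y\<close> that is nearly constant on all slices and on the
  marginal \<open>?k\<close>; and \<open>\<Phi>\<close> can be exchanged with the mean in
  \<open>x\<close> by \<open>ravg_param\<close>.\<close>

lemma mean_swap:
  assumes H: "continuous_map (prod_topology T T) euclideanreal H"
  shows "mean (\<lambda>x. mean (\<lambda>y. H (x, y))) = mean (\<lambda>y. mean (\<lambda>x. H (x, y)))"
proof -
  have "continuous_map (prod_topology T T) (prod_topology T T) (\<lambda>p. (snd p, fst p))"
    by (intro continuous_map_pairedI continuous_map_fst continuous_map_snd)
  then have H': "continuous_map (prod_topology T T) euclideanreal (\<lambda>p. H (snd p, fst p))"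
    by (rule continuous_map_compose_app[OF _ H])
  let ?k = "\<lambda>y. mean (\<lambda>x. H (x, y))" and ?l = "\<lambda>x. mean (\<lambda>y. H (x, y))"
  have k: "cont ?k" using continuous_mean[OF H'] by simp
  have l: "cont ?l" by (rule continuous_mean[OF H])
  have "\<bar>mean ?l - mean ?k\<bar> \<le> 4 * e" if e: "e > 0" for e
  proof -
    obtain D where D: "finite D" "D \<subseteq> topspace T"
      "\<And>x. x \<in> topspace T \<Longrightarrow> \<exists>d\<in>D. \<forall>y\<in>carrier G. \<bar>H (x, y) - H (d, y)\<bar> < e"
      by (rule finite_parameter_net[OF H compact e]) blast
    define F where "F = insert ?k ((\<lambda>d y. H (d, y)) ` D)"
    have "finite F" "\<And>f. f \<in> F \<Longrightarrow> cont f" using D k cont_slice[OF H] by (auto simp: F_def)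
    from mean_simultaneous[OF this e] obtain \<Phi> where \<Phi>: "ravg \<Phi>" "\<And>f x. f \<in> F \<Longrightarrow> x \<in> carrier G \<Longrightarrow> \<bar>\<Phi> f x - mean f\<bar> \<le> e"
      by blast
    have near: "\<bar>\<Phi> (\<lambda>y. H (x, y)) \<one> - ?l x\<bar> \<le> 3 * e" if x: "x \<in> carrier G" for x
    proof -
      obtain d where d: "d \<in> D" "\<And>y. y \<in> carrier G \<Longrightarrow> \<bar>H (x, y) - H (d, y)\<bar> \<le> e"
        using D(3)[of x] x topspace_eq by (force intro: less_imp_le)
      have "\<bar>\<Phi> (\<lambda>y. H (x, y)) \<one> - \<Phi> (\<lambda>y. H (d, y)) \<one>\<bar> \<le> e"
        by (rule ravg_close[OF \<Phi>(1) d(2)]) simp_all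
      moreover have "\<bar>\<Phi> (\<lambda>y. H (d, y)) \<one> - ?l d\<bar> \<le> e"
        by (rule \<Phi>(2)) (use d(1) in \<open>simp_all add: F_def\<close>)
      moreover have "\<bar>?l x - ?l d\<bar> \<le> e"
        by (rule mean_close[OF cont_slice[OF H] cont_slice[OF H] d(2)]) (use x d(1) D(2) topspace_eq in auto)
      ultimately show ?thesis by linarith
    qed
    note p = ravg_param[OF \<Phi>(1) H]
    have "cont (\<lambda>x. \<Phi> (\<lambda>y. H (x, y)) \<one>)"
      using cont_slice'[OF conjunct1[OF p], of \<one>] topspace_eq by simp
    then have "\<bar>mean (\<lambda>x. \<Phi> (\<lambda>y. H (x, y)) \<one>) - mean ?l\<bar> \<le> 3 * e"
      by (rule mean_close[OF _ l near])
    moreover have "mean (\<lambda>x. \<Phi> (\<lambda>y. H (x, y)) \<one>) = \<Phi> ?k \<one>" using p by simp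
    moreover have "\<bar>\<Phi> ?k \<one> - mean ?k\<bar> \<le> e" by (rule \<Phi>(2)) (simp_all add: F_def)
    ultimately show ?thesis by linarith
  qed
  from this[of "\<bar>mean ?l - mean ?k\<bar> / 8"] show ?thesis by fastforce
qed

section \<open>The inner product given by the mean\<close>

definition ip :: "('a \<Rightarrow> real) \<Rightarrow> ('a \<Rightarrow> real) \<Rightarrow> real" where
  "ip u v = mean (\<lambda>x. u x * v x)"

lemma ip_commute: "ip u v = ip v u"
  by (simp add: ip_def mult.commute)

lemma ip_cong:
  "(\<And>x. x \<in> carrier G \<Longrightarrow> u x = u' x) \<Longrightarrow> (\<And>x. x \<in> carrier G \<Longrightarrow> v x = v' x) \<Longrightarrow> ip u v = ip u' v'"
  unfolding ip_def by (rule mean_cong) simp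

lemma ip_add_left: "cont u \<Longrightarrow> cont v \<Longrightarrow> cont w \<Longrightarrow> ip (\<lambda>x. u x + v x) w = ip u w + ip v w"
  unfolding ip_def distrib_right by (rule mean_add) (auto intro: continuous_intros)

lemma ip_diff_left: "cont u \<Longrightarrow> cont v \<Longrightarrow> cont w \<Longrightarrow> ip (\<lambda>x. u x - v x) w = ip u w - ip v w"
  unfolding ip_def left_diff_distrib by (rule mean_diff) (auto intro: continuous_intros)

lemma ip_cmul_left: "cont u \<Longrightarrow> cont w \<Longrightarrow> ip (\<lambda>x. c * u x) w = c * ip u w"
  unfolding ip_def mult.assoc by (rule mean_cmul) (auto intro: continuous_intros)

lemma ip_diff_right: "cont u \<Longrightarrow> cont v \<Longrightarrow> cont w \<Longrightarrow> ip w (\<lambda>x. u x - v x) = ip w u - ip w v"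
  using ip_diff_left[of u v w] by (simp add: ip_commute)

lemma ip_cmul_right: "cont u \<Longrightarrow> cont w \<Longrightarrow> ip w (\<lambda>x. c * u x) = c * ip w u"
  using ip_cmul_left[of u w c] by (simp add: ip_commute)

lemma ip_sum_left:
  assumes "\<And>i. i \<in> I \<Longrightarrow> cont (u i)" "cont w"
  shows "ip (\<lambda>x. \<Sum>i\<in>I. c i * u i x) w = (\<Sum>i\<in>I. c i * ip (u i) w)"
  using assms(1)
proof (induction I rule: infinite_finite_induct)
  case (insert i I)
  have "ip (\<lambda>x. c i * u i x + (\<Sum>i\<in>I. c i * u i x)) w = ip (\<lambda>x. c i * u i x) w + ip (\<lambda>x. \<Sum>i\<in>I. c i * u i x) w"
    by (rule ip_add_left) (use insert.prems insert.hyps assms(2) in \<open>auto intro!: continuous_intros\<close>)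
  then show ?case using insert assms(2) by (simp add: ip_cmul_left)
qed (simp_all add: ip_def)

lemma ip_nonneg: "cont u \<Longrightarrow> 0 \<le> ip u u"
  unfolding ip_def by (rule mean_nonneg) (auto intro: continuous_intros)

lemma ip_eq_0:
  assumes "cont u" "ip u u = 0" "x \<in> carrier G" shows "u x = 0"
proof (rule ccontr)
  assume "u x \<noteq> 0"
  then have pos: "0 < u x * u x" by (simp add: zero_less_mult_iff) linarith
  have "0 < ip u u"
    unfolding ip_def by (rule mean_pos[where f = "\<lambda>x. u x * u x", OF _ _ assms(3) pos]) (use assms in \<open>auto intro: continuous_intros\<close>)
  then show False using assms(2) by simp
qed

lemma ip_Cauchy_Schwarz:
  assumes u: "cont u" and v: "cont v" shows "(ip u v)\<^sup>2 \<le> ip u u * ip v v"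
proof (cases "ip v v = 0")
  case True
  then have "ip u v = ip u (\<lambda>_. 0)" using ip_eq_0[OF v] by (intro ip_cong) auto
  then show ?thesis using True by (simp add: ip_def)
next
  case False
  then have d: "ip v v > 0" using ip_nonneg[OF v] by simp
  let ?a = "ip v v" and ?b = "ip u v"
  have c: "cont (\<lambda>x. ?a * u x)" "cont (\<lambda>x. ?b * v x)" "cont (\<lambda>x. ?a * u x - ?b * v x)"
    using u v by (auto intro!: continuous_intros)
  have "0 \<le> ip (\<lambda>x. ?a * u x - ?b * v x) (\<lambda>x. ?a * u x - ?b * v x)"
    by (rule ip_nonneg[OF c(3)])
  also have "\<dots> = ?a * (?a * ip u u - ?b\<^sup>2)"
    by (simp only: ip_diff_left[OF c] ip_diff_right[OF c(1,2) c(1)] ip_diff_right[OF c(1,2) c(2)]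
        ip_cmul_left[OF u c(1)] ip_cmul_left[OF u c(2)] ip_cmul_left[OF v c(1)] ip_cmul_left[OF v c(2)]
        ip_cmul_right[OF u u] ip_cmul_right[OF u v] ip_cmul_right[OF v u] ip_cmul_right[OF v v] ip_commute[of v u])
      (simp add: power2_eq_square algebra_simps)
  finally show ?thesis using d by (simp add: zero_le_mult_iff mult.commute)
qed

section \<open>The convolution operator of a function and its top eigenspace\<close>

text \<open>The integral operator with kernel \<open>f (y \<otimes> g)\<close>. It carries right
  translations to left translations and \<open>conv_adj\<close> carries them back, so the composite
  commutes with right translations.\<close>

definition conv :: "('a \<Rightarrow> real) \<Rightarrow> ('a \<Rightarrow> real) \<Rightarrow> 'a \<Rightarrow> real" where
  "conv f u g = mean (\<lambda>y. u y * f (y \<otimes> g))"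

definition conv_adj :: "('a \<Rightarrow> real) \<Rightarrow> ('a \<Rightarrow> real) \<Rightarrow> 'a \<Rightarrow> real" where
  "conv_adj f w x = mean (\<lambda>g. f (x \<otimes> g) * w g)"

lemma cont_conv:
  assumes "cont f" "cont u" shows "cont (conv f u)"
proof -
  have "continuous_map (prod_topology T T) euclideanreal (\<lambda>p. u (snd p) * f (snd p \<otimes> fst p))"
    by (intro continuous_map_real_mult continuous_map_compose_app[OF continuous_map_snd assms(2)]
        continuous_map_compose_app[OF continuous_mult_of[OF continuous_map_snd continuous_map_fst] assms(1)])
  from continuous_mean[OF this] show ?thesis by (simp add: conv_def[abs_def])
qed

lemma cont_conv_adj:
  assumes "cont f" "cont w" shows "cont (conv_adj f w)"
proof -
  have "continuous_map (prod_topology T T) euclideanreal (\<lambda>p. f (fst p \<otimes> snd p) * w (snd p))"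
    by (intro continuous_map_real_mult continuous_map_compose_app[OF continuous_map_snd assms(2)]
        continuous_map_compose_app[OF continuous_mult_of[OF continuous_map_fst continuous_map_snd] assms(1)])
  from continuous_mean[OF this] show ?thesis by (simp add: conv_adj_def[abs_def])
qed

lemma ip_conv:
  assumes f: "cont f" and u: "cont u" and w: "cont w"
  shows "ip (conv f u) w = ip u (conv_adj f w)"
proof -
  have H: "continuous_map (prod_topology T T) euclideanreal (\<lambda>p. u (snd p) * f (snd p \<otimes> fst p) * w (fst p))"
    by (intro continuous_map_real_mult continuous_map_compose_app[OF continuous_map_snd u]
        continuous_map_compose_app[OF continuous_map_fst w]
        continuous_map_compose_app[OF continuous_mult_of[OF continuous_map_snd continuous_map_fst] f])
  have "ip (conv f u) w = mean (\<lambda>g. mean (\<lambda>y. u y * f (y \<otimes> g) * w g))"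
    unfolding ip_def
  proof (rule mean_cong)
    fix g assume g: "g \<in> carrier G"
    have "cont (\<lambda>y. u y * f (y \<otimes> g))" using u cont_right[OF f g] by (intro continuous_intros)
    from mean_cmul[OF this, of "w g"] show "conv f u g * w g = mean (\<lambda>y. u y * f (y \<otimes> g) * w g)"
      by (simp add: conv_def mult_ac)
  qed
  also have "\<dots> = mean (\<lambda>y. mean (\<lambda>g. u y * f (y \<otimes> g) * w g))"
    using mean_swap[OF H] by simp
  also have "\<dots> = ip u (conv_adj f w)"
    unfolding ip_def
  proof (rule mean_cong)
    fix y assume y: "y \<in> carrier G"
    have "cont (\<lambda>g. f (y \<otimes> g) * w g)" using w cont_left[OF f y] by (intro continuous_intros)
    from mean_cmul[OF this, of "u y"] show "mean (\<lambda>g. u y * f (y \<otimes> g) * w g) = u y * conv_adj f w y"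
      by (simp add: conv_adj_def mult_ac)
  qed
  finally show ?thesis .
qed

lemma conv_diff:
  assumes "cont f" "cont u" "cont v" "g \<in> carrier G"
  shows "conv f (\<lambda>x. u x - v x) g = conv f u g - conv f v g"
  unfolding conv_def left_diff_distrib
  by (rule mean_diff) (use assms cont_right in \<open>auto intro!: continuous_intros\<close>)

lemma conv_cmul:
  assumes "cont f" "cont u" "g \<in> carrier G"
  shows "conv f (\<lambda>x. c * u x) g = c * conv f u g"
  unfolding conv_def mult.assoc
  by (rule mean_cmul) (use assms cont_right in \<open>auto intro!: continuous_intros\<close>)

lemma conv_adj_cmul:
  assumes "cont f" "cont u"  "x \<in> carrier G"
  shows "conv_adj f (\<lambda>x. c * u x) x = c * conv_adj f u x"
proof -
  have "conv_adj f (\<lambda>x. c * u x) x = mean (\<lambda>g. c * (f (x \<otimes> g) * u g))"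
    by (simp add: conv_adj_def mult_ac)
  also have "\<dots> = c * conv_adj f u x"
    unfolding conv_adj_def by (rule mean_cmul) (use assms cont_left in \<open>auto intro!: continuous_intros\<close>)
  finally show ?thesis .
qed

lemma conv_cong: "(\<And>x. x \<in> carrier G \<Longrightarrow> u x = v x) \<Longrightarrow> conv f u g = conv f v g"
  unfolding conv_def by (rule mean_cong) simp

lemma conv_adj_cong: "(\<And>x. x \<in> carrier G \<Longrightarrow> u x = v x) \<Longrightarrow> conv_adj f u g = conv_adj f v g"
  unfolding conv_adj_def by (rule mean_cong) simp

lemma conv_eq_ip: "conv f u g = ip u (\<lambda>y. f (y \<otimes> g))"
  by (simp add: conv_def ip_def)

lemma conv_bound:
  assumes f: "cont f" and u: "cont u" and g: "g \<in> carrier G"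
  shows "(conv f u g)\<^sup>2 \<le> ip u u * ip f f"
proof -
  have "ip (\<lambda>y. f (y \<otimes> g)) (\<lambda>y. f (y \<otimes> g)) = ip f f"
    unfolding ip_def using mean_right[of "\<lambda>y. f y * f y" g] f g by (simp add: continuous_map_real_mult)
  then show ?thesis unfolding conv_eq_ip using ip_Cauchy_Schwarz[OF u cont_right[OF f g]] by simp
qed

lemma conv_equicontinuous:
  assumes f: "cont f" and u: "cont u" and gs: "g \<in> carrier G" "g' \<in> carrier G"
    and close: "\<And>y. y \<in> carrier G \<Longrightarrow> \<bar>f (y \<otimes> g) - f (y \<otimes> g')\<bar> \<le> e"
  shows "\<bar>conv f u g - conv f u g'\<bar> \<le> sqrt (ip u u) * e"
proof -
  let ?d = "\<lambda>y. f (y \<otimes> g) - f (y \<otimes> g')"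
  have e: "0 \<le> e" using close[OF one_closed] by linarith
  have d: "cont ?d" using cont_right[OF f] gs by (intro continuous_intros) auto
  have "ip ?d ?d \<le> mean (\<lambda>_. e\<^sup>2)"
    unfolding ip_def
  proof (rule mean_mono)
    show "?d x * ?d x \<le> e\<^sup>2" if "x \<in> carrier G" for x
      using close[OF that] by (metis abs_le_square_iff abs_of_nonneg e power2_eq_square)
  qed (use d in \<open>auto intro: continuous_intros\<close>)
  then have de: "ip ?d ?d \<le> e\<^sup>2" by simp
  have "conv f u g - conv f u g' = ip u ?d"
    unfolding conv_eq_ip by (rule ip_diff_right[symmetric]) (use u cont_right[OF f] gs in auto)
  then have "(conv f u g - conv f u g')\<^sup>2 \<le> ip u u * ip ?d ?d"
    using ip_Cauchy_Schwarz[OF u d] by simp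
  also have "\<dots> \<le> ip u u * e\<^sup>2" by (rule mult_left_mono[OF de ip_nonneg[OF u]])
  also have "\<dots> = (sqrt (ip u u) * e)\<^sup>2" using ip_nonneg[OF u] by (simp add: power_mult_distrib)
  finally have "\<bar>conv f u g - conv f u g'\<bar> \<le> \<bar>sqrt (ip u u) * e\<bar>" by (simp only: abs_le_square_iff)
  moreover have "0 \<le> sqrt (ip u u) * e" using e ip_nonneg[OF u] by simp
  ultimately show ?thesis by linarith
qed

lemma mult_inv_cancel:
  assumes "x \<in> carrier G" "a \<in> carrier G" "g \<in> carrier G"
  shows "x \<otimes> a \<otimes> (inv a \<otimes> g) = x \<otimes> g"
proof -
  have "a \<otimes> (inv a \<otimes> g) = g" using assms by (simp add: m_assoc[symmetric])
  then show ?thesis using assms by (simp add: m_assoc)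
qed

lemma conv_right_translate:
  assumes f: "cont f" and u: "cont u" and a: "a \<in> carrier G" and g: "g \<in> carrier G"
  shows "conv f (\<lambda>x. u (x \<otimes> a)) g = conv f u (inv a \<otimes> g)"
proof -
  have "mean (\<lambda>y. u (y \<otimes> a) * f (y \<otimes> a \<otimes> (inv a \<otimes> g))) = mean (\<lambda>y. u y * f (y \<otimes> (inv a \<otimes> g)))"
    by (rule mean_right[of "\<lambda>y. u y * f (y \<otimes> (inv a \<otimes> g))"])
      (use u cont_right[OF f, of "inv a \<otimes> g"] a g in \<open>auto intro: continuous_intros\<close>)
  moreover have "mean (\<lambda>y. u (y \<otimes> a) * f (y \<otimes> a \<otimes> (inv a \<otimes> g))) = mean (\<lambda>y. u (y \<otimes> a) * f (y \<otimes> g))"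
    by (rule mean_cong) (use a g in \<open>simp add: mult_inv_cancel\<close>)
  ultimately show ?thesis by (simp add: conv_def)
qed

lemma conv_adj_left_translate:
  assumes f: "cont f" and w: "cont w" and a: "a \<in> carrier G" and x: "x \<in> carrier G"
  shows "conv_adj f (\<lambda>g. w (inv a \<otimes> g)) x = conv_adj f w (x \<otimes> a)"
proof -
  have "mean (\<lambda>g. f (x \<otimes> a \<otimes> (inv a \<otimes> g)) * w (inv a \<otimes> g)) = mean (\<lambda>g. f (x \<otimes> a \<otimes> g) * w g)"
    by (rule mean_left[of "\<lambda>g. f (x \<otimes> a \<otimes> g) * w g"])
      (use w cont_left[OF f, of "x \<otimes> a"] a x in \<open>auto intro: continuous_intros\<close>)
  moreover have "x \<otimes> a \<otimes> (inv a \<otimes> g) = x \<otimes> g" if "g \<in> carrier G" for g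
    by (rule mult_inv_cancel[OF x a that])
  then have "mean (\<lambda>g. f (x \<otimes> a \<otimes> (inv a \<otimes> g)) * w (inv a \<otimes> g)) = mean (\<lambda>g. f (x \<otimes> g) * w (inv a \<otimes> g))"
    by (intro mean_cong) simp
  ultimately show ?thesis by (simp add: conv_adj_def)
qed

end

context compact_topological_group
begin

lemma mean_square_bound:
  assumes "cont u" "\<And>x. x \<in> carrier G \<Longrightarrow> \<bar>u x\<bar> \<le> e"
  shows "ip u u \<le> e\<^sup>2"
proof -
  have "ip u u \<le> mean (\<lambda>_. e\<^sup>2)"
    unfolding ip_def
  proof (rule mean_mono)
    show "u x * u x \<le> e\<^sup>2" if "x \<in> carrier G" for x
      using power_mono[OF assms(2)[OF that] abs_ge_zero, of 2] by (simp add: power2_eq_square)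
  qed (use assms(1) in \<open>auto intro: continuous_intros\<close>)
  then show ?thesis by simp
qed

lemma cont_bounded:
  assumes "cont f"
  obtains K where "K > 0" "\<And>x. x \<in> carrier G \<Longrightarrow> \<bar>f x\<bar> \<le> K"
proof -
  obtain xm where "\<And>y. y \<in> carrier G \<Longrightarrow> \<bar>f y\<bar> \<le> \<bar>f xm\<bar>"
    using compact_space_attains_sup[OF compact nonempty continuous_map_real_abs[OF assms]] topspace_eq by metis
  then show thesis using that[of "\<bar>f xm\<bar> + 1"] by force
qed

lemma conv_adj_close:
  assumes f: "cont f" "\<And>x. x \<in> carrier G \<Longrightarrow> \<bar>f x\<bar> \<le> K" and w: "cont w" "cont w'"
    and close: "\<And>g. g \<in> carrier G \<Longrightarrow> \<bar>w g - w' g\<bar> \<le> e" and x: "x \<in> carrier G"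
  shows "\<bar>conv_adj f w x - conv_adj f w' x\<bar> \<le> K * e"
  unfolding conv_adj_def
proof (rule mean_close)
  fix g assume g: "g \<in> carrier G"
  have "\<bar>f (x \<otimes> g) * w g - f (x \<otimes> g) * w' g\<bar> = \<bar>f (x \<otimes> g)\<bar> * \<bar>w g - w' g\<bar>"
    by (simp add: abs_mult right_diff_distrib[symmetric])
  also have "\<dots> \<le> K * e" using f(2)[of "x \<otimes> g"] close[OF g] x g by (intro mult_mono) auto
  finally show "\<bar>f (x \<otimes> g) * w g - f (x \<otimes> g) * w' g\<bar> \<le> K * e" .
qed (use w cont_left[OF f(1) x] in \<open>auto intro: continuous_intros\<close>)

lemma uniform_limit_cont:
  assumes b: "\<And>n::nat. cont (b n)"
    and lim: "\<And>e. e > 0 \<Longrightarrow> \<exists>N. \<forall>n\<ge>N. \<forall>g\<in>carrier G. \<bar>b n g - w g\<bar> \<le> e"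
  shows "cont w"
proof (rule continuous_map_real_epsilon)
  fix x and e :: real assume x: "x \<in> topspace T" and e: "e > 0"
  obtain N where N: "\<And>g. g \<in> carrier G \<Longrightarrow> \<bar>b N g - w g\<bar> \<le> e / 4" using lim[of "e / 4"] e by auto
  have op: "openin T {y \<in> topspace T. b N y \<in> ball (b N x) (e / 4)}"
    by (rule openin_continuous_map_preimage[OF b]) simp
  have "\<bar>w y - w x\<bar> < e" if "y \<in> {y \<in> topspace T. b N y \<in> ball (b N x) (e / 4)}" for y
  proof -
    have "\<bar>b N x - b N y\<bar> < e / 4" "x \<in> carrier G" "y \<in> carrier G"
      using that x topspace_eq by (simp_all add: dist_real_def)
    then show ?thesis using N[of x] N[of y] e by linarith
  qed
  then show "\<exists>U. openin T U \<and> x \<in> U \<and> (\<forall>x'\<in>U. \<bar>w x' - w x\<bar> < e)"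
    using op x e by (intro exI[of _ "{y \<in> topspace T. b N y \<in> ball (b N x) (e / 4)}"]) auto
qed

text \<open>Images of bounded sequences under the convolution operator are equicontinuous, so that they
  have uniformly convergent subsequences.\<close>

lemma conv_compact:
  assumes f: "cont f" and u: "\<And>n::nat. cont (u n)" "\<And>n. ip (u n) (u n) \<le> 1"
  shows "\<exists>r w. strict_mono (r :: nat \<Rightarrow> nat) \<and> cont w \<and>
    (\<forall>e>0. \<exists>N. \<forall>n\<ge>N. \<forall>g\<in>carrier G. \<bar>conv f (u (r n)) g - w g\<bar> \<le> e)"
proof -
  define b where "b n = conv f (u n)" for n
  have b: "cont (b n)" for n unfolding b_def by (rule cont_conv[OF f u(1)])
  have H: "continuous_map (prod_topology T T) euclideanreal (\<lambda>p. f (snd p \<otimes> fst p))"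
    by (rule continuous_map_compose_app[OF continuous_mult_of[OF continuous_map_snd continuous_map_fst] f])
  have "\<exists>D. finite D \<and> D \<subseteq> carrier G \<and> (\<forall>g\<in>carrier G. \<exists>d\<in>D. \<forall>y\<in>carrier G. \<bar>f (y \<otimes> g) - f (y \<otimes> d)\<bar> < 1 / Suc k)" for k
  proof -
    obtain D where "finite D" "D \<subseteq> topspace T" "\<And>x. x \<in> topspace T \<Longrightarrow>
        \<exists>d\<in>D. \<forall>y\<in>carrier G. \<bar>f (snd (x, y) \<otimes> fst (x, y)) - f (snd (d, y) \<otimes> fst (d, y))\<bar> < 1 / Suc k"
      by (rule finite_parameter_net[OF H compact, of "1 / Suc k"]) simp_all
    then show ?thesis using topspace_eq by (intro exI[of _ D]) simp
  qed
  then obtain D where D: "\<And>k. finite (D k)" "\<And>k. D k \<subseteq> carrier G"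
    "\<And>k g. g \<in> carrier G \<Longrightarrow> \<exists>d\<in>D k. \<forall>y\<in>carrier G. \<bar>f (y \<otimes> g) - f (y \<otimes> d)\<bar> < 1 / Suc k"
    by metis
  \<comment> \<open>The union of the nets plays the part of a countable dense set in the
    Arzela-Ascoli theorem. The group need not be separable: closeness is measured only by translates
    of \<open>f\<close>.\<close>
  have cnt: "countable (\<Union>k. D k)" using D(1) by (simp add: countable_finite)
  have bd: "norm (b n g) \<le> sqrt (ip f f)" if "g \<in> (\<Union>k. D k)" for n g
  proof -
    have "g \<in> carrier G" using that D(2) by blast
    then have "(b n g)\<^sup>2 \<le> ip (u n) (u n) * ip f f" unfolding b_def by (rule conv_bound[OF f u(1)])
    also have "\<dots> \<le> 1 * ip f f" using u(2) ip_nonneg[OF f] by (intro mult_right_mono)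
    finally show ?thesis by (simp add: real_le_rsqrt)
  qed
  have "\<exists>r::nat \<Rightarrow> nat. strict_mono r \<and> (\<forall>g\<in>(\<Union>k. D k). \<exists>l. (\<lambda>n. b (r n) g) \<longlonglongrightarrow> l)"
  proof (rule function_convergent_subsequence[OF cnt bd])
    fix k :: "nat \<Rightarrow> nat"
    assume k: "strict_mono k" "\<And>x. x \<in> (\<Union>k. D k) \<Longrightarrow> \<exists>l. (\<lambda>n. b (k n) x) \<longlonglongrightarrow> l"
    show "\<exists>r::nat \<Rightarrow> nat. strict_mono r \<and> (\<forall>g\<in>(\<Union>k. D k). \<exists>l. (\<lambda>n. b (r n) g) \<longlonglongrightarrow> l)"
      by (intro exI[of _ k] conjI ballI k)
  qed
  then obtain r :: "nat \<Rightarrow> nat" where r: "strict_mono r" "\<forall>g\<in>(\<Union>k. D k). \<exists>l. (\<lambda>n. b (r n) g) \<longlonglongrightarrow> l"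
    by (elim exE conjE)
  have equi: "\<bar>b n g - b n d\<bar> \<le> 1 / Suc k"
    if "g \<in> carrier G" "d \<in> carrier G" "\<And>y. y \<in> carrier G \<Longrightarrow> \<bar>f (y \<otimes> g) - f (y \<otimes> d)\<bar> < 1 / Suc k" for n g d k
  proof -
    have "\<bar>b n g - b n d\<bar> \<le> sqrt (ip (u n) (u n)) * (1 / Suc k)"
      unfolding b_def by (rule conv_equicontinuous[OF f u(1) that(1,2)]) (use that(3) in \<open>force intro: less_imp_le\<close>)
    also have "\<dots> \<le> 1 * (1 / Suc k)" using u(2)[of n] by (intro mult_right_mono) auto
    finally show ?thesis by simp
  qed
  have cauchy: "\<exists>N. \<forall>m\<ge>N. \<forall>n\<ge>N. \<forall>g\<in>carrier G. \<bar>b (r m) g - b (r n) g\<bar> \<le> e" if e: "e > 0" for e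
  proof -
    obtain k where k: "1 / Suc k < e / 3" using e nat_approx_posE[of "e / 3"] by auto
    have "\<forall>d\<in>D k. \<exists>N. \<forall>m\<ge>N. \<forall>n\<ge>N. \<bar>b (r m) d - b (r n) d\<bar> < e / 3"
    proof
      fix d assume "d \<in> D k"
      then obtain l where "(\<lambda>n. b (r n) d) \<longlonglongrightarrow> l" using r(2) by blast
      then have "Cauchy (\<lambda>n. b (r n) d)" by (rule LIMSEQ_imp_Cauchy)
      then show "\<exists>N. \<forall>m\<ge>N. \<forall>n\<ge>N. \<bar>b (r m) d - b (r n) d\<bar> < e / 3"
        using e unfolding Cauchy_def dist_real_def by (meson divide_pos_pos zero_less_numeral)
    qed
    then obtain N where N: "\<And>d m n. d \<in> D k \<Longrightarrow> m \<ge> N d \<Longrightarrow> n \<ge> N d \<Longrightarrow> \<bar>b (r m) d - b (r n) d\<bar> < e / 3"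
      by metis
    have "\<bar>b (r m) g - b (r n) g\<bar> \<le> e" if mn: "m \<ge> sum N (D k)" "n \<ge> sum N (D k)" and g: "g \<in> carrier G" for m n g
    proof -
      obtain d where d: "d \<in> D k" "\<And>y. y \<in> carrier G \<Longrightarrow> \<bar>f (y \<otimes> g) - f (y \<otimes> d)\<bar> < 1 / Suc k"
        using D(3)[OF g] by blast
      have dG: "d \<in> carrier G" using d(1) D(2) by blast
      have "N d \<le> sum N (D k)" using d(1) D(1) by (intro member_le_sum) auto
      then have "\<bar>b (r m) d - b (r n) d\<bar> < e / 3" using N[OF d(1)] mn by simp
      then show ?thesis using equi[OF g dG d(2), of "r m"] equi[OF g dG d(2), of "r n"] k by linarith
    qed
    then show ?thesis by blast
  qed
  define w where "w g = lim (\<lambda>n. b (r n) g)" for g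
  have lim: "(\<lambda>n. b (r n) g) \<longlonglongrightarrow> w g" if g: "g \<in> carrier G" for g
  proof -
    have "Cauchy (\<lambda>n. b (r n) g)"
      unfolding Cauchy_def dist_real_def
    proof (intro allI impI)
      fix e :: real assume "e > 0"
      then have "e / 2 > 0" by simp
      from cauchy[OF this] obtain N where "\<forall>m\<ge>N. \<forall>n\<ge>N. \<forall>g\<in>carrier G. \<bar>b (r m) g - b (r n) g\<bar> \<le> e / 2" by blast
      then have "\<forall>m\<ge>N. \<forall>n\<ge>N. \<bar>b (r m) g - b (r n) g\<bar> < e" using g \<open>e > 0\<close> by fastforce
      then show "\<exists>N. \<forall>m\<ge>N. \<forall>n\<ge>N. \<bar>b (r m) g - b (r n) g\<bar> < e" by blast
    qed
    then show ?thesis unfolding w_def using Cauchy_convergent_iff convergent_LIMSEQ_iff by blast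
  qed
  have unif: "\<exists>N. \<forall>n\<ge>N. \<forall>g\<in>carrier G. \<bar>b (r n) g - w g\<bar> \<le> e" if e: "e > 0" for e
  proof -
    obtain N where N: "\<And>m n g. m \<ge> N \<Longrightarrow> n \<ge> N \<Longrightarrow> g \<in> carrier G \<Longrightarrow> \<bar>b (r m) g - b (r n) g\<bar> \<le> e"
      using cauchy[OF e] by blast
    have "\<bar>b (r n) g - w g\<bar> \<le> e" if n: "n \<ge> N" and g: "g \<in> carrier G" for n g
    proof (rule LIMSEQ_le_const2)
      show "(\<lambda>m. \<bar>b (r n) g - b (r m) g\<bar>) \<longlonglongrightarrow> \<bar>b (r n) g - w g\<bar>"
        by (intro tendsto_intros lim[OF g])
      show "\<exists>N. \<forall>m\<ge>N. \<bar>b (r n) g - b (r m) g\<bar> \<le> e" using N[OF n _ g] by blast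
    qed
    then show ?thesis by blast
  qed
  have "cont w" by (rule uniform_limit_cont[OF b unif])
  with r(1) unif show ?thesis unfolding b_def by (intro exI[of _ r] exI[of _ w] conjI allI impI)
qed

text \<open>The variational construction of the largest eigenvalue of
  \<open>conv_adj f \<circ> conv f\<close>. Continuous functions need not be complete for
  \<open>ip\<close>, so no limit of the maximizing sequence is formed. Its images under
  \<open>conv f\<close> have a continuous uniform limit \<open>w\<close> along a subsequence, and
  \<open>v\<close> is the image of \<open>w\<close> under \<open>conv_adj f\<close>.\<close>

lemma conv_top_eigenfunction:
  assumes f: "cont f" and x0: "x0 \<in> carrier G" "f x0 \<noteq> 0"
  obtains v \<sigma> y where "cont v" "\<sigma> > 0" "y \<in> carrier G" "v y \<noteq> 0"
    "\<And>x. x \<in> carrier G \<Longrightarrow> conv_adj f (conv f v) x = \<sigma> * v x"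
proof -
  let ?B = "conv f" and ?B' = "conv_adj f" and ?F = "ip f f"
  note cB = cont_conv[OF f] and cB' = cont_conv_adj[OF f]
  have F: "?F > 0" using ip_eq_0[OF f _ x0(1)] x0(2) ip_nonneg[OF f] by force
  define Q where "Q = {ip (?B u) (?B u) |u. cont u \<and> ip u u \<le> 1}"
  define \<sigma> where "\<sigma> = Sup Q"
  have bound: "ip (?B u) (?B u) \<le> ?F" if u: "cont u" "ip u u \<le> 1" for u
  proof -
    have "\<bar>?B u g\<bar> \<le> sqrt ?F" if "g \<in> carrier G" for g
    proof -
      have "(?B u g)\<^sup>2 \<le> ip u u * ?F" by (rule conv_bound[OF f u(1) that])
      also have "\<dots> \<le> 1 * ?F" using u(2) F by (intro mult_right_mono) auto
      finally show ?thesis by (simp add: real_le_rsqrt)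
    qed
    from mean_square_bound[OF cB[OF u(1)] this] show ?thesis using F by simp
  qed
  have bdd: "bdd_above Q" using bound unfolding Q_def bdd_above_def by blast
  have upper: "ip (?B u) (?B u) \<le> \<sigma>" if "cont u" "ip u u \<le> 1" for u
    unfolding \<sigma>_def by (rule cSup_upper[OF _ bdd]) (use that in \<open>auto simp: Q_def\<close>)
  have scale: "ip (?B (\<lambda>x. c * u x)) (?B (\<lambda>x. c * u x)) = c\<^sup>2 * ip (?B u) (?B u)" "ip (\<lambda>x. c * u x) (\<lambda>x. c * u x) = c\<^sup>2 * ip u u"
    if u: "cont u" for u c
  proof -
    have cu: "cont (\<lambda>x. c * u x)" "cont (\<lambda>x. c * ?B u x)" using u cB[OF u] by (auto intro!: continuous_intros)
    have "ip (?B (\<lambda>x. c * u x)) (?B (\<lambda>x. c * u x)) = ip (\<lambda>x. c * ?B u x) (\<lambda>x. c * ?B u x)"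
      by (rule ip_cong) (simp_all add: conv_cmul[OF f u])
    then show "ip (?B (\<lambda>x. c * u x)) (?B (\<lambda>x. c * u x)) = c\<^sup>2 * ip (?B u) (?B u)"
      using u cu cB[OF u] by (simp add: ip_cmul_left ip_cmul_right power2_eq_square)
    show "ip (\<lambda>x. c * u x) (\<lambda>x. c * u x) = c\<^sup>2 * ip u u"
      using u cu by (simp add: ip_cmul_left ip_cmul_right power2_eq_square)
  qed
  have general: "ip (?B u) (?B u) \<le> \<sigma> * ip u u" if u: "cont u" for u
  proof (cases "ip u u = 0")
    case True
    then have "?B u g = 0" if "g \<in> carrier G" for g using conv_bound[OF f u that] by simp
    then have "ip (?B u) (?B u) = ip (\<lambda>_. 0) (\<lambda>_. 0)" by (intro ip_cong) auto
    then show ?thesis using True by (simp add: ip_def)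
  next
    case False
    then have p: "ip u u > 0" using ip_nonneg[OF u] by simp
    let ?c = "1 / sqrt (ip u u)"
    have c2: "?c\<^sup>2 = 1 / ip u u" using p by (simp add: power_divide)
    have "cont (\<lambda>x. ?c * u x)" by (intro continuous_map_real_mult u) simp
    moreover have "ip (\<lambda>x. ?c * u x) (\<lambda>x. ?c * u x) \<le> 1" unfolding scale(2)[OF u] c2 using p by simp
    ultimately have "ip (?B (\<lambda>x. ?c * u x)) (?B (\<lambda>x. ?c * u x)) \<le> \<sigma>" by (rule upper)
    then show ?thesis unfolding scale(1)[OF u] c2 using p by (simp add: divide_le_eq)
  qed
  have \<sigma>: "\<sigma> > 0"
  proof -
    \<comment> \<open>With \<open>f\<close> itself as test function the operator is seen to be
      nonzero.\<close>
    have "?B f \<one> = ?F" unfolding conv_def ip_def by (rule mean_cong) simp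
    then have "ip (?B f) (?B f) \<noteq> 0" using ip_eq_0[OF cB[OF f] _ one_closed] F by force
    then have "0 < ip (?B f) (?B f)" using ip_nonneg[OF cB[OF f]] by simp
    then have "0 < \<sigma> * ?F" using general[OF f] by linarith
    then show ?thesis using F by (simp add: zero_less_mult_iff)
  qed
  have "\<exists>u. cont u \<and> ip u u \<le> 1 \<and> \<sigma> - 1 / Suc n < ip (?B u) (?B u)" for n
  proof -
    have "Q \<noteq> {}" unfolding Q_def by (auto intro!: exI[of _ "\<lambda>_. 0"] simp: ip_def)
    then have "\<exists>q\<in>Q. \<sigma> - 1 / Suc n < q"
      using less_cSup_iff[OF _ bdd, of "\<sigma> - 1 / Suc n"] by (simp add: \<sigma>_def)
    then show ?thesis by (auto simp: Q_def)
  qed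
  then obtain u where u: "\<And>n. cont (u n)" "\<And>n. ip (u n) (u n) \<le> 1" "\<And>n. \<sigma> - 1 / Suc n < ip (?B (u n)) (?B (u n))"
    by metis
  obtain r w where r: "strict_mono (r :: nat \<Rightarrow> nat)" and w: "cont w"
    and unif: "\<And>e. e > 0 \<Longrightarrow> \<exists>N. \<forall>n\<ge>N. \<forall>g\<in>carrier G. \<bar>?B (u (r n)) g - w g\<bar> \<le> e"
    using conv_compact[where u = u, OF f u(1,2)] by (elim exE conjE) simp
  obtain K where K: "K > 0" "\<And>x. x \<in> carrier G \<Longrightarrow> \<bar>f x\<bar> \<le> K" by (rule cont_bounded[OF f]) blast
  define v where "v = ?B' w"
  have v: "cont v" unfolding v_def by (rule cB'[OF w])
  define Ta where "Ta n = ?B' (?B (u (r n)))" for n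
  have Ta: "cont (Ta n)" for n unfolding Ta_def by (intro cB' cB u)
  let ?a = "\<lambda>n. u (r n)"
  have a\<sigma>: "cont (\<lambda>x. \<sigma> * ?a n x)" for n using u(1) by (auto intro!: continuous_intros)
  \<comment> \<open>The maximizing sequence consists of approximate eigenfunctions: with
    \<open>ip (Ta n) (Ta n) \<le> \<sigma>\<^sup>2\<close> the expanded square is at most
    \<open>2 * \<sigma> * (\<sigma> - ?q)\<close>, and \<open>?q\<close> tends to
    \<open>\<sigma>\<close>.\<close>
  have near1: "ip (\<lambda>x. Ta n x - \<sigma> * ?a n x) (\<lambda>x. Ta n x - \<sigma> * ?a n x) \<le> 2 * \<sigma> / Suc n" for n
  proof -
    let ?q = "ip (?B (?a n)) (?B (?a n))"
    have c: "cont (\<lambda>x. Ta n x - \<sigma> * ?a n x)" using Ta[of n] a\<sigma>[of n] by (rule continuous_map_diff)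
    have q: "ip (Ta n) (?a n) = ?q" unfolding Ta_def
      using ip_conv[OF f u(1) cB[OF u(1)]] by (simp add: ip_commute)
    have "ip (Ta n) (Ta n) = ip (?B (?a n)) (?B (Ta n))"
      unfolding Ta_def[of n] using ip_conv[OF f cB'[OF cB[OF u(1)]] cB[OF u(1)]] by (simp add: ip_commute)
    then have "(ip (Ta n) (Ta n))\<^sup>2 \<le> ?q * ip (?B (Ta n)) (?B (Ta n))"
      using ip_Cauchy_Schwarz[OF cB[OF u(1)] cB[OF Ta]] by simp
    also have "\<dots> \<le> \<sigma> * (\<sigma> * ip (Ta n) (Ta n))"
      using upper[OF u(1,2)] general[OF Ta] \<sigma> ip_nonneg[OF cB[OF Ta]] by (intro mult_mono) auto
    finally have "ip (Ta n) (Ta n) * ip (Ta n) (Ta n) \<le> \<sigma>\<^sup>2 * ip (Ta n) (Ta n)"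
      by (simp add: power2_eq_square mult.assoc)
    then have TT: "ip (Ta n) (Ta n) \<le> \<sigma>\<^sup>2"
      using ip_nonneg[OF Ta[of n]] by (cases "ip (Ta n) (Ta n) = 0") (auto simp: mult_le_cancel_right)
    have "ip (\<lambda>x. Ta n x - \<sigma> * ?a n x) (\<lambda>x. Ta n x - \<sigma> * ?a n x)
        = ip (Ta n) (Ta n) - 2 * \<sigma> * ?q + \<sigma>\<^sup>2 * ip (?a n) (?a n)"
      by (simp only: ip_diff_left[OF Ta a\<sigma> c] ip_diff_right[OF Ta a\<sigma> Ta] ip_diff_right[OF Ta a\<sigma> a\<sigma>]
          ip_cmul_left[OF u(1) Ta] ip_cmul_left[OF u(1) a\<sigma>] ip_cmul_right[OF u(1) Ta] ip_cmul_right[OF u(1) u(1)]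
          ip_commute[of "?a n" "Ta n"] q) (simp add: power2_eq_square algebra_simps)
    also have "\<dots> \<le> \<sigma>\<^sup>2 - 2 * \<sigma> * ?q + \<sigma>\<^sup>2 * 1"
      using TT mult_left_mono[OF u(2)[of "r n"], of "\<sigma>\<^sup>2"] by simp
    also have "\<dots> = 2 * \<sigma> * (\<sigma> - ?q)" by (simp add: power2_eq_square algebra_simps)
    also have "\<dots> \<le> 2 * \<sigma> * (1 / Suc n)"
    proof (rule mult_left_mono)
      have "1 / real (Suc (r n)) \<le> 1 / Suc n" using seq_suble[OF r, of n] by (intro divide_left_mono) auto
      then show "\<sigma> - ?q \<le> 1 / Suc n" using u(3)[of "r n"] by linarith
    qed (use \<sigma> in simp)
    finally show ?thesis by simp
  qed
  have eig: "?B v g = \<sigma> * w g" if g: "g \<in> carrier G" for g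
  proof (rule ccontr)
    assume "?B v g \<noteq> \<sigma> * w g"
    define e where "e = \<bar>?B v g - \<sigma> * w g\<bar> / 4"
    have e: "e > 0" using \<open>?B v g \<noteq> \<sigma> * w g\<close> by (simp add: e_def)
    \<comment> \<open>Both sides are limits of \<open>?B (Ta n) g\<close>: it is close to
      \<open>?B v g\<close> because \<open>Ta n\<close> tends to \<open>v\<close>, and to
      \<open>\<sigma> * w g\<close> by \<open>near1\<close> and the convergence to \<open>w\<close>.
      Three errors of at most \<open>e\<close> face a gap of \<open>4 * e\<close>.\<close>
    define d where "d = min (e / \<sigma>) (e / (K * sqrt ?F))"
    have d: "d > 0" "\<sigma> * d \<le> e" "K * d * sqrt ?F \<le> e"
      using e \<sigma> K(1) F by (auto simp: d_def min_def field_simps)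
    obtain N where N: "\<And>n g. n \<ge> N \<Longrightarrow> g \<in> carrier G \<Longrightarrow> \<bar>?B (?a n) g - w g\<bar> \<le> d" using unif[OF d(1)] by blast
    obtain M where M: "2 * \<sigma> * ?F / e\<^sup>2 < real M" using reals_Archimedean2 by blast
    define n where "n = max N M"
    have "2 * \<sigma> * ?F / e\<^sup>2 \<le> real (Suc n)" using M by (simp add: n_def)
    then have small: "2 * \<sigma> / Suc n * ?F \<le> e\<^sup>2" using e by (simp add: field_simps)
    have "\<bar>v x - Ta n x\<bar> \<le> K * d" if x: "x \<in> carrier G" for x
      unfolding v_def Ta_def
      by (rule conv_adj_close[OF f K(2) w cB[OF u(1)] _ x]) (use N[of n] n_def in \<open>simp_all add: abs_minus_commute\<close>)
    then have "ip (\<lambda>x. v x - Ta n x) (\<lambda>x. v x - Ta n x) \<le> (K * d)\<^sup>2"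
      by (intro mean_square_bound continuous_map_diff v Ta)
    then have "(?B (\<lambda>x. v x - Ta n x) g)\<^sup>2 \<le> (K * d)\<^sup>2 * ?F"
      using conv_bound[OF f continuous_map_diff[OF v Ta] g, of n] F
      by (meson mult_right_mono less_imp_le order_trans)
    also have "\<dots> = (K * d * sqrt ?F)\<^sup>2" using F by (simp add: power_mult_distrib)
    finally have "\<bar>?B (\<lambda>x. v x - Ta n x) g\<bar> \<le> \<bar>K * d * sqrt ?F\<bar>" by (simp only: abs_le_square_iff)
    then have 1: "\<bar>?B v g - ?B (Ta n) g\<bar> \<le> e" using d K F unfolding conv_diff[OF f v Ta g] by simp
    have "(?B (\<lambda>x. Ta n x - \<sigma> * ?a n x) g)\<^sup>2 \<le> 2 * \<sigma> / Suc n * ?F"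
      using conv_bound[OF f continuous_map_diff[OF Ta a\<sigma>] g, of n n] near1[of n] F
      by (meson mult_right_mono less_imp_le order_trans)
    then have "(?B (\<lambda>x. Ta n x - \<sigma> * ?a n x) g)\<^sup>2 \<le> e\<^sup>2" using small by linarith
    then have "\<bar>?B (\<lambda>x. Ta n x - \<sigma> * ?a n x) g\<bar> \<le> \<bar>e\<bar>" by (simp only: abs_le_square_iff)
    then have 2: "\<bar>?B (Ta n) g - \<sigma> * ?B (?a n) g\<bar> \<le> e"
      using e unfolding conv_diff[OF f Ta a\<sigma> g] conv_cmul[OF f u(1) g] by simp
    have "\<bar>\<sigma> * ?B (?a n) g - \<sigma> * w g\<bar> = \<sigma> * \<bar>?B (?a n) g - w g\<bar>"
      using \<sigma> by (simp add: abs_mult right_diff_distrib[symmetric])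
    also have "\<dots> \<le> \<sigma> * d" using N[of n g] g \<sigma> by (intro mult_left_mono) (simp_all add: n_def)
    finally have "\<bar>\<sigma> * ?B (?a n) g - \<sigma> * w g\<bar> \<le> e" using d(2) by linarith
    with 1 2 have "\<bar>?B v g - \<sigma> * w g\<bar> \<le> 3 * e" by linarith
    moreover have "\<bar>?B v g - \<sigma> * w g\<bar> = 4 * e" by (simp add: e_def)
    ultimately show False using e by linarith
  qed
  have "?B' (?B v) x = \<sigma> * v x" if x: "x \<in> carrier G" for x
    using conv_adj_cong[of "?B v" "\<lambda>g. \<sigma> * w g" f x] eig conv_adj_cmul[OF f w x] by (simp add: v_def)
  \<comment> \<open>If \<open>v\<close> vanished, so would \<open>w\<close>, and the images of the
    maximizing sequence would tend to 0, although the means of their squares tend to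
    \<open>\<sigma>\<close>.\<close>
  moreover have "\<exists>y\<in>carrier G. v y \<noteq> 0"
  proof (rule ccontr)
    assume "\<not> ?thesis"
    then have "?B v g = ?B (\<lambda>_. 0) g" for g by (intro conv_cong) auto
    then have w0: "w g = 0" if "g \<in> carrier G" for g using eig[OF that] \<sigma> by (simp add: conv_def)
    have "sqrt \<sigma> / 2 > 0" using \<sigma> by simp
    from unif[OF this] obtain N where "\<forall>n\<ge>N. \<forall>g\<in>carrier G. \<bar>?B (?a n) g - w g\<bar> \<le> sqrt \<sigma> / 2" by blast
    then have N: "\<bar>?B (?a n) g\<bar> \<le> sqrt \<sigma> / 2" if "n \<ge> N" "g \<in> carrier G" for n g
      using that w0[OF that(2)] by (metis diff_zero)
    obtain M where M: "1 / Suc M < \<sigma> / 2" using nat_approx_posE[of "\<sigma> / 2"] \<sigma> by auto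
    define n where "n = max N M"
    have "ip (?B (?a n)) (?B (?a n)) \<le> (sqrt \<sigma> / 2)\<^sup>2"
      by (rule mean_square_bound[OF cB[OF u(1)]]) (use N n_def in simp)
    then have "ip (?B (?a n)) (?B (?a n)) \<le> \<sigma> / 4" using \<sigma> by (simp add: power_divide)
    moreover have "1 / real (Suc (r n)) \<le> 1 / Suc M"
      using seq_suble[OF r, of n] by (intro divide_left_mono) (auto simp: n_def)
    ultimately show False using u(3)[of "r n"] M \<sigma> by linarith
  qed
  ultimately show thesis using that[OF v \<sigma>] by blast
qed

end

section \<open>Traces of translations on an eigenspace, and the identity component\<close>

lemma complex_matrix_trace_eigenvalues:
  fixes A :: "nat \<Rightarrow> nat \<Rightarrow> complex"
  shows "\<exists>es. (\<Sum>i<n. A i i) = sum_list es \<and>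
    (\<forall>\<mu>\<in>set es. \<exists>c. (\<exists>i<n. c i \<noteq> 0) \<and> (\<forall>i<n. (\<Sum>j<n. A i j * c j) = \<mu> * c i))"
proof -
  define M where "M = Matrix.mat n n (\<lambda>(i, j). A i j)"
  have M: "M \<in> carrier_mat n n" by (simp add: M_def)
  have "\<exists>es. char_poly M = (\<Prod>a\<leftarrow>es. [:- a, 1:]) \<and> length es = n"
    by (rule char_poly_factorized[OF M])
  then obtain es where es: "char_poly M = (\<Prod>a\<leftarrow>es. [:- a, 1:])" "length es = n"
    by (elim exE conjE)
  \<comment> \<open>The Schur form has the eigenvalues on its diagonal, and similarity preserves the
    trace.\<close>
  obtain B P Q where bpq: "schur_decomposition M es = (B, P, Q)"
    by (rule prod_cases3)
  have sd: "similar_mat_wit M B P Q" "diag_mat B = es"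
    using schur_decomposition[OF M es(1) bpq] by simp_all
  have car: "B \<in> carrier_mat n n" "P \<in> carrier_mat n n" "Q \<in> carrier_mat n n"
    and QP: "Q * P = 1\<^sub>m n" and eq: "M = P * B * Q"
    using similar_mat_witD2[OF M sd(1)] by simp_all
  have tr: "(\<Sum>i<n. (X * Y) $$ (i, i)) = (\<Sum>i<n. (Y * X) $$ (i, i))"
    if XY: "X \<in> carrier_mat n n" "Y \<in> carrier_mat n n" for X Y :: "complex Matrix.mat"
  proof -
    have e: "(U * V) $$ (i, i) = (\<Sum>k<n. U $$ (i, k) * V $$ (k, i))"
      if "U \<in> carrier_mat n n" "V \<in> carrier_mat n n" "i < n" for U V :: "complex Matrix.mat" and i
      using that by (simp add: scalar_prod_def atLeast0LessThan)
    have "(\<Sum>i<n. (X * Y) $$ (i, i)) = (\<Sum>i<n. \<Sum>k<n. X $$ (i, k) * Y $$ (k, i))"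
      by (intro sum.cong refl e XY) simp
    also have "\<dots> = (\<Sum>k<n. \<Sum>i<n. X $$ (i, k) * Y $$ (k, i))"
      by (rule sum.swap)
    also have "\<dots> = (\<Sum>k<n. \<Sum>i<n. Y $$ (k, i) * X $$ (i, k))"
      by (simp only: mult.commute)
    also have "\<dots> = (\<Sum>k<n. (Y * X) $$ (k, k))"
      by (intro sum.cong refl e[symmetric] XY) simp
    finally show ?thesis .
  qed
  have "(\<Sum>i<n. A i i) = (\<Sum>i<n. M $$ (i, i))"
    by (simp add: M_def)
  also have "\<dots> = (\<Sum>i<n. (P * (B * Q)) $$ (i, i))"
    using car eq by (simp add: assoc_mult_mat[of _ n n _ n _ n])
  also have "\<dots> = (\<Sum>i<n. ((B * Q) * P) $$ (i, i))"
    by (rule tr) (use car in simp_all)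
  also have "(B * Q) * P = B"
    using car QP by (simp add: assoc_mult_mat[of _ n n _ n _ n])
  also have "(\<Sum>i<n. B $$ (i, i)) = sum_list (diag_mat B)"
    using car by (simp add: diag_mat_def sum_list_sum_nth atLeast0LessThan)
  finally have trace: "(\<Sum>i<n. A i i) = sum_list es"
    using sd by simp
  have "\<exists>c. (\<exists>i<n. c i \<noteq> 0) \<and> (\<forall>i<n. (\<Sum>j<n. A i j * c j) = \<mu> * c i)" if mu: "\<mu> \<in> set es" for \<mu>
  proof -
    have "poly (char_poly M) \<mu> = 0"
      using mu unfolding es(1) by (simp add: poly_prod_list prod_list_zero_iff image_iff)
    then have "eigenvalue M \<mu>"
      by (simp add: eigenvalue_root_char_poly[OF M])
    then obtain v where v: "v \<in> carrier_vec n" "v \<noteq> 0\<^sub>v n" "M *\<^sub>v v = \<mu> \<cdot>\<^sub>v v"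
      unfolding eigenvalue_def eigenvector_def using M by auto
    have "\<exists>i<n. v $ i \<noteq> 0"
    proof (rule ccontr)
      assume "\<not> ?thesis"
      then have "v = 0\<^sub>v n" using v(1) by (intro eq_vecI) auto
      with v(2) show False by simp
    qed
    moreover have "(\<Sum>j<n. A i j * v $ j) = \<mu> * v $ i" if i: "i < n" for i
    proof -
      have "(M *\<^sub>v v) $ i = (\<Sum>j<n. A i j * v $ j)"
        using i v(1) by (simp add: M_def scalar_prod_def atLeast0LessThan)
      then show ?thesis using v i by simp
    qed
    ultimately show ?thesis by (intro exI[of _ "\<lambda>i. v $ i"]) blast
  qed
  with trace show ?thesis by blast
qed

lemma countable_sums_of_roots_of_unity:
  "countable (sum_list ` lists {z::complex. \<exists>k::nat. k > 0 \<and> z ^ k = 1})"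
proof -
  have "finite {z::complex. z ^ Suc k = 1}" for k :: nat
    by (rule finite_roots_unity) simp
  then have "countable (\<Union>k::nat. {z::complex. z ^ Suc k = 1})"
    by (intro countable_UN[OF countableI_type] countable_finite)
  moreover have "{z::complex. \<exists>k::nat. k > 0 \<and> z ^ k = 1} \<subseteq> (\<Union>k::nat. {z. z ^ Suc k = 1})"
    by (auto dest!: gr0_implies_Suc simp del: power_Suc)
  ultimately have "countable {z::complex. \<exists>k::nat. k > 0 \<and> z ^ k = 1}"
    by (rule countable_subset[rotated])
  from countable_image[OF countable_lists[OF this]] show ?thesis .
qed

context compact_topological_group
begin

definition orthonormal :: "nat \<Rightarrow> (nat \<Rightarrow> 'a \<Rightarrow> real) \<Rightarrow> bool" where
  "orthonormal r e \<longleftrightarrow> (\<forall>i<r. cont (e i)) \<and> (\<forall>i<r. \<forall>j<r. ip (e i) (e j) = (if i = j then 1 else 0))"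

definition proj :: "nat \<Rightarrow> (nat \<Rightarrow> 'a \<Rightarrow> real) \<Rightarrow> ('a \<Rightarrow> real) \<Rightarrow> 'a \<Rightarrow> real" where
  "proj r e w x = (\<Sum>i<r. ip w (e i) * e i x)"

lemma mean_sum:
  assumes "\<And>i. i \<in> I \<Longrightarrow> cont (u i)"
  shows "mean (\<lambda>x. \<Sum>i\<in>I. u i x) = (\<Sum>i\<in>I. mean (u i))"
  using ip_sum_left[where w = "\<lambda>_. 1" and c = "\<lambda>_. 1", OF assms] by (simp add: ip_def)

lemma orthonormal_coeff:
  assumes e: "orthonormal r e" and j: "j < r"
  shows "ip (\<lambda>x. \<Sum>i<r. c i * e i x) (e j) = c j"
proof -
  have "ip (\<lambda>x. \<Sum>i<r. c i * e i x) (e j) = (\<Sum>i<r. c i * ip (e i) (e j))"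
    by (rule ip_sum_left) (use e j in \<open>auto simp: orthonormal_def\<close>)
  also have "\<dots> = (\<Sum>i<r. if i = j then c j else 0)"
    by (rule sum.cong) (use e j in \<open>auto simp: orthonormal_def\<close>)
  finally show ?thesis using j by simp
qed

lemma cont_combination: "orthonormal r e \<Longrightarrow> cont (\<lambda>x. \<Sum>i<r. c i * e i x)"
  by (auto simp: orthonormal_def intro!: continuous_intros)

lemma ip_residual:
  assumes e: "orthonormal r e" and w: "cont w"
  shows "j < r \<Longrightarrow> ip (\<lambda>x. w x - proj r e w x) (e j) = 0"
    and "ip (\<lambda>x. w x - proj r e w x) (\<lambda>x. w x - proj r e w x) = ip w w - (\<Sum>i<r. (ip w (e i))\<^sup>2)"
proof -
  have p: "cont (proj r e w)" unfolding proj_def[abs_def] by (rule cont_combination[OF e])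
  have ei: "cont (e i)" if "i < r" for i using e that by (simp add: orthonormal_def)
  have d: "cont (\<lambda>x. w x - proj r e w x)" by (rule continuous_map_diff[OF w p])
  have 1: "ip (\<lambda>x. w x - proj r e w x) (e j) = 0" if "j < r" for j
    using ip_diff_left[OF w p ei[OF that]] orthonormal_coeff[OF e that] by (simp add: proj_def[abs_def])
  then show "j < r \<Longrightarrow> ip (\<lambda>x. w x - proj r e w x) (e j) = 0" .
  have "ip (\<lambda>x. w x - proj r e w x) (proj r e w) = (\<Sum>i<r. ip w (e i) * ip (e i) (\<lambda>x. w x - proj r e w x))"
    unfolding proj_def[of r e w, abs_def] ip_commute[of "\<lambda>x. w x - (\<Sum>i<r. ip w (e i) * e i x)"]
    by (rule ip_sum_left) (use ei d in \<open>auto simp: proj_def\<close>)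
  also have "\<dots> = 0" using 1 by (simp add: ip_commute)
  finally have "ip (\<lambda>x. w x - proj r e w x) (\<lambda>x. w x - proj r e w x) = ip (\<lambda>x. w x - proj r e w x) w"
    using ip_diff_right[OF w p d] by simp
  also have "\<dots> = ip w w - ip (proj r e w) w" by (rule ip_diff_left[OF w p w])
  also have "ip (proj r e w) w = (\<Sum>i<r. ip w (e i) * ip (e i) w)"
    unfolding proj_def[abs_def] by (rule ip_sum_left) (use ei w in auto)
  finally show "ip (\<lambda>x. w x - proj r e w x) (\<lambda>x. w x - proj r e w x) = ip w w - (\<Sum>i<r. (ip w (e i))\<^sup>2)"
    by (simp add: ip_commute power2_eq_square)
qed

lemma Bessel:
  assumes e: "orthonormal r e" and w: "cont w"
  shows "(\<Sum>i<r. (ip w (e i))\<^sup>2) \<le> ip w w"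
proof -
  have "cont (\<lambda>x. w x - proj r e w x)"
    unfolding proj_def by (rule continuous_map_diff[OF w cont_combination[OF e]])
  from ip_nonneg[OF this] show ?thesis using ip_residual(2)[OF e w] by simp
qed

definition eigenfunction :: "('a \<Rightarrow> real) \<Rightarrow> real \<Rightarrow> ('a \<Rightarrow> real) \<Rightarrow> bool" where
  "eigenfunction f \<sigma> v \<longleftrightarrow> cont v \<and> (\<forall>x\<in>carrier G. conv_adj f (conv f v) x = \<sigma> * v x)"

lemma eigenfunction_cont: "eigenfunction f \<sigma> v \<Longrightarrow> cont v"
  by (simp add: eigenfunction_def)

lemma eigenfunction_cmul:
  assumes f: "cont f" and v: "eigenfunction f \<sigma> v"
  shows "eigenfunction f \<sigma> (\<lambda>x. c * v x)"
proof -
  have v': "cont v" using v by (rule eigenfunction_cont)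
  have "conv_adj f (conv f (\<lambda>x. c * v x)) x = c * conv_adj f (conv f v) x" if x: "x \<in> carrier G" for x
    using conv_adj_cong[of "conv f (\<lambda>x. c * v x)" "\<lambda>g. c * conv f v g" f x] conv_cmul[OF f v']
      conv_adj_cmul[OF f cont_conv[OF f v'] x] by simp
  then show ?thesis using v v' by (auto simp: eigenfunction_def intro!: continuous_intros)
qed

lemma eigenfunction_diff:
  assumes f: "cont f" and u: "eigenfunction f \<sigma> u" and v: "eigenfunction f \<sigma> v"
  shows "eigenfunction f \<sigma> (\<lambda>x. u x - v x)"
proof -
  note uv = eigenfunction_cont[OF u] eigenfunction_cont[OF v]
  have "conv_adj f (conv f (\<lambda>x. u x - v x)) x = conv_adj f (conv f u) x - conv_adj f (conv f v) x"
    if x: "x \<in> carrier G" for x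
  proof -
    have "conv_adj f (conv f (\<lambda>x. u x - v x)) x = conv_adj f (\<lambda>g. conv f u g - conv f v g) x"
      by (rule conv_adj_cong) (rule conv_diff[OF f uv])
    also have "\<dots> = conv_adj f (conv f u) x - conv_adj f (conv f v) x"
      unfolding conv_adj_def right_diff_distrib
      by (rule mean_diff) (intro continuous_map_real_mult cont_left f cont_conv uv x)+
    finally show ?thesis .
  qed
  then show ?thesis using u v uv by (auto simp: eigenfunction_def right_diff_distrib intro!: continuous_intros)
qed

lemma eigenfunction_combination:
  assumes f: "cont f" and v: "eigenfunction f \<sigma> v" and e: "\<And>i::nat. i < r \<Longrightarrow> eigenfunction f \<sigma> (e i)"
  shows "eigenfunction f \<sigma> (\<lambda>x. v x - (\<Sum>i<r. c i * e i x))"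
  using e
proof (induct r)
  case (Suc r)
  have "eigenfunction f \<sigma> (\<lambda>x. (v x - (\<Sum>i<r. c i * e i x)) - c r * e r x)"
    by (rule eigenfunction_diff[OF f Suc.hyps eigenfunction_cmul[OF f]]) (use Suc.prems in auto)
  then show ?case by (simp add: algebra_simps)
qed (use v in simp)

lemma eigenfunction_right_translate:
  assumes f: "cont f" and v: "eigenfunction f \<sigma> v" and a: "a \<in> carrier G"
  shows "eigenfunction f \<sigma> (\<lambda>x. v (x \<otimes> a))"
proof -
  note v' = eigenfunction_cont[OF v]
  have "conv_adj f (conv f (\<lambda>x. v (x \<otimes> a))) x = \<sigma> * v (x \<otimes> a)" if x: "x \<in> carrier G" for x
  proof -
    have "conv_adj f (conv f (\<lambda>x. v (x \<otimes> a))) x = conv_adj f (\<lambda>g. conv f v (inv a \<otimes> g)) x"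
      by (rule conv_adj_cong) (rule conv_right_translate[OF f v' a])
    also have "\<dots> = conv_adj f (conv f v) (x \<otimes> a)"
      by (rule conv_adj_left_translate[OF f cont_conv[OF f v'] a x])
    finally show ?thesis using v x a by (simp add: eigenfunction_def)
  qed
  then show ?thesis using cont_right[OF v' a] by (simp add: eigenfunction_def)
qed

text \<open>A Hilbert-Schmidt estimate. The left-hand side is the sum of the squared norms of the
  \<open>conv f (e i)\<close>, and at each point \<open>g\<close> Bessel's inequality for
  \<open>y \<mapsto> f (y \<otimes> g)\<close> bounds the sum of their squares by
  \<open>ip f f\<close>. Eigenspaces for positive \<open>\<sigma>\<close> are therefore
  finite-dimensional.\<close>

lemma orthonormal_eigenfunctions_bound:
  assumes f: "cont f" and e: "orthonormal r e" and eig: "\<And>i. i < r \<Longrightarrow> eigenfunction f \<sigma> (e i)"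
  shows "real r * \<sigma> \<le> ip f f"
proof -
  have c: "cont (e i)" if "i < r" for i using e that by (simp add: orthonormal_def)
  have "\<sigma> = mean (\<lambda>g. (conv f (e i) g)\<^sup>2)" if i: "i < r" for i
  proof -
    have "mean (\<lambda>g. (conv f (e i) g)\<^sup>2) = ip (e i) (conv_adj f (conv f (e i)))"
      using ip_conv[OF f c[OF i] cont_conv[OF f c[OF i]]] by (simp add: ip_def power2_eq_square)
    also have "\<dots> = ip (e i) (\<lambda>x. \<sigma> * e i x)"
      by (rule ip_cong) (use eig[OF i] in \<open>simp_all add: eigenfunction_def\<close>)
    also have "\<dots> = \<sigma>" using ip_cmul_right[OF c[OF i] c[OF i]] e i by (simp add: orthonormal_def)
    finally show ?thesis by simp
  qed
  then have "(\<Sum>i<r. \<sigma>) = (\<Sum>i<r. mean (\<lambda>g. (conv f (e i) g)\<^sup>2))"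
    by (intro sum.cong) auto
  then have "real r * \<sigma> = (\<Sum>i<r. mean (\<lambda>g. (conv f (e i) g)\<^sup>2))" by simp
  also have "\<dots> = mean (\<lambda>g. \<Sum>i<r. (conv f (e i) g)\<^sup>2)"
    by (rule mean_sum[symmetric]) (use c cont_conv[OF f] in \<open>auto intro!: continuous_intros\<close>)
  also have "\<dots> \<le> mean (\<lambda>_. ip f f)"
  proof (rule mean_mono)
    show "cont (\<lambda>g. \<Sum>i<r. (conv f (e i) g)\<^sup>2)"
      using c cont_conv[OF f] by (auto intro!: continuous_intros)
    fix g assume g: "g \<in> carrier G"
    let ?w = "\<lambda>y. f (y \<otimes> g)"
    have "(\<Sum>i<r. (conv f (e i) g)\<^sup>2) = (\<Sum>i<r. (ip ?w (e i))\<^sup>2)"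
      by (simp add: conv_eq_ip ip_commute)
    also have "\<dots> \<le> ip ?w ?w" by (rule Bessel[OF e cont_right[OF f g]])
    also have "\<dots> = ip f f"
      unfolding ip_def using mean_right[of "\<lambda>y. f y * f y" g] f g by (simp add: continuous_map_real_mult)
    finally show "(\<Sum>i<r. (conv f (e i) g)\<^sup>2) \<le> ip f f" .
  qed simp
  finally show ?thesis by simp
qed

text \<open>By the preceding bound there is an orthonormal system of maximal length. It spans the
  eigenspace, since a nonzero residual could be normalized and appended.\<close>

lemma eigenspace_orthonormal_basis:
  assumes f: "cont f" and \<sigma>: "\<sigma> > 0"
  shows "\<exists>r e. orthonormal r e \<and> (\<forall>i<r. eigenfunction f \<sigma> (e i)) \<and>
    (\<forall>v. eigenfunction f \<sigma> v \<longrightarrow> (\<forall>x\<in>carrier G. v x = proj r e v x))"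
proof -
  define P where "P r \<longleftrightarrow> (\<exists>e. orthonormal r e \<and> (\<forall>i<r. eigenfunction f \<sigma> (e i)))" for r
  have "r \<le> nat \<lfloor>ip f f / \<sigma>\<rfloor>" if "P r" for r
  proof -
    have "real r * \<sigma> \<le> ip f f" using that orthonormal_eigenfunctions_bound[OF f] unfolding P_def by blast
    then have "real r \<le> ip f f / \<sigma>" using \<sigma> by (simp add: field_simps)
    then show ?thesis by (simp add: le_nat_iff le_floor_iff)
  qed
  moreover have "P 0" by (simp add: P_def orthonormal_def)
  ultimately have "\<exists>r. P r \<and> (\<forall>r'. P r' \<longrightarrow> r' \<le> r)" by (metis GreatestI_nat Greatest_le_nat)
  then obtain r where r: "P r" "\<And>r'. P r' \<Longrightarrow> r' \<le> r" by blast
  then obtain e where e: "orthonormal r e" "\<And>i. i < r \<Longrightarrow> eigenfunction f \<sigma> (e i)" unfolding P_def by blast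
  have "v x = proj r e v x" if v: "eigenfunction f \<sigma> v" and x: "x \<in> carrier G" for v x
  proof (rule ccontr)
    assume neq: "v x \<noteq> proj r e v x"
    define d where "d y = v y - proj r e v y" for y
    have d: "eigenfunction f \<sigma> d"
      unfolding d_def[abs_def] proj_def by (rule eigenfunction_combination[OF f v e(2)])
    note dc = eigenfunction_cont[OF d]
    have pos: "ip d d > 0"
      using ip_nonneg[OF dc] ip_eq_0[OF dc _ x] neq by (fastforce simp: d_def)
    define s where "s = 1 / sqrt (ip d d)"
    define e' where "e' i = (if i < r then e i else (\<lambda>y. s * d y))" for i
    have sd: "cont (\<lambda>y. s * d y)" using dc by (intro continuous_intros)
    have ei: "cont (e i)" if "i < r" for i using e(1) that by (simp add: orthonormal_def)
    have zero: "ip (\<lambda>y. s * d y) (e i) = 0" if "i < r" for i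
      using ip_cmul_left[OF dc ei[OF that]] ip_residual(1)[OF e(1) eigenfunction_cont[OF v] that]
      by (simp add: d_def[abs_def])
    then have zero': "ip (e i) (\<lambda>y. s * d y) = 0" if "i < r" for i
      using that by (simp add: ip_commute[of "e i"])
    have "ip (\<lambda>y. s * d y) (\<lambda>y. s * d y) = s * s * ip d d"
      using ip_cmul_left[OF dc sd] ip_cmul_right[OF dc dc] by simp
    also have "\<dots> = 1" using pos by (simp add: s_def)
    finally have one: "ip (\<lambda>y. s * d y) (\<lambda>y. s * d y) = 1" .
    have "orthonormal (Suc r) e'"
      using e(1) sd zero zero' one by (auto simp: orthonormal_def e'_def less_Suc_eq)
    moreover have "eigenfunction f \<sigma> (e' i)" for i
      using e(2) eigenfunction_cmul[OF f d] by (simp add: e'_def)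
    ultimately have "P (Suc r)" unfolding P_def by blast
    from r(2)[OF this] show False by simp
  qed
  with e show ?thesis by blast
qed

text \<open>An eigenvector of the matrix of the translation gives a complex eigenfunction on the
  group, which is nonzero because the \<open>e j\<close> are orthonormal. So \<open>rational\<close>
  applies to every eigenvalue, and the trace is the sum of the eigenvalues.\<close>

lemma trace_sum_of_roots_of_unity:
  assumes e: "orthonormal r e" and a: "a \<in> carrier G"
    and span: "\<And>j x. j < r \<Longrightarrow> x \<in> carrier G \<Longrightarrow> e j (x \<otimes> a) = proj r e (\<lambda>x. e j (x \<otimes> a)) x"
    and rational: "\<And>\<phi> \<mu> x0. continuous_map T euclidean (\<phi> :: 'a \<Rightarrow> complex) \<Longrightarrow> x0 \<in> carrier G \<Longrightarrow> \<phi> x0 \<noteq> 0 \<Longrightarrow>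
      (\<And>x. x \<in> carrier G \<Longrightarrow> \<phi> (x \<otimes> a) = \<mu> * \<phi> x) \<Longrightarrow> \<exists>k::nat. k > 0 \<and> \<mu> ^ k = 1"
  shows "complex_of_real (\<Sum>i<r. ip (\<lambda>x. e i (x \<otimes> a)) (e i))
    \<in> sum_list ` lists {z::complex. \<exists>k::nat. k > 0 \<and> z ^ k = 1}"
proof -
  define A where "A i j = complex_of_real (ip (\<lambda>x. e j (x \<otimes> a)) (e i))" for i j
  have ei: "cont (e i)" if "i < r" for i using e that by (simp add: orthonormal_def)
  obtain es where es: "(\<Sum>i<r. A i i) = sum_list es"
    and ev: "\<And>\<mu>. \<mu> \<in> set es \<Longrightarrow> \<exists>c. (\<exists>i<r. c i \<noteq> 0) \<and> (\<forall>i<r. (\<Sum>j<r. A i j * c j) = \<mu> * c i)"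
    using complex_matrix_trace_eigenvalues[where A = A and n = r] by blast
  have "\<exists>k::nat. k > 0 \<and> \<mu> ^ k = 1" if \<mu>: "\<mu> \<in> set es" for \<mu>
  proof -
    obtain c i0 where i0: "i0 < r" "c i0 \<noteq> 0" and c: "\<And>i. i < r \<Longrightarrow> (\<Sum>j<r. A i j * c j) = \<mu> * c i"
      using ev[OF \<mu>] by blast
    define \<phi> where "\<phi> x = (\<Sum>j<r. e j x *\<^sub>R c j)" for x
    have \<phi>c: "continuous_map T euclidean \<phi>"
      unfolding \<phi>_def by (intro continuous_map_sum continuous_map_scaleR_euclidean) (use ei in auto)
    have eig: "\<phi> (x \<otimes> a) = \<mu> * \<phi> x" if x: "x \<in> carrier G" for x
    proof -
      have "\<phi> (x \<otimes> a) = (\<Sum>j<r. \<Sum>i<r. (A i j * c j) * complex_of_real (e i x))"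
        unfolding \<phi>_def
        by (intro sum.cong refl)
          (simp add: span[OF _ x] proj_def scaleR_conv_of_real A_def sum_distrib_right sum_distrib_left mult_ac)
      also have "\<dots> = (\<Sum>i<r. \<Sum>j<r. (A i j * c j) * complex_of_real (e i x))"
        by (rule sum.swap)
      also have "\<dots> = (\<Sum>i<r. (\<mu> * c i) * complex_of_real (e i x))"
        by (intro sum.cong refl) (simp add: c[symmetric] sum_distrib_right)
      finally show ?thesis by (simp add: \<phi>_def scaleR_conv_of_real sum_distrib_left mult_ac)
    qed
    have "\<exists>x0\<in>carrier G. \<phi> x0 \<noteq> 0"
    proof (rule ccontr)
      assume "\<not> ?thesis"
      then have z: "\<phi> x = 0" if "x \<in> carrier G" for x using that by blast
      have "Re (\<phi> x) = (\<Sum>j<r. Re (c j) * e j x)" "Im (\<phi> x) = (\<Sum>j<r. Im (c j) * e j x)" for x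
        by (simp_all add: \<phi>_def mult.commute)
      then have "(\<Sum>j<r. Re (c j) * e j x) = 0" "(\<Sum>j<r. Im (c j) * e j x) = 0" if "x \<in> carrier G" for x
        using z[OF that] by (metis zero_complex.simps(1), metis zero_complex.simps(2))
      then have "ip (\<lambda>x. \<Sum>j<r. Re (c j) * e j x) (e i0) = ip (\<lambda>_. 0) (e i0)"
        "ip (\<lambda>x. \<Sum>j<r. Im (c j) * e j x) (e i0) = ip (\<lambda>_. 0) (e i0)"
        by (intro ip_cong; simp)+
      then have "Re (c i0) = 0" "Im (c i0) = 0"
        using orthonormal_coeff[OF e i0(1)] by (simp_all add: ip_def)
      then show False using i0(2) by (simp add: complex_eq_iff)
    qed
    then obtain x0 where "x0 \<in> carrier G" "\<phi> x0 \<noteq> 0" by blast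
    from rational[OF \<phi>c this eig] show ?thesis .
  qed
  then have "es \<in> lists {z::complex. \<exists>k::nat. k > 0 \<and> z ^ k = 1}" by auto
  moreover have "complex_of_real (\<Sum>i<r. ip (\<lambda>x. e i (x \<otimes> a)) (e i)) = sum_list es"
    using es by (simp add: A_def)
  ultimately show ?thesis by (rule image_eqI[rotated])
qed

text \<open>Translation preserves norms, so each diagonal entry is at most 1. The trace
  \<open>r\<close> forces all of them to be 1, the equality case of the Cauchy-Schwarz
  inequality.\<close>

lemma translation_invariant_of_trace:
  assumes e: "orthonormal r e" and a: "a \<in> carrier G"
    and tr: "(\<Sum>i<r. ip (\<lambda>x. e i (x \<otimes> a)) (e i)) = real r"
    and i: "i < r" and x: "x \<in> carrier G"
  shows "e i (x \<otimes> a) = e i x"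
proof -
  let ?R = "\<lambda>i x. e i (x \<otimes> a)"
  have ec: "cont (e i)" if "i < r" for i using e that by (simp add: orthonormal_def)
  have Rc: "cont (?R i)" if "i < r" for i by (rule cont_right[OF ec[OF that] a])
  have ee: "ip (e i) (e i) = 1" if "i < r" for i using e that by (simp add: orthonormal_def)
  have RR: "ip (?R i) (?R i) = 1" if "i < r" for i
    using mean_right[OF continuous_map_real_mult[OF ec[OF that] ec[OF that]] a] ee[OF that] by (simp add: ip_def)
  have le: "ip (?R i) (e i) \<le> 1" if "i < r" for i
    using ip_Cauchy_Schwarz[OF Rc[OF that] ec[OF that]] RR[OF that] ee[OF that]
    by (simp add: power2_le_iff_abs_le abs_square_le_1)
  have "(\<Sum>i<r. ip (?R i) (e i)) = (\<Sum>i<r. 1)" using tr by simp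
  then have Re: "ip (?R i) (e i) = 1"
    by (rule sum_mono_inv) (use le i in auto)
  have d: "cont (\<lambda>x. ?R i x - e i x)" by (rule continuous_map_diff[OF Rc[OF i] ec[OF i]])
  have "ip (\<lambda>x. ?R i x - e i x) (\<lambda>x. ?R i x - e i x) = 0"
    using ip_diff_left[OF Rc[OF i] ec[OF i] d] ip_diff_right[OF Rc[OF i] ec[OF i] Rc[OF i]]
      ip_diff_right[OF Rc[OF i] ec[OF i] ec[OF i]] Re RR[OF i] ee[OF i] ip_commute[of "e i" "?R i"] by simp
  from ip_eq_0[OF d this x] show ?thesis by simp
qed

lemma connected_component_trivial:
  assumes rational: "\<And>\<phi> \<mu> x0 a. continuous_map T euclidean (\<phi> :: 'a \<Rightarrow> complex) \<Longrightarrow> x0 \<in> carrier G \<Longrightarrow> \<phi> x0 \<noteq> 0 \<Longrightarrow>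
      a \<in> carrier G \<Longrightarrow> (\<And>x. x \<in> carrier G \<Longrightarrow> \<phi> (x \<otimes> a) = \<mu> * \<phi> x) \<Longrightarrow> \<exists>k::nat. k > 0 \<and> \<mu> ^ k = 1"
    and h: "h \<in> connected_component_of_set T \<one>"
  shows "h = \<one>"
proof (rule ccontr)
  assume nontriv: "h \<noteq> \<one>"
  define C where "C = connected_component_of_set T \<one>"
  have Cc: "connectedin T C" unfolding C_def by (rule connectedin_connected_component_of)
  have C1: "\<one> \<in> C" by (simp add: C_def connected_component_of_refl topspace_eq)
  have CG: "C \<subseteq> carrier G" using connectedin_subset_topspace[OF Cc] topspace_eq by simp
  have hC: "h \<in> C" using h by (simp add: C_def)
  have hG: "h \<in> carrier G" using hC CG by blast
  have "closedin T {h}" using hG Hausdorff topspace_eq by (simp add: closedin_Hausdorff_singleton)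
  then obtain \<psi> where \<psi>: "continuous_map T (top_of_set {0..1::real}) \<psi>" "\<psi> \<one> = 0" "\<psi> ` {h} \<subseteq> {1}"
    using completely_regular nontriv unfolding completely_regular_space_def topspace_eq
    by (metis (no_types, lifting) Diff_iff one_closed singletonD)
  have \<psi>c: "cont \<psi>" by (rule continuous_map_into_fulltopology[OF \<psi>(1)])
  \<comment> \<open>If \<open>v\<close> is invariant under left translation by \<open>h\<close>, the
    two halves of the difference contribute equally to \<open>conv f v\<close>, which therefore
    vanishes. At the identity \<open>f\<close> is nonzero because \<open>\<psi>\<close> separates it
    from \<open>h\<close>.\<close>
  define f where "f x = \<psi> x - \<psi> (h \<otimes> x)" for x
  have f: "cont f" unfolding f_def by (intro continuous_map_diff cont_left \<psi>c hG)
  have f1: "f \<one> \<noteq> 0" using \<psi> hG by (simp add: f_def)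
  obtain v \<sigma> y where v: "cont v" "\<sigma> > 0" "y \<in> carrier G" "v y \<noteq> 0"
    "\<And>x. x \<in> carrier G \<Longrightarrow> conv_adj f (conv f v) x = \<sigma> * v x"
    by (rule conv_top_eigenfunction[OF f one_closed f1]) blast
  then have veig: "eigenfunction f \<sigma> v" by (simp add: eigenfunction_def)
  obtain r e where e: "orthonormal r e" "\<And>i. i < r \<Longrightarrow> eigenfunction f \<sigma> (e i)"
    and span: "\<And>v x. eigenfunction f \<sigma> v \<Longrightarrow> x \<in> carrier G \<Longrightarrow> v x = proj r e v x"
    using eigenspace_orthonormal_basis[OF f v(2)] by blast
  have ec: "cont (e i)" if "i < r" for i using e(1) that by (simp add: orthonormal_def)
  define \<tau> where "\<tau> a = (\<Sum>i<r. ip (\<lambda>x. e i (x \<otimes> a)) (e i))" for a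
  have \<tau>c: "cont \<tau>"
    unfolding \<tau>_def
  proof (intro continuous_map_sum finite_lessThan)
    fix i assume i: "i \<in> {..<r}"
    then have "continuous_map (prod_topology T T) euclideanreal (\<lambda>p. e i (snd p \<otimes> fst p) * e i (snd p))"
      by (intro continuous_map_real_mult continuous_map_compose_app[OF continuous_map_snd ec]
        continuous_map_compose_app[OF continuous_mult_of[OF continuous_map_snd continuous_map_fst] ec]) auto
    from continuous_mean[OF this] show "cont (\<lambda>a. ip (\<lambda>x. e i (x \<otimes> a)) (e i))" by (simp add: ip_def)
  qed
  have "complex_of_real ` \<tau> ` C \<subseteq> sum_list ` lists {z::complex. \<exists>k::nat. k > 0 \<and> z ^ k = 1}"
  proof -
    have "complex_of_real (\<tau> a) \<in> sum_list ` lists {z::complex. \<exists>k::nat. k > 0 \<and> z ^ k = 1}" if "a \<in> C" for a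
      unfolding \<tau>_def
    proof (rule trace_sum_of_roots_of_unity[OF e(1)])
      show aG: "a \<in> carrier G" using that CG by blast
      show "e j (x \<otimes> a) = proj r e (\<lambda>x. e j (x \<otimes> a)) x" if "j < r" "x \<in> carrier G" for j x
        by (rule span[OF eigenfunction_right_translate[OF f e(2)[OF that(1)] aG] that(2)])
      show "\<exists>k::nat. k > 0 \<and> \<mu> ^ k = 1" if "continuous_map T euclidean (\<phi> :: 'a \<Rightarrow> complex)" "x0 \<in> carrier G"
        "\<phi> x0 \<noteq> 0" "\<And>x. x \<in> carrier G \<Longrightarrow> \<phi> (x \<otimes> a) = \<mu> * \<phi> x" for \<phi> \<mu> x0
        by (rule rational[OF that(1-3) aG that(4)])
    qed
    then show ?thesis by blast
  qed
  then have "countable (complex_of_real ` \<tau> ` C)"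
    by (rule countable_subset[OF _ countable_sums_of_roots_of_unity])
  then have "countable (\<tau> ` C)" by (rule countable_image_inj_on) (simp add: inj_on_def)
  moreover have "connected (\<tau> ` C)" using connectedin_continuous_map_image[OF \<tau>c Cc] by simp
  ultimately have "\<tau> a = \<tau> \<one>" if "a \<in> C" for a
    using connected_uncountable[of "\<tau> ` C"] that C1 by blast
  moreover have "\<tau> \<one> = real r"
  proof -
    have "ip (\<lambda>x. e i (x \<otimes> \<one>)) (e i) = ip (e i) (e i)" for i by (rule ip_cong) simp_all
    then show ?thesis using e(1) by (simp add: \<tau>_def orthonormal_def)
  qed
  ultimately have tr: "\<tau> a = real r" if "a \<in> C" for a using that by simp
  have inv_e: "e i (x \<otimes> a) = e i x" if "i < r" "a \<in> C" "x \<in> carrier G" for i a x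
    using translation_invariant_of_trace[OF e(1) _ tr[OF that(2), unfolded \<tau>_def] that(1,3)] that(2) CG by blast
  have inv_v: "v (x \<otimes> a) = v x" if a: "a \<in> C" and x: "x \<in> carrier G" for a x
  proof -
    have "x \<otimes> a \<in> carrier G" using a x CG by blast
    then have "v (x \<otimes> a) = proj r e v (x \<otimes> a)" by (rule span[OF veig])
    also have "\<dots> = proj r e v x" using inv_e[OF _ a x] by (simp add: proj_def)
    also have "\<dots> = v x" by (rule span[OF veig x, symmetric])
    finally show ?thesis .
  qed
  \<comment> \<open>The identity component is normal, so
    \<open>inv y \<otimes> (h \<otimes> y)\<close> lies in \<open>C\<close>, and right invariance
    under \<open>C\<close> becomes left invariance under \<open>h\<close>.\<close>
  have left_v: "v (h \<otimes> y) = v y" if y: "y \<in> carrier G" for y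
  proof -
    let ?c = "\<lambda>x. inv y \<otimes> (x \<otimes> y)"
    have cc: "continuous_map T T ?c"
      by (rule continuous_map_compose_app[OF continuous_right_mult[OF y] continuous_left_mult]) (use y in simp)
    have "connectedin T (?c ` C)" by (rule connectedin_continuous_map_image[OF cc Cc])
    moreover have "\<one> \<in> ?c ` C" using C1 y by (intro image_eqI[of _ _ \<one>]) simp_all
    ultimately have "?c ` C \<subseteq> C" unfolding C_def by (rule connected_component_of_maximal)
    then have "inv y \<otimes> (h \<otimes> y) \<in> C" using hC by blast
    from inv_v[OF this y] show ?thesis using y hG by (simp add: inv_solve_left' m_assoc[symmetric])
  qed
  have "conv f v g = 0" if g: "g \<in> carrier G" for g
  proof -
    have w: "cont (\<lambda>y. v y * \<psi> (y \<otimes> g))" by (intro continuous_map_real_mult v(1) cont_right \<psi>c g)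
    have "conv f v g = mean (\<lambda>y. v y * \<psi> (y \<otimes> g) - v (h \<otimes> y) * \<psi> (h \<otimes> y \<otimes> g))"
      unfolding conv_def by (rule mean_cong) (simp add: f_def left_v m_assoc hG g right_diff_distrib)
    also have "\<dots> = mean (\<lambda>y. v y * \<psi> (y \<otimes> g)) - mean (\<lambda>y. v (h \<otimes> y) * \<psi> (h \<otimes> y \<otimes> g))"
      by (rule mean_diff[OF w cont_left[OF w hG]])
    also have "\<dots> = 0" using mean_left[OF w hG] by simp
    finally show ?thesis .
  qed
  then have "conv_adj f (conv f v) y = conv_adj f (\<lambda>_. 0) y" by (rule conv_adj_cong)
  then show False using v(2-5) by (simp add: conv_adj_def)
qed

end

section \<open>Free abelian subgroups of torsion-free groups\<close>

context compact_topological_group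
begin

text \<open>The double centralizer of \<open>g\<close> is abelian, closed and infinite, so it is uncountable by the
  Baire category theorem.\<close>

lemma uncountable_abelian_subgroup:
  assumes g: "g \<in> carrier G" and tf: "\<And>q::nat. q > 0 \<Longrightarrow> g [^] q \<noteq> \<one>"
  shows "\<exists>A. subgroup A G \<and> (\<forall>x\<in>A. \<forall>y\<in>A. x \<otimes> y = y \<otimes> x) \<and> uncountable A"
proof -
  define Z where "Z = {y \<in> carrier G. y \<otimes> g = g \<otimes> y}"
  define A where "A = {x \<in> carrier G. \<forall>y\<in>Z. x \<otimes> y = y \<otimes> x}"
  have ZG: "y \<in> carrier G" if "y \<in> Z" for y using that by (simp add: Z_def)
  have AG: "x \<in> carrier G" if "x \<in> A" for x using that by (simp add: A_def)
  have AZ: "x \<otimes> y = y \<otimes> x" if "x \<in> A" "y \<in> Z" for x y using that by (simp add: A_def)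
  have gZ: "g \<in> Z" using g by (simp add: Z_def)
  have gA: "g \<in> A" using g by (auto simp: A_def Z_def)
  have "A \<subseteq> Z" using AG AZ[OF _ gZ] by (auto simp: Z_def)
  then have comm: "x \<otimes> y = y \<otimes> x" if "x \<in> A" "y \<in> A" for x y using AZ that by blast
  have sub: "subgroup A G"
  proof (rule subgroup.intro)
    show "A \<subseteq> carrier G" using AG by blast
    show "x \<otimes> y \<in> A" if "x \<in> A" "y \<in> A" for x y
    proof -
      have "x \<otimes> y \<otimes> z = z \<otimes> (x \<otimes> y)" if z: "z \<in> Z" for z
      proof -
        have "x \<otimes> y \<otimes> z = x \<otimes> (z \<otimes> y)" using AZ[OF \<open>y \<in> A\<close> z] AG that ZG z \<open>x \<in> A\<close> \<open>y \<in> A\<close> by (simp add: m_assoc)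
        also have "\<dots> = x \<otimes> z \<otimes> y" using AG ZG z \<open>x \<in> A\<close> \<open>y \<in> A\<close> by (simp add: m_assoc)
        also have "\<dots> = z \<otimes> (x \<otimes> y)" using AZ[OF \<open>x \<in> A\<close> z] AG ZG z \<open>x \<in> A\<close> \<open>y \<in> A\<close> by (simp add: m_assoc)
        finally show ?thesis .
      qed
      then show ?thesis using AG that by (simp add: A_def)
    qed
    show "\<one> \<in> A" using ZG by (simp add: A_def)
    show "inv x \<in> A" if "x \<in> A" for x
    proof -
      have "inv x \<otimes> z = z \<otimes> inv x" if z: "z \<in> Z" for z
      proof -
        have "inv x \<otimes> z = inv x \<otimes> (z \<otimes> x) \<otimes> inv x" using AG[OF \<open>x \<in> A\<close>] ZG[OF z] by (simp add: m_assoc)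
        also have "\<dots> = inv x \<otimes> (x \<otimes> z) \<otimes> inv x" using AZ[OF \<open>x \<in> A\<close> z] by simp
        also have "\<dots> = z \<otimes> inv x" using AG[OF \<open>x \<in> A\<close>] ZG[OF z] by (simp add: m_assoc[symmetric])
        finally show ?thesis .
      qed
      then show ?thesis using AG that by (simp add: A_def)
    qed
  qed
  have "closedin T (\<Inter>y\<in>Z. {x \<in> topspace T. x \<otimes> y = y \<otimes> x})"
    using gZ ZG by (intro closedin_INT closedin_continuous_maps_eq[OF Hausdorff] continuous_right_mult continuous_left_mult) auto
  moreover have "(\<Inter>y\<in>Z. {x \<in> topspace T. x \<otimes> y = y \<otimes> x}) = A"
    using gZ by (auto simp: A_def topspace_eq)
  ultimately have closed: "closedin T A" by simp
  define X where "X = subtopology T A"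
  have tX: "topspace X = A" using AG by (auto simp: X_def topspace_eq)
  have cX: "compact_space X"
    unfolding X_def by (intro compact_space_subtopology closedin_compact_space[OF compact closed])
  have hX: "Hausdorff_space X" unfolding X_def by (rule Hausdorff_space_subtopology[OF Hausdorff])
  have pow: "g [^] i \<in> A" for i :: nat
  proof (induction i)
    case (Suc i) then show ?case using gA subgroup.m_closed[OF sub] by simp
  qed (use subgroup.one_closed[OF sub] in simp)
  have "inj (\<lambda>i::nat. g [^] i)"
  proof (rule linorder_injI)
    fix i j :: nat assume ij: "i < j"
    then have *: "g [^] j = g [^] i \<otimes> g [^] (j - i)" using g by (simp add: nat_pow_mult)
    have **: "g [^] (j - i) \<noteq> \<one>" by (rule tf) (use ij in simp)
        show "g [^] i \<noteq> g [^] j"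
    proof
      assume "g [^] i = g [^] j"
      then have "g [^] i \<otimes> g [^] (j - i) = g [^] i" using * by simp
      then have "g [^] (j - i) = \<one>" using l_cancel_one[of "g [^] i" "g [^] (j - i)"] g nat_pow_closed by blast
      then show False using ** by contradiction
    qed
  qed
  then have inf: "infinite A"
    using pow finite_subset[of "range (\<lambda>i::nat. g [^] i)" A] finite_imageD[of "\<lambda>i::nat. g [^] i" UNIV] by auto
  have "uncountable A"
  proof
    assume "countable A"
    \<comment> \<open>By the Baire property a countable \<open>A\<close> has an isolated point.
      Translation then isolates all its points, and a compact discrete group is finite, against the
      infinitely many powers of \<open>g\<close>.\<close>
    have "\<exists>a\<in>A. X interior_of {a} \<noteq> {}"
    proof (rule ccontr)
      assume c: "\<not> ?thesis"
      have "X interior_of \<Union>((\<lambda>a. {a}) ` A) = {}"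
      proof (rule Baire_category_alt)
        show "completely_metrizable_space X \<or> locally_compact_space X \<and> regular_space X"
          using cX hX compact_imp_locally_compact_space compact_Hausdorff_imp_regular_space by blast
        show "countable ((\<lambda>a. {a}) ` A)" using \<open>countable A\<close> by simp
        show "closedin X S \<and> X interior_of S = {}" if "S \<in> (\<lambda>a. {a}) ` A" for S
          using that c closedin_Hausdorff_singleton[OF hX] tX by auto
      qed
      moreover have "\<Union>((\<lambda>a. {a}) ` A) = topspace X" using tX by auto
      ultimately show False using interior_of_topspace[of X] gA tX by auto
    qed
    then obtain a where a: "a \<in> A" "X interior_of {a} \<noteq> {}" by blast
    have "X interior_of {a} \<subseteq> {a}" by (rule interior_of_subset)
    then have "X interior_of {a} = {a}" using a(2) by blast
    then have "openin X {a}" using openin_interior_of[of X "{a}"] by simp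
    then obtain U where U: "openin T U" "{a} = U \<inter> A"
      unfolding X_def openin_subtopology by blast
    have "openin X {b}" if b: "b \<in> A" for b
    proof -
      have c: "a \<otimes> inv b \<in> A" using a(1) b sub by (simp add: subgroup.m_closed subgroup.m_inv_closed)
      have "{x \<in> topspace T. a \<otimes> inv b \<otimes> x \<in> U} \<inter> A = {b}"
      proof
        show "{b} \<subseteq> {x \<in> topspace T. a \<otimes> inv b \<otimes> x \<in> U} \<inter> A"
          using U(2) b AG[OF a(1)] AG[OF b] by (auto simp: topspace_eq m_assoc)
        show "{x \<in> topspace T. a \<otimes> inv b \<otimes> x \<in> U} \<inter> A \<subseteq> {b}"
        proof
          fix x assume x: "x \<in> {x \<in> topspace T. a \<otimes> inv b \<otimes> x \<in> U} \<inter> A"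
          then have "a \<otimes> inv b \<otimes> x \<in> U \<inter> A" using c subgroup.m_closed[OF sub c] by blast
          then have "a \<otimes> inv b \<otimes> x = a" using U(2) by blast
          then have "inv b \<otimes> x = \<one>" using AG[OF a(1)] AG[OF b] AG[of x] x by (simp add: m_assoc)
          then show "x \<in> {b}" using AG[OF b] AG[of x] x by (simp add: inv_solve_left')
        qed
      qed
      moreover have "openin T {x \<in> topspace T. a \<otimes> inv b \<otimes> x \<in> U}"
        by (rule openin_continuous_map_preimage[OF continuous_left_mult[OF AG[OF c]] U(1)])
      ultimately show ?thesis unfolding X_def openin_subtopology by blast
    qed
    then have "discrete_topology A = X" using discrete_topology_unique[of A X] tX by simp
    then show False using cX inf compact_space_discrete_topology[of A] by simp
  qed
  with sub comm show ?thesis by blast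
qed

primrec word :: "(nat \<Rightarrow> 'a) \<Rightarrow> nat \<Rightarrow> (nat \<Rightarrow> int) \<Rightarrow> 'a" where
  "word \<gamma> 0 k = \<one>"
| "word \<gamma> (Suc r) k = word \<gamma> r k \<otimes> \<gamma> r [^] k r"

lemma word_cong:
  "(\<And>i. i < r \<Longrightarrow> \<gamma> i = \<gamma>' i) \<Longrightarrow> (\<And>i. i < r \<Longrightarrow> k i = k' i) \<Longrightarrow> word \<gamma> r k = word \<gamma>' r k'"
  by (induction r) simp_all

lemma countable_words: "countable (range (word \<gamma> r))"
proof (induction r)
  case (Suc r)
  have "range (word \<gamma> (Suc r)) \<subseteq> (\<lambda>(x, j::int). x \<otimes> \<gamma> r [^] j) ` (range (word \<gamma> r) \<times> UNIV)"
    by (auto intro!: image_eqI[where x = "(word \<gamma> r k, k r)" for k])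
  moreover have "countable ((\<lambda>(x, j::int). x \<otimes> \<gamma> r [^] j) ` (range (word \<gamma> r) \<times> UNIV))"
    by (intro countable_image countable_SIGMA Suc.IH countableI_type)
  ultimately show ?case by (rule countable_subset)
next
  case 0
  have "range (word \<gamma> 0) \<subseteq> {\<one>}" by auto
  then show ?case by (rule countable_subset) simp
qed

context
  fixes A assumes sub: "subgroup A G" and comm: "\<forall>x\<in>A. \<forall>y\<in>A. x \<otimes> y = y \<otimes> x"
begin

lemma commD: "x \<in> A \<Longrightarrow> y \<in> A \<Longrightarrow> x \<otimes> y = y \<otimes> x"
  using comm by blast

lemma subG: "x \<in> A \<Longrightarrow> x \<in> carrier G"
  using subgroup.subset[OF sub] by blast

lemma word_in: "(\<And>i. i < r \<Longrightarrow> \<gamma> i \<in> A) \<Longrightarrow> word \<gamma> r k \<in> A"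
  by (induction r) (simp_all add: subgroup.one_closed[OF sub] subgroup.m_closed[OF sub] subgroup_int_pow_closed[OF sub])

lemma word_add:
  "(\<And>i. i < r \<Longrightarrow> \<gamma> i \<in> A) \<Longrightarrow> word \<gamma> r (\<lambda>i. k i + l i) = word \<gamma> r k \<otimes> word \<gamma> r l"
proof (induction r)
  case (Suc r)
  let ?a = "word \<gamma> r k" and ?b = "word \<gamma> r l" and ?c = "\<gamma> r [^] k r" and ?d = "\<gamma> r [^] l r"
  have A: "?a \<in> A" "?b \<in> A" "?c \<in> A" "?d \<in> A"
    using Suc.prems word_in[of r] subgroup_int_pow_closed[OF sub] by auto
  have "?a \<otimes> ?b \<otimes> (?c \<otimes> ?d) = ?a \<otimes> (?b \<otimes> ?c) \<otimes> ?d" using A subG by (simp add: m_assoc)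
  also have "\<dots> = ?a \<otimes> ?c \<otimes> (?b \<otimes> ?d)" unfolding commD[OF A(2,3)] using A subG by (simp add: m_assoc)
  finally show ?case using Suc subG by (simp add: int_pow_mult)
qed simp

lemma word_zero: "(\<And>i. i < r \<Longrightarrow> k i = 0) \<Longrightarrow> word \<gamma> r k = \<one>"
  by (induction r) simp_all

lemma word_uminus:
  assumes "\<And>i. i < r \<Longrightarrow> \<gamma> i \<in> A"
  shows "word \<gamma> r (\<lambda>i. - k i) = inv (word \<gamma> r k)"
proof -
  have "word \<gamma> r (\<lambda>i. - k i) \<otimes> word \<gamma> r k = \<one>"
    using word_add[OF assms, where r = r and k = "\<lambda>i. - k i" and l = k] word_zero[of r "\<lambda>i. - k i + k i"] by simp
  from inv_equality[OF this] show ?thesis using subG[OF word_in[OF assms]] by simp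
qed

text \<open>In a torsion-free abelian group an element has at most one \<open>q\<close>-th root. So
  only countably many elements of \<open>A\<close> have a positive power among the words in the
  elements found so far, and any other element of \<open>A\<close> can be added.\<close>

lemma independent_family:
  assumes unc: "uncountable A" and tf: "\<And>h q. h \<in> carrier G \<Longrightarrow> h \<noteq> \<one> \<Longrightarrow> q > 0 \<Longrightarrow> h [^] (q::nat) \<noteq> \<one>"
  shows "\<exists>\<gamma>. (\<forall>i<r. \<gamma> i \<in> A) \<and> (\<forall>k. word \<gamma> r k = \<one> \<longrightarrow> (\<forall>i<r. k i = 0))"
proof (induction r)
  case (Suc r)
  then obtain \<gamma> where \<gamma>: "\<And>i. i < r \<Longrightarrow> \<gamma> i \<in> A" and ind: "\<And>k i. word \<gamma> r k = \<one> \<Longrightarrow> i < r \<Longrightarrow> k i = 0"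
    by blast
  let ?W = "range (word \<gamma> r)"
  define S where "S q w = {a \<in> A. a [^] q = w}" for q :: nat and w
  have "countable (S q w)" if q: "q > 0" for q w
  proof (cases "S q w = {}")
    case False
    then obtain a where a: "a \<in> A" "a [^] q = w" by (auto simp: S_def)
    have "b = a" if b: "b \<in> S q w" for b
    proof -
      have bA: "b \<in> A" "b [^] q = w" using b by (auto simp: S_def)
      note aG = subG[OF a(1)] and bG = subG[OF bA(1)]
      have "(b \<otimes> inv a) [^] q = b [^] q \<otimes> inv a [^] q"
        by (rule pow_mult_distrib[OF commD[OF bA(1) subgroup.m_inv_closed[OF sub a(1)]]]) (use aG bG in auto)
      also have "\<dots> = \<one>" using a(2) bA(2) aG nat_pow_closed[OF aG, of q] by (simp add: nat_pow_inv)
      finally have "b \<otimes> inv a = \<one>" using tf[of "b \<otimes> inv a" q] q aG bG by blast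
      then show ?thesis using aG bG by (simp add: inv_solve_right')
    qed
    then have "S q w \<subseteq> {a}" by blast
    then show ?thesis by (rule countable_subset) simp
  qed simp
  then have "countable (\<Union>q\<in>{0<..}. \<Union>w\<in>?W. S q w)"
    by (intro countable_UN[OF countableI_type] countable_UN[OF countable_words]) auto
  then have "\<not> A \<subseteq> (\<Union>q\<in>{0<..}. \<Union>w\<in>?W. S q w)" using unc countable_subset by blast
  then obtain a where a: "a \<in> A" "a \<notin> (\<Union>q\<in>{0<..}. \<Union>w\<in>?W. S q w)" unfolding subset_eq by blast
  have bad: "a [^] q \<noteq> word \<gamma> r k" if "q > 0" for q :: nat and k
    using a that by (auto simp: S_def)
  let ?\<gamma> = "\<gamma>(r := a)"
  have eq: "word ?\<gamma> r k = word \<gamma> r k" for k by (rule word_cong) auto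
  have indep: "\<forall>i<Suc r. k i = 0" if k: "word ?\<gamma> (Suc r) k = \<one>" for k
  proof -
    have wG: "word \<gamma> r k \<in> carrier G" and aG: "a \<in> carrier G" using subG[OF word_in[OF \<gamma>]] subG[OF a(1)] by auto
    have 1: "word \<gamma> r k \<otimes> a [^] k r = \<one>" using k by (simp add: eq)
    then have inv: "word \<gamma> r k = inv (a [^] k r)" using wG aG by (intro inv_equality[symmetric]) auto
    have "k r = 0"
    proof (rule ccontr)
      assume "k r \<noteq> 0"
      then consider "k r > 0" | "k r < 0" by linarith
      then show False
      proof cases
        assume pos: "k r > 0"
        have "a [^] nat (k r) = a [^] k r" using pos aG by (simp add: int_pow_int[symmetric])
        also have "\<dots> = word \<gamma> r (\<lambda>i. - k i)" using word_uminus[OF \<gamma>] inv aG by simp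
        finally show False using bad[of "nat (k r)" "\<lambda>i. - k i"] pos by simp
      next
        assume neg: "k r < 0"
        have "a [^] nat (- k r) = a [^] (- k r)" using neg aG by (simp add: int_pow_int[symmetric])
        also have "\<dots> = word \<gamma> r k" using inv aG by (simp add: int_pow_neg)
        finally show False using bad[of "nat (- k r)" k] neg by simp
      qed
    qed
    moreover from this have "word \<gamma> r k = \<one>" using 1 wG by simp
    ultimately show ?thesis using ind[of k] by (auto simp: less_Suc_eq)
  qed
  have "\<forall>i<Suc r. ?\<gamma> i \<in> A" using \<gamma> a(1) by (auto simp: less_Suc_eq)
  with indep show ?case by (intro exI[of _ ?\<gamma>] conjI allI[of "\<lambda>k. word ?\<gamma> (Suc r) k = \<one> \<longrightarrow> (\<forall>i<Suc r. k i = 0)"] impI)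
qed simp

text \<open>A representative is chosen in each left coset of the group generated by the
  \<open>\<gamma> i\<close>, and \<open>\<psi> j\<close> reads off the \<open>j\<close>-th exponent
  relative to it. The exponents are unique by independence; nothing is said about
  continuity.\<close>

lemma coordinates:
  assumes \<gamma>: "\<And>i. i < r \<Longrightarrow> \<gamma> i \<in> A" and ind: "\<And>k i. word \<gamma> r k = \<one> \<Longrightarrow> i < r \<Longrightarrow> k i = 0"
  shows "\<exists>\<psi>. \<forall>x\<in>carrier G. \<forall>k. \<forall>j<r. \<psi> j (x \<otimes> word \<gamma> r k) = \<psi> j x + (k j :: int)"
proof -
  let ?w = "word \<gamma> r"
  have wG: "?w k \<in> carrier G" for k by (rule subG[OF word_in[OF \<gamma>]])
  define cos where "cos x = {y \<in> carrier G. \<exists>k. x = y \<otimes> ?w k}" for x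
  define rep where "rep x = (SOME y. y \<in> cos x)" for x
  define K where "K x = (SOME k. x = rep x \<otimes> ?w k)" for x
  have cos_eq: "cos (x \<otimes> ?w k) = cos x" if x: "x \<in> carrier G" for x k
  proof -
    have "(\<exists>l. x \<otimes> ?w k = y \<otimes> ?w l) \<longleftrightarrow> (\<exists>l. x = y \<otimes> ?w l)" if y: "y \<in> carrier G" for y
    proof
      assume "\<exists>l. x \<otimes> ?w k = y \<otimes> ?w l"
      then obtain l where l: "x \<otimes> ?w k = y \<otimes> ?w l" by blast
      have "x = x \<otimes> ?w k \<otimes> inv (?w k)" using x wG by (simp add: m_assoc)
      also have "\<dots> = y \<otimes> (?w l \<otimes> ?w (\<lambda>i. - k i))" using l y wG word_uminus[OF \<gamma>, where r = r and k = k] by (simp add: m_assoc)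
      also have "\<dots> = y \<otimes> ?w (\<lambda>i. l i + - k i)" by (simp only: word_add[OF \<gamma>])
      finally show "\<exists>l. x = y \<otimes> ?w l" by blast
    next
      assume "\<exists>l. x = y \<otimes> ?w l"
      then obtain l where l: "x = y \<otimes> ?w l" by blast
      have "x \<otimes> ?w k = y \<otimes> ?w (\<lambda>i. l i + k i)" unfolding l using word_add[OF \<gamma>] y wG by (simp add: m_assoc)
      then show "\<exists>l. x \<otimes> ?w k = y \<otimes> ?w l" by blast
    qed
    then show ?thesis unfolding cos_def by blast
  qed
  have rep: "rep x \<in> carrier G" "x = rep x \<otimes> ?w (K x)" if x: "x \<in> carrier G" for x
  proof -
    have "x = x \<otimes> ?w (\<lambda>_. 0)" using word_zero[of r "\<lambda>_. 0"] x by simp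
    then have "x \<in> cos x" using x unfolding cos_def by blast
    then have "rep x \<in> cos x" unfolding rep_def by (rule someI)
    then have "rep x \<in> carrier G" and ex: "\<exists>k. x = rep x \<otimes> ?w k" by (simp_all add: cos_def)
    then show "rep x \<in> carrier G" by simp
    show "x = rep x \<otimes> ?w (K x)" unfolding K_def by (rule someI_ex[OF ex])
  qed
  have "K (x \<otimes> ?w k) j = K x j + k j" if x: "x \<in> carrier G" and j: "j < r" for x k j
  proof -
    let ?y = "x \<otimes> ?w k"
    have yG: "?y \<in> carrier G" using x wG by simp
    have re: "rep ?y = rep x" using cos_eq[OF x] by (simp add: rep_def)
    have "rep x \<otimes> ?w (K ?y) = ?y" using rep(2)[OF yG] re by simp
    also have "\<dots> = rep x \<otimes> ?w (K x) \<otimes> ?w k" using rep(2)[OF x] by simp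
    also have "\<dots> = rep x \<otimes> ?w (\<lambda>i. K x i + k i)" using rep(1)[OF x] wG word_add[OF \<gamma>] by (simp add: m_assoc)
    finally have eq: "?w (K ?y) = ?w (\<lambda>i. K x i + k i)" using rep(1)[OF x] wG by simp
    have "?w (\<lambda>i. K ?y i + - (K x i + k i)) = ?w (K ?y) \<otimes> inv (?w (\<lambda>i. K x i + k i))"
      using word_add[OF \<gamma>, where r = r and k = "K ?y" and l = "\<lambda>i. - (K x i + k i)"]
        word_uminus[OF \<gamma>, where r = r and k = "\<lambda>i. K x i + k i"] by (simp only:)
    also have "\<dots> = \<one>" using eq wG by simp
    finally have "K ?y j + - (K x j + k j) = 0" using j by (rule ind)
    then show ?thesis by simp
  qed
  then show ?thesis by (intro exI[of _ "\<lambda>j x. K x j"]) blast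
qed

end

end

section \<open>An equivariant map from Euclidean space\<close>

text \<open>The integer congruent to \<open>b\<close> modulo 2 whose interval of radius 1, closed on
  the left and open on the right, contains \<open>s\<close>.\<close>

definition near :: "int \<Rightarrow> real \<Rightarrow> int" where
  "near b s = 2 * \<lfloor>(s - b + 1) / 2\<rfloor> + b"

text \<open>A bump of period 2 with value 1 at the integers congruent to \<open>b\<close> modulo 2
  and value 0 at the other integers. With the cosine the bumps of the two parities add up to
  1.\<close>

definition tent :: "int \<Rightarrow> real \<Rightarrow> real" where
  "tent b s = (1 + cos (pi * (s - b))) / 2"

lemma near_bounds:
  fixes s :: real
  shows "near b s - 1 \<le> s" "s < near b s + 1"
  using floor_correct[of "(s - b + 1) / 2"] by (auto simp: near_def field_simps)

lemma near_eqI: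
  fixes x s :: real
  assumes "near b s - 1 \<le> x" "x < near b s + 1"
  shows "near b x = near b s"
proof -
  have "\<lfloor>(x - b + 1) / 2\<rfloor> = \<lfloor>(s - b + 1) / 2\<rfloor>"
    by (rule floor_unique) (use assms in \<open>auto simp: near_def field_simps\<close>)
  then show ?thesis by (simp add: near_def)
qed

lemma near_shift:
  fixes s :: real
  shows "near b (s + 2 * of_int k) = near b s + 2 * k"
proof -
  have "(s + 2 * of_int k - b + 1) / 2 = (s - b + 1) / 2 + of_int k" by (simp add: field_simps)
  then show ?thesis unfolding near_def by (simp only: floor_add_int[symmetric]) simp
qed

lemma tent_nonneg:
  fixes s :: real
  shows "0 \<le> tent b s"
proof -
  have "- 1 \<le> cos (pi * (s - b))" by (rule cos_ge_minus_one)
  then have "0 \<le> 1 + cos (pi * (s - b))" by linarith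
  then show ?thesis unfolding tent_def by (rule divide_nonneg_nonneg) simp
qed

text \<open>The excluded point is the left end of the interval, the only place where
  \<open>near\<close> jumps. So \<open>near\<close> is locally constant where the tent is
  positive.\<close>

lemma tent_pos_near:
  fixes s :: real
  assumes "tent b s > 0" shows "near b s - 1 < s"
proof -
  have "s \<noteq> near b s - 1"
  proof
    assume "s = near b s - 1"
    then have "s - b = 2 * \<lfloor>(s - b + 1) / 2\<rfloor> - 1" by (simp add: near_def)
    then have "cos (pi * (s - b)) = cos (pi * (2 * \<lfloor>(s - b + 1) / 2\<rfloor> - 1))" by simp
    also have "\<dots> = - 1" by (simp add: right_diff_distrib cos_diff mult.assoc[symmetric] mult.commute[of pi])
    finally show False using assms by (simp add: tent_def)
  qed
  then show ?thesis using near_bounds(1)[of b s] by linarith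
qed

lemma tent_add:
  fixes s :: real
  shows "tent 0 s + tent 1 s = 1"
  by (simp add: tent_def right_diff_distrib cos_diff add_divide_distrib diff_divide_distrib)

lemma tent_shift:
  fixes s :: real
  shows "tent b (s + 2 * of_int k) = tent b s"
proof -
  have "pi * (s + 2 * of_int k - b) = pi * (s - b) + 2 * pi * of_int k" by (simp add: algebra_simps)
  then show ?thesis unfolding tent_def by (simp only: cos_add) simp
qed

lemma continuous_tent: "continuous_on UNIV (tent b)"
  unfolding tent_def by (intro continuous_intros) auto

definition parity :: "nat set \<Rightarrow> nat \<Rightarrow> int" where
  "parity X i = (if i \<in> X then 1 else 0)"

text \<open>\<open>X\<close> is the set of odd coordinates and thus names a class of lattice points
  modulo 2.\<close>

definition weight :: "nat \<Rightarrow> nat set \<Rightarrow> (nat \<Rightarrow> real) \<Rightarrow> real" where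
  "weight r X s = (\<Prod>i<r. tent (parity X i) (s i))"

lemma weight_nonneg: "0 \<le> weight r X s"
  unfolding weight_def by (intro prod_nonneg) (simp add: tent_nonneg)

lemma weight_pos: "0 < weight r X s \<Longrightarrow> i < r \<Longrightarrow> 0 < tent (parity X i) (s i)"
  unfolding weight_def using tent_nonneg by (metis finite_lessThan lessThan_iff less_eq_real_def less_irrefl prod_zero_iff)

text \<open>This is the product of the sums \<open>tent 0 (s i) + tent 1 (s i)\<close>, each equal
  to 1, multiplied out.\<close>

lemma sum_weight: "(\<Sum>X\<in>Pow {..<r}. weight r X s) = 1"
proof (induction r)
  case (Suc r)
  have cong: "weight r (insert r X) s = weight r X s" for X
    unfolding weight_def by (rule prod.cong) (auto simp: parity_def)
  have suc: "weight (Suc r) X s = weight r X s * tent (parity X r) (s r)" for X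
    by (simp add: weight_def)
  have "(\<Sum>X\<in>Pow {..<Suc r}. weight (Suc r) X s)
    = (\<Sum>X\<in>Pow {..<r}. weight (Suc r) X s) + (\<Sum>X\<in>insert r ` Pow {..<r}. weight (Suc r) X s)"
    unfolding lessThan_Suc Pow_insert by (rule sum.union_disjoint) auto
  also have "(\<Sum>X\<in>insert r ` Pow {..<r}. weight (Suc r) X s) = (\<Sum>X\<in>Pow {..<r}. weight (Suc r) (insert r X) s)"
    by (rule sum.reindex_cong[where l = "insert r"]) (auto simp: inj_on_def)
  also have "(\<Sum>X\<in>Pow {..<r}. weight (Suc r) X s) + \<dots>
    = (\<Sum>X\<in>Pow {..<r}. weight r X s * (tent (parity X r) (s r) + tent (parity (insert r X) r) (s r)))"
    unfolding sum.distrib[symmetric] by (intro sum.cong refl) (simp only: suc cong distrib_left)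
  also have "\<dots> = (\<Sum>X\<in>Pow {..<r}. weight r X s)"
    by (rule sum.cong) (auto simp: parity_def tent_add)
  finally show ?case using Suc.IH by simp
qed (simp add: weight_def)

lemma weight_shift: "weight r X (\<lambda>i. s i + 2 * of_int (k i)) = weight r X s"
  unfolding weight_def by (simp add: tent_shift)

lemma continuous_weight: "continuous_on UNIV (weight r X)"
proof -
  have "continuous_on UNIV (\<lambda>s :: nat \<Rightarrow> real. tent b (s i))" for b i
    by (rule continuous_on_compose2[OF continuous_tent continuous_on_product_coordinates]) simp
  then show ?thesis unfolding weight_def by (intro continuous_on_prod)
qed

context compact_topological_group
begin

context
  fixes A assumes sub: "subgroup A G" and comm: "\<forall>x\<in>A. \<forall>y\<in>A. x \<otimes> y = y \<otimes> x"
begin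

text \<open>One slot for each parity class of lattice points; within a class, distinct points have
  disjoint tents.\<close>

lemma lattice_equivariant_map:
  assumes \<gamma>: "\<And>i. i < r \<Longrightarrow> \<gamma> i \<in> A"
  shows "\<exists>Q. continuous_map euclidean (join_power T (2 ^ r - 1)) Q \<and>
    (\<forall>s k. Q (\<lambda>i. s i + 2 * real_of_int (k i)) = diag_action G (Q s) (word \<gamma> r (\<lambda>i. 2 * k i)))"
proof -
  define m :: nat where "m = 2 ^ r - 1"
  have "card (Pow {..<r}) = Suc m" by (simp add: m_def card_Pow)
  then have "\<exists>b. bij_betw b {0..<Suc m} (Pow {..<r})"
    using ex_bij_betw_nat_finite[of "Pow {..<r}"] by simp
  then obtain b where b: "bij_betw b {..m} (Pow {..<r})"
    by (auto simp: atLeast0LessThan lessThan_Suc_atMost)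
  \<comment> \<open>The group element of the lattice point of class \<open>b \<sigma>\<close> near
    \<open>s\<close>. Only even translations preserve the classes, hence the factor 2 in the
    equivariance.\<close>
  define el where "el \<sigma> s = word \<gamma> r (\<lambda>i. near (parity (b \<sigma>) i) (s i))" for \<sigma> s
  define Q where "Q s = (\<lambda>\<sigma>. if \<sigma> \<le> m \<and> 0 < weight r (b \<sigma>) s then Some (el \<sigma> s, weight r (b \<sigma>) s) else None)" for s
  have elG: "el \<sigma> s \<in> carrier G" for \<sigma> s
    unfolding el_def by (intro subG[OF sub comm] word_in[OF sub comm] \<gamma>)
  have coeff: "coeff_at (Q s) \<sigma> = weight r (b \<sigma>) s" if "\<sigma> \<le> m" for s \<sigma>
    using that weight_nonneg[of r "b \<sigma>" s] by (auto simp: coeff_at_def Q_def)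
  have "(\<Sum>\<sigma>\<le>m. coeff_at (Q s) \<sigma>) = 1" for s
  proof -
    have "(\<Sum>\<sigma>\<le>m. coeff_at (Q s) \<sigma>) = (\<Sum>\<sigma>\<le>m. weight r (b \<sigma>) s)" using coeff by simp
    also have "\<dots> = (\<Sum>X\<in>Pow {..<r}. weight r X s)" by (rule sum.reindex_bij_betw[OF b])
    finally show ?thesis by (simp add: sum_weight)
  qed
  then have Qin: "Q s \<in> topspace (join_power T m)" for s
    unfolding topspace_join_power topspace_eq convex_combs_def using elG by (auto simp: Q_def)
  have "continuous_map euclidean (join_power T m) Q"
  proof (rule continuous_map_into_join_power[OF compact Hausdorff])
    show "Q s \<in> topspace (join_power T m)" for s by (rule Qin)
    show "continuous_map euclidean euclideanreal (\<lambda>z. coeff_at (Q z) \<sigma>)" if "\<sigma> \<le> m" for \<sigma>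
      using continuous_weight by (simp add: coeff[OF that])
    show "openin euclidean {z \<in> topspace euclidean. Q z \<in> comb_slot \<sigma> U}" if \<sigma>: "\<sigma> \<le> m" for \<sigma> U
    proof -
      let ?P = "parity (b \<sigma>)"
      have "\<exists>V. open V \<and> s \<in> V \<and> V \<subseteq> {z. Q z \<in> comb_slot \<sigma> U}" if s: "Q s \<in> comb_slot \<sigma> U" for s
      proof -
        have pos: "0 < weight r (b \<sigma>) s" and elU: "el \<sigma> s \<in> U"
          using s by (auto simp: comb_slot_def Q_def split: if_splits)
        \<comment> \<open>The intervals are those on which \<open>near\<close> keeps its value, so
          \<open>el \<sigma>\<close> is constant on \<open>V\<close>.\<close>
        define V where "V = {z. 0 < weight r (b \<sigma>) z} \<inter>
          (\<Inter>i\<in>{..<r}. {z. z i \<in> {real_of_int (near (?P i) (s i)) - 1<..<near (?P i) (s i) + 1}})"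
        have "open {z. 0 < weight r (b \<sigma>) z}"
          by (rule open_Collect_less[OF continuous_on_const continuous_weight])
        moreover have "open {z :: nat \<Rightarrow> real. z i \<in> {a<..<c}}" for i a c
          using open_vimage[OF open_greaterThanLessThan continuous_on_product_coordinates[of i]]
          by (simp add: vimage_def)
        ultimately have "open V" unfolding V_def by (intro open_Int open_INT) auto
        moreover have "s \<in> V"
          using pos tent_pos_near[OF weight_pos[OF pos]] near_bounds(2) by (auto simp: V_def)
        moreover have "Q z \<in> comb_slot \<sigma> U" if z: "z \<in> V" for z
        proof -
          have "near (?P i) (z i) = near (?P i) (s i)" if "i < r" for i
            by (rule near_eqI) (use z that in \<open>auto simp: V_def less_imp_le\<close>)
          then have "el \<sigma> z = el \<sigma> s" unfolding el_def by (intro word_cong) auto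
          then show ?thesis using z \<sigma> elU by (auto simp: comb_slot_def Q_def V_def)
        qed
        ultimately show ?thesis by blast
      qed
      then have "open {z. Q z \<in> comb_slot \<sigma> U}" by (subst open_subopen) auto
      then show ?thesis by (simp add: open_openin[symmetric])
    qed
  qed
  moreover have "Q (\<lambda>i. s i + 2 * of_int (k i)) = diag_action G (Q s) (word \<gamma> r (\<lambda>i. 2 * k i))" for s k
  proof
    fix \<sigma>
    have "el \<sigma> (\<lambda>i. s i + 2 * of_int (k i)) = el \<sigma> s \<otimes> word \<gamma> r (\<lambda>i. 2 * k i)"
      unfolding el_def near_shift by (intro word_add[OF sub comm] \<gamma>)
    then show "Q (\<lambda>i. s i + 2 * of_int (k i)) \<sigma> = diag_action G (Q s) (word \<gamma> r (\<lambda>i. 2 * k i)) \<sigma>"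
      by (simp add: Q_def diag_action_def weight_shift)
  qed
  ultimately show ?thesis unfolding m_def by (intro exI[of _ Q] conjI allI)
qed

end

end

section \<open>Torsion-free totally disconnected groups\<close>

lemma dist_fun_le:
  fixes x y :: "nat \<Rightarrow> real"
  assumes "\<And>i. \<bar>x i - y i\<bar> \<le> d"
  shows "dist x y \<le> 2 * d"
proof -
  have s: "summable (\<lambda>n::nat. (1/2::real)^n)" by (rule summable_geometric) simp
  have tm: "(1/2)^n * min (dist (x (from_nat n)) (y (from_nat n))) 1 \<le> (1/2)^n * d" for n :: nat
    using assms[of "from_nat n"] by (intro mult_left_mono) (auto simp: dist_real_def)
  have "dist x y \<le> suminf (\<lambda>n. (1/2)^n * d)"
    unfolding dist_fun_def
  proof (rule suminf_le[OF tm])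
    show "summable (\<lambda>n. (1/2)^n * min (dist (x (from_nat n)) (y (from_nat n))) 1)"
      by (rule summable_comparison_test[OF _ s]) (auto intro!: exI[of _ 0] mult_left_le)
    show "summable (\<lambda>n. (1/2::real)^n * d)" by (rule summable_mult2[OF s])
  qed
  also have "\<dots> = 2 * d"
    using suminf_mult2[OF s, of d] suminf_geometric[of "1/2::real"] by simp
  finally show ?thesis .
qed

lemma periodic_uniformly_continuous:
  fixes t :: "(nat \<Rightarrow> real) \<Rightarrow> real"
  assumes t: "continuous_on UNIV t" and per: "\<And>s k. t (\<lambda>i. s i + 2 * real_of_int (k i)) = t s" and e: "e > 0"
  shows "\<exists>\<delta>>0. \<forall>s s'. (\<forall>j. s j \<le> s' j \<and> s' j \<le> s j + \<delta>) \<longrightarrow> \<bar>t s' - t s\<bar> < e"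
proof -
  \<comment> \<open>Both points are moved by the same even translation: the first to coordinates
    between 0 and 2, the second, at most 1 above it, to coordinates up to 3.\<close>
  define K where "K = PiE UNIV (\<lambda>_::nat. {0..3::real})"
  have "compactin (product_topology (\<lambda>_. euclidean) UNIV) K"
    unfolding K_def compactin_PiE by auto
  then have "compact K" unfolding euclidean_product_topology by simp
  then have "uniformly_continuous_on K t"
    using t continuous_on_subset compact_uniformly_continuous by blast
  then obtain d where d: "d > 0" "\<And>x x'. x \<in> K \<Longrightarrow> x' \<in> K \<Longrightarrow> dist x' x < d \<Longrightarrow> dist (t x') (t x) < e"
    unfolding uniformly_continuous_on_def using e by meson
  define \<delta> where "\<delta> = min 1 (d / 3)"
  have \<delta>: "\<delta> > 0" "\<delta> \<le> 1" "2 * \<delta> < d" using d(1) by (auto simp: \<delta>_def)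
  have "\<bar>t s' - t s\<bar> < e" if s: "\<forall>j. s j \<le> s' j \<and> s' j \<le> s j + \<delta>" for s s'
  proof -
    define k where "k i = - \<lfloor>s i / 2\<rfloor>" for i
    let ?x = "\<lambda>i. s i + 2 * real_of_int (k i)" and ?x' = "\<lambda>i. s' i + 2 * real_of_int (k i)"
    have fl: "2 * real_of_int \<lfloor>s i / 2\<rfloor> \<le> s i" "s i < 2 * real_of_int \<lfloor>s i / 2\<rfloor> + 2" for i
      using floor_correct[of "s i / 2"] by linarith+
    have "0 \<le> ?x i \<and> ?x i \<le> 3" "0 \<le> ?x' i \<and> ?x' i \<le> 3" for i
      using fl[of i] s[rule_format, of i] \<delta>(2) unfolding k_def by (simp_all; linarith)+
    then have "?x \<in> K" "?x' \<in> K" by (auto simp: K_def PiE_UNIV_domain)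
    moreover have "dist ?x' ?x \<le> 2 * \<delta>"
      by (rule dist_fun_le) (use s in \<open>auto simp: abs_le_iff algebra_simps\<close>)
    ultimately have "dist (t ?x') (t ?x) < e" using d(2) \<delta>(3) by (meson le_less_trans)
    then show ?thesis by (simp add: per dist_real_def)
  qed
  then show ?thesis using \<delta>(1) by blast
qed

lemma coeff_at_diag_action: "coeff_at (diag_action G c g) i = coeff_at c i"
  by (auto simp: coeff_at_def diag_action_def split: option.splits)

context compact_topological_group
begin

text \<open>As long as slot \<open>i\<close> is present its group element varies continuously,
  because \<open>comb_slot i U\<close> is an open condition for an open \<open>U\<close>; and a path
  in a totally disconnected space is constant.\<close>

lemma slot_constant_on_segment:
  fixes u v :: "nat \<Rightarrow> real"
  assumes H: "continuous_map euclidean (join_power T n) H"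
    and td: "\<And>S x y. connectedin T S \<Longrightarrow> x \<in> S \<Longrightarrow> y \<in> S \<Longrightarrow> x = y"
    and pos: "\<And>x. x \<in> {0..1} \<Longrightarrow> 0 < coeff_at (H (\<lambda>j::nat. (1 - x) * u j + x * v j)) i"
  shows "fst (the (H u i)) = fst (the (H v i))"
proof -
  define p where "p x = (\<lambda>j. (1 - x) * u j + x * v j)" for x :: real
  define c where "c x = fst (the (H (p x) i))" for x
  have pc: "continuous_on {0..1} p" unfolding p_def
    by (intro continuous_on_coordinatewise_then_product continuous_intros)
  have "continuous_map (top_of_set {0..1}) euclidean p" using pc by simp
  from continuous_map_compose_app[OF this H] have Hp: "continuous_map (top_of_set {0..1}) (join_power T n) (\<lambda>x. H (p x))" .
  have some: "\<exists>t. H (p x) i = Some (c x, t)" if "x \<in> {0..1}" for x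
    using pos[OF that] by (auto simp: c_def p_def coeff_at_def split: option.splits)
  have HT: "H s \<in> topspace (join_power T n)" for s
    using continuous_map_image_subset_topspace[OF H] by auto
  have "continuous_map (top_of_set {0..1}) T c"
    unfolding continuous_map_def
  proof (intro conjI allI impI)
    show "c \<in> topspace (top_of_set {0..1}) \<rightarrow> topspace T"
      using some join_power_in(1)[OF HT] by fastforce
    fix U assume U: "openin T U"
    have "{x \<in> topspace (top_of_set {0..1}). c x \<in> U}
      = {x \<in> topspace (top_of_set {0..1}). H (p x) \<in> topspace (join_power T n) \<inter> comb_slot i U}"
    proof (intro Collect_cong conj_cong refl)
      fix x assume "x \<in> topspace (top_of_set {0..1::real})"
      then obtain t where "H (p x) i = Some (c x, t)" using some[of x] by auto
      then show "(c x \<in> U) = (H (p x) \<in> topspace (join_power T n) \<inter> comb_slot i U)"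
        using HT by (simp add: comb_slot_def)
    qed
    then show "openin (top_of_set {0..1}) {x \<in> topspace (top_of_set {0..1}). c x \<in> U}"
      using openin_continuous_map_preimage[OF Hp openin_comb_slot[OF U]] by simp
  qed
  moreover have "connectedin (top_of_set {0..1}) {0..1::real}"
    by (simp add: connectedin_absolute connectedin_subtopology)
  ultimately have "connectedin T (c ` {0..1})" by (rule connectedin_continuous_map_image)
  then have "c 0 = c 1" by (rule td) auto
  moreover have "p 0 = u" "p 1 = v" by (simp_all add: p_def)
  ultimately show ?thesis by (simp add: c_def)
qed

lemma no_torsion_free_totally_disconnected:
  assumes maps: "\<And>m. n \<le> m \<Longrightarrow> \<exists>F. continuous_map (join_power T m) (join_power T n) F \<and>
      equivariant_map G (topspace (join_power T m)) F"
    and tf: "\<And>h q. h \<in> carrier G \<Longrightarrow> h \<noteq> \<one> \<Longrightarrow> q > 0 \<Longrightarrow> h [^] (q::nat) \<noteq> \<one>"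
    and td: "\<And>S x y. connectedin T S \<Longrightarrow> x \<in> S \<Longrightarrow> y \<in> S \<Longrightarrow> x = y"
    and g: "g \<in> carrier G" "g \<noteq> \<one>"
  shows False
proof -
  \<comment> \<open>As many independent elements as \<open>E_n\<close> has slots, so that slot
    \<open>i\<close> can be read through the \<open>i\<close>-th coordinate.\<close>
  define r where "r = Suc n"
  have "\<exists>A. subgroup A G \<and> (\<forall>x\<in>A. \<forall>y\<in>A. x \<otimes> y = y \<otimes> x) \<and> uncountable A"
    by (rule uncountable_abelian_subgroup[OF g(1)]) (rule tf[OF g])
  then obtain A where A: "subgroup A G" "\<forall>x\<in>A. \<forall>y\<in>A. x \<otimes> y = y \<otimes> x" "uncountable A" by (elim exE conjE)
  have "\<exists>\<gamma>. (\<forall>i<r. \<gamma> i \<in> A) \<and> (\<forall>k. word \<gamma> r k = \<one> \<longrightarrow> (\<forall>i<r. k i = 0))"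
    by (rule independent_family[OF A tf])
  then obtain \<gamma> where \<gamma>: "\<forall>i<r. \<gamma> i \<in> A" "\<forall>k. word \<gamma> r k = \<one> \<longrightarrow> (\<forall>i<r. k i = 0)" by (elim exE conjE)
  have "\<exists>\<psi>. \<forall>x\<in>carrier G. \<forall>k. \<forall>j<r. \<psi> j (x \<otimes> word \<gamma> r k) = \<psi> j x + (k j :: int)"
    by (rule coordinates[OF A(1,2)]) (use \<gamma> in auto)
  then obtain \<psi> where \<psi>: "\<forall>x\<in>carrier G. \<forall>k. \<forall>j<r. \<psi> j (x \<otimes> word \<gamma> r k) = \<psi> j x + (k j :: int)" by (elim exE)
  have "\<exists>Q. continuous_map euclidean (join_power T (2 ^ r - 1)) Q \<and>
    (\<forall>s k. Q (\<lambda>i. s i + 2 * real_of_int (k i)) = diag_action G (Q s) (word \<gamma> r (\<lambda>i. 2 * k i)))"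
    by (rule lattice_equivariant_map[OF A(1,2)]) (use \<gamma> in auto)
  then obtain Q where Q: "continuous_map euclidean (join_power T (2 ^ r - 1)) Q"
    and Qs: "\<forall>s k. Q (\<lambda>i. s i + 2 * real_of_int (k i)) = diag_action G (Q s) (word \<gamma> r (\<lambda>i. 2 * k i))"
    by (elim exE conjE)
  have "n < 2 ^ n" by (rule less_exp)
  then have "n \<le> 2 ^ r - 1" unfolding r_def power_Suc by linarith
  from maps[OF this] obtain F where F: "continuous_map (join_power T (2 ^ r - 1)) (join_power T n) F"
    and Fe: "equivariant_map G (topspace (join_power T (2 ^ r - 1))) F" by (elim exE conjE)
  define H where "H s = F (Q s)" for s
  have H: "continuous_map euclidean (join_power T n) H"
    unfolding H_def by (rule continuous_map_compose_app[OF Q F])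
  have wG: "word \<gamma> r k \<in> carrier G" for k
    by (intro subG[OF A(1,2)] word_in[OF A(1,2)]) (use \<gamma> in auto)
  have QT: "Q s \<in> topspace (join_power T (2 ^ r - 1))" for s
    using continuous_map_image_subset_topspace[OF Q] by auto
  have Hs: "H (\<lambda>i. s i + 2 * real_of_int (k i)) = diag_action G (H s) (word \<gamma> r (\<lambda>i. 2 * k i))" for s k
    using Fe QT wG unfolding H_def Qs[rule_format] equivariant_map_def by blast
  have HT: "H s \<in> topspace (join_power T n)" for s
    using continuous_map_image_subset_topspace[OF H] by auto
  define t where "t i s = coeff_at (H s) i" for i s
  have tc: "continuous_on UNIV (t i)" for i
    using continuous_map_compose_app[OF H continuous_map_coeff_at] by (simp add: t_def[abs_def])
  have ts: "t i (\<lambda>i. s i + 2 * real_of_int (k i)) = t i s" for i s k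
    by (simp add: t_def Hs coeff_at_diag_action)
  \<comment> \<open>Where slot \<open>i\<close> is absent, the floor is a substitute that behaves in
    the same way under even translations. The final contradiction compares only points where the
    slot is present.\<close>
  define f where "f i s = (if 0 < t i s then \<psi> i (fst (the (H s i))) else \<lfloor>s i\<rfloor>)" for i s
  have fs: "f i (\<lambda>i. s i + 2 * real_of_int (k i)) = f i s + 2 * k i" if i: "i < r" for i s k
  proof (cases "0 < t i s")
    case True
    then obtain h a where h: "H s i = Some (h, a)" by (auto simp: t_def coeff_at_def split: option.splits)
    have "h \<in> carrier G" using join_power_in(1)[OF HT h] topspace_eq by simp
    then show ?thesis using True h i \<psi> unfolding f_def ts Hs by (simp add: diag_action_def)
  next
    case False
    have "\<lfloor>s i + 2 * real_of_int (k i)\<rfloor> = \<lfloor>s i + real_of_int (2 * k i)\<rfloor>" by simp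
    also have "\<dots> = \<lfloor>s i\<rfloor> + 2 * k i" by (rule floor_add_int[symmetric])
    finally show ?thesis using False unfolding f_def ts by simp
  qed
  have "\<forall>i. \<exists>\<delta>>0. \<forall>s s'. (\<forall>j. s j \<le> s' j \<and> s' j \<le> s j + \<delta>) \<longrightarrow> \<bar>t i s' - t i s\<bar> < 1 / r"
    by (intro allI periodic_uniformly_continuous tc ts) (simp add: r_def)
  then obtain d where d: "\<forall>i. d i > 0 \<and> (\<forall>s s'. (\<forall>j. s j \<le> s' j \<and> s' j \<le> s j + d i) \<longrightarrow> \<bar>t i s' - t i s\<bar> < 1 / r)"
    by (rule choice[THEN exE]) blast
  define \<delta> where "\<delta> = Min (d ` {..n})"
  have \<delta>: "\<delta> > 0" "\<And>i. i \<le> n \<Longrightarrow> \<delta> \<le> d i" using d by (auto simp: \<delta>_def)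
  obtain N where N: "1 / Suc N < \<delta>" using nat_approx_posE[OF \<delta>(1)] by blast
  let ?N = "real (Suc N)"
  \<comment> \<open>The grid has mesh \<open>1 / ?N\<close>, below the \<open>\<delta>\<close>
    within which every weight changes by less than \<open>1 / r\<close>.\<close>
  define pt where "pt q = (\<lambda>j. if j < r then real (q j) / ?N else 0)" for q :: "nat \<Rightarrow> nat"
  \<comment> \<open>The grid points of a fundamental domain. The difference between
    \<open>f i\<close> and the \<open>i\<close>-th coordinate has period 2 in every direction, so
    its maximum on this finite set bounds it on the whole grid.\<close>
  define S where "S = {..<r} \<times> PiE {..<r} (\<lambda>_. {..<2 * Suc N})"
  have "finite S" unfolding S_def by (intro finite_cartesian_product finite_PiE) auto
  then have "bdd_above ((\<lambda>(i, q). \<bar>f i (pt q) - pt q i\<bar>) ` S)" by (intro bdd_above_finite finite_imageI)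
  then obtain B where B': "\<forall>z\<in>(\<lambda>(i, q). \<bar>f i (pt q) - pt q i\<bar>) ` S. z \<le> B"
    unfolding bdd_above_def by (elim exE)
  have B: "\<bar>f i (pt q) - pt q i\<bar> \<le> B" if "(i, q) \<in> S" for i q
    using bspec[OF B' imageI[OF that]] by simp
  have bound: "\<bar>f i (pt q) - pt q i\<bar> \<le> B" if i: "i < r" for i q
  proof -
    define q0 where "q0 = restrict (\<lambda>j. q j mod (2 * Suc N)) {..<r}"
    define k where "k j = (if j < r then int (q j div (2 * Suc N)) else 0)" for j
    have "pt q = (\<lambda>j. pt q0 j + 2 * real_of_int (k j))"
    proof
      fix j
      have "real (q j) = real (q j mod (2 * Suc N)) + 2 * ?N * real (q j div (2 * Suc N))"
        using arg_cong[OF mod_mult_div_eq[of "q j" "2 * Suc N"], of real]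
        by (simp only: of_nat_add of_nat_mult of_nat_numeral)
      then show "pt q j = pt q0 j + 2 * real_of_int (k j)"
        by (simp add: pt_def q0_def k_def field_simps del: of_nat_Suc)
    qed
    then have "f i (pt q) - pt q i = f i (pt q0) - pt q0 i" using fs[OF i, of "pt q0" k] by simp
    moreover have "(i, q0) \<in> S" using i by (auto simp: S_def q0_def)
    ultimately show ?thesis using B by simp
  qed
  \<comment> \<open>The cube has side \<open>p / ?N > 2 * B\<close>. So \<open>f i\<close> is at
    most \<open>B\<close> on the face where coordinate \<open>i\<close> is 0, and at least
    \<open>p / ?N - B\<close>, hence above \<open>B\<close>, on the opposite face. These are the
    boundary labels for Kuhn's cubical form of Sperner's lemma.\<close>
  obtain p where p: "2 * \<bar>B\<bar> * ?N < real p" using reals_Archimedean2 by blast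
  have p0: "0 < p" using p by (cases p) (auto simp: mult_less_0_iff)
  define label where "label x i = (if B < f i (pt x) then 1 else 0 :: nat)" for x i
  have "\<exists>q. (\<forall>i<r. \<exists>a b. (\<forall>j<r. q j \<le> a j \<and> a j \<le> q j + 1) \<and>
    (\<forall>j<r. q j \<le> b j \<and> b j \<le> q j + 1) \<and> label a i \<noteq> label b i)"
  proof (rule kuhn_lemma[OF p0, of r label])
    show "\<forall>x::nat \<Rightarrow> nat. (\<forall>i<r. x i \<le> p) \<longrightarrow> (\<forall>i<r. label x i = 0 \<or> label x i = 1)" by (simp add: label_def)
    show "\<forall>x::nat \<Rightarrow> nat. (\<forall>i<r. x i \<le> p) \<longrightarrow> (\<forall>i<r. x i = 0 \<longrightarrow> label x i = 0)"
    proof (intro allI impI)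
      fix x :: "nat \<Rightarrow> nat" and i assume "i < r" "x i = 0"
      then show "label x i = 0" using bound[of i x] by (simp add: label_def pt_def)
    qed
    show "\<forall>x::nat \<Rightarrow> nat. (\<forall>i<r. x i \<le> p) \<longrightarrow> (\<forall>i<r. x i = p \<longrightarrow> label x i = 1)"
    proof (intro allI impI)
      fix x :: "nat \<Rightarrow> nat" and i assume i: "i < r" "x i = p"
      have "2 * B * ?N \<le> 2 * \<bar>B\<bar> * ?N" by (intro mult_right_mono) auto
      then have "2 * B * ?N < real p" using p by linarith
      then have "2 * B < real p / ?N" by (simp only: pos_less_divide_eq of_nat_0_less_iff zero_less_Suc)
      moreover have "pt x i = real p / ?N" using i by (simp add: pt_def)
      ultimately show "label x i = 1" using bound[OF i(1), of x] by (simp add: label_def)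
    qed
  qed blast
  then obtain q where q: "\<forall>i<r. \<exists>a b. (\<forall>j<r. q j \<le> a j \<and> a j \<le> q j + 1) \<and>
    (\<forall>j<r. q j \<le> b j \<and> b j \<le> q j + 1) \<and> label a i \<noteq> label b i" by (elim exE)
  \<comment> \<open>One of \<open>r = n + 1\<close> weights with sum 1 is at least
    \<open>1 / r\<close>. It stays positive throughout the cell, so the element in slot
    \<open>i\<close> is the same at \<open>a\<close> and \<open>b\<close>, although label
    \<open>i\<close> differs there.\<close>
  have "\<exists>i\<le>n. 1 / r \<le> t i (pt q)"
  proof (rule ccontr)
    assume "\<not> ?thesis"
    then have "(\<Sum>i\<le>n. t i (pt q)) < (\<Sum>i\<le>n. 1 / r)" by (intro sum_strict_mono) auto
    moreover have "(\<Sum>i\<le>n. t i (pt q)) = 1"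
      using HT[of "pt q"] unfolding topspace_join_power convex_combs_def t_def by simp
    ultimately show False by (simp add: r_def)
  qed
  then obtain i where i: "i \<le> n" "1 / r \<le> t i (pt q)" by blast
  then have ir: "i < r" by (simp add: r_def)
  from q[rule_format, OF ir] obtain a b where ab: "\<forall>j<r. q j \<le> a j \<and> a j \<le> q j + 1"
    "\<forall>j<r. q j \<le> b j \<and> b j \<le> q j + 1" "label a i \<noteq> label b i" by (elim exE conjE)
  have cell: "pt q j \<le> pt x j \<and> pt x j \<le> pt q j + 1 / ?N" if "\<forall>j<r. q j \<le> x j \<and> x j \<le> q j + 1" for x j
  proof (cases "j < r")
    case True
    then have "real (q j) \<le> real (x j)" "real (x j) \<le> real (q j) + 1" using that by auto
    then show ?thesis using True by (simp add: pt_def divide_right_mono add_divide_distrib[symmetric] del: of_nat_Suc)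
  qed (simp add: pt_def)
  have pos: "0 < t i (\<lambda>j. (1 - x) * pt a j + x * pt b j)" if x: "x \<in> {0..1}" for x
  proof -
    have "pt q j \<le> (1 - x) * pt a j + x * pt b j \<and> (1 - x) * pt a j + x * pt b j \<le> pt q j + d i" for j
    proof -
      have "(1 - x) * pt q j + x * pt q j \<le> (1 - x) * pt a j + x * pt b j"
        using x cell[OF ab(1), of j] cell[OF ab(2), of j] by (intro add_mono mult_left_mono) auto
      moreover have "(1 - x) * pt a j + x * pt b j \<le> (1 - x) * (pt q j + 1 / ?N) + x * (pt q j + 1 / ?N)"
        using x cell[OF ab(1), of j] cell[OF ab(2), of j] by (intro add_mono mult_left_mono) auto
      moreover have "(1 - x) * y + x * y = y" for y :: real by (simp add: algebra_simps)
      ultimately show ?thesis using N \<delta>(2)[OF i(1)] by (smt (verit))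
    qed
    then have "\<bar>t i (\<lambda>j. (1 - x) * pt a j + x * pt b j) - t i (pt q)\<bar> < 1 / r"
      by (intro d[rule_format, THEN conjunct2, rule_format]) auto
    then show ?thesis using i(2) by linarith
  qed
  have "fst (the (H (pt a) i)) = fst (the (H (pt b) i))"
    by (rule slot_constant_on_segment[OF H td pos[unfolded t_def]])
  moreover have "0 < t i (pt a)" "0 < t i (pt b)" using pos[of 0] pos[of 1] by simp_all
  ultimately have "f i (pt a) = f i (pt b)" by (simp add: f_def)
  then show False using ab(3) by (simp add: label_def)
qed

end

section \<open>Iterated maps between join powers, and the case distinction\<close>

lemma (in compact_topological_group) join_power_maps:
  assumes f: "continuous_map (join_power T (Suc n)) (join_power T n) f"
      "equivariant_map G (topspace (join_power T (Suc n))) f"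
    and m: "n \<le> m"
  shows "\<exists>F. continuous_map (join_power T m) (join_power T n) F \<and> equivariant_map G (topspace (join_power T m)) F"
proof -
  let ?eq = "\<lambda>k l F. continuous_map (join_power T k) (join_power T l) F \<and> equivariant_map G (topspace (join_power T k)) F"
  have succ: "\<exists>F. ?eq (Suc k) k F" if "n \<le> k" for k
    using that
  proof (induction k rule: dec_induct)
    case base
    then show ?case using f by (intro exI[of _ f] conjI)
  next
    case (step k)
    from step.IH obtain F where F: "continuous_map (join_power T (Suc k)) (join_power T k) F"
      "equivariant_map G (topspace (join_power T (Suc k))) F" by (elim exE conjE)
    show ?case by (rule join_power_step_map[OF F]) (simp add: topspace_eq)
  qed
  show ?thesis
    using m
  proof (induction m rule: dec_induct)
    case base
    show ?case by (intro exI[of _ "\<lambda>c. c"]) (simp add: equivariant_map_def)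
  next
    case (step m)
    from step.IH obtain F where F: "continuous_map (join_power T m) (join_power T n) F"
      "equivariant_map G (topspace (join_power T m)) F" by (elim exE conjE)
    from step(1) have "\<exists>F. ?eq (Suc m) m F" by (rule succ)
    then obtain F' where F': "continuous_map (join_power T (Suc m)) (join_power T m) F'"
      "equivariant_map G (topspace (join_power T (Suc m))) F'" by (elim exE conjE)
    have "F' c \<in> topspace (join_power T m)" if "c \<in> topspace (join_power T (Suc m))" for c
      using continuous_map_image_subset_topspace[OF F'(1)] that by blast
    then have "equivariant_map G (topspace (join_power T (Suc m))) (\<lambda>c. F (F' c))"
      using F(2) F'(2) unfolding equivariant_map_def by simp
    then show ?case using continuous_map_compose_app[OF F'(1) F(1)] by (intro exI[of _ "\<lambda>c. F (F' c)"] conjI)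
  qed
qed

theorem theorem1p1:
  fixes G :: "('a, 'b) monoid_scheme" and T :: "'a topology" and n :: nat
  assumes "topological_group G T"
    and "compact_space T" and "Hausdorff_space T"
    and "carrier G \<noteq> {\<one>\<^bsub>G\<^esub>}"
    and "n \<ge> 1"
  shows "\<not> (\<exists>f. continuous_map (join_power T (n + 1)) (join_power T n) f \<and>
               equivariant_map G (topspace (join_power T (n + 1))) f)"
proof
  assume "\<exists>f. continuous_map (join_power T (n + 1)) (join_power T n) f \<and>
    equivariant_map G (topspace (join_power T (n + 1))) f"
  then obtain f where f: "continuous_map (join_power T (Suc n)) (join_power T n) f"
    "equivariant_map G (topspace (join_power T (Suc n))) f" unfolding Suc_eq_plus1 by (elim exE conjE)
  interpret compact_topological_group G T
    using assms(1-3) by (simp add: compact_topological_group_def compact_topological_group_axioms_def)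
  note maps = join_power_maps[OF f]
  have tf: "h [^]\<^bsub>G\<^esub> q \<noteq> \<one>\<^bsub>G\<^esub>" if "h \<in> carrier G" "h \<noteq> \<one>\<^bsub>G\<^esub>" "q > 0" for h and q :: nat
    using no_torsion_element[OF maps that] by blast
  have comp: "h = \<one>\<^bsub>G\<^esub>" if h: "h \<in> connected_component_of_set T \<one>\<^bsub>G\<^esub>" for h
    by (rule connected_component_trivial[OF _ h]) (rule no_irrational_eigenfunction[OF maps])
  have td: "x = y" if S: "connectedin T S" and x: "x \<in> S" and y: "y \<in> S" for S x y
  proof -
    have xG: "x \<in> carrier G" and yG: "y \<in> carrier G"
      using connectedin_subset_topspace[OF S] x y topspace_eq by auto
    have "connectedin T ((\<lambda>z. inv\<^bsub>G\<^esub> x \<otimes>\<^bsub>G\<^esub> z) ` S)"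
      by (rule connectedin_continuous_map_image[OF continuous_left_mult S]) (use xG in simp)
    moreover have "\<one>\<^bsub>G\<^esub> \<in> (\<lambda>z. inv\<^bsub>G\<^esub> x \<otimes>\<^bsub>G\<^esub> z) ` S" using x xG by (intro image_eqI[of _ _ x]) simp_all
    ultimately have "(\<lambda>z. inv\<^bsub>G\<^esub> x \<otimes>\<^bsub>G\<^esub> z) ` S \<subseteq> connected_component_of_set T \<one>\<^bsub>G\<^esub>"
      by (rule connected_component_of_maximal)
    then have "inv\<^bsub>G\<^esub> x \<otimes>\<^bsub>G\<^esub> y = \<one>\<^bsub>G\<^esub>" using y comp by blast
    then show ?thesis using xG yG by (simp add: inv_solve_left')
  qed
  obtain g where g: "g \<in> carrier G" "g \<noteq> \<one>\<^bsub>G\<^esub>" using assms(4) one_closed by blast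
  show False
    by (rule no_torsion_free_totally_disconnected[where n = n and g = g]) (fact maps tf td g)+
qed

end
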